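(* Let $t\ge 2$, $q,s\ge 1$ and $k_i\ge 4$ $(1\le i\le t)$ be integers, and let $G\cong K_1\vee (C_{k_1}\cup C_{k_2}\cup\cdots \cup C_{k_t}\cup qK_2\cup sK_1)$ have at least $33$ vertices. If every $k_i$ is odd, then $G$ is DQS.
   Context: All graphs are finite, simple and undirected. $C_n$, $K_n$ denote the cycle and complete graph on $n$ vertices; $\cup$ is disjoint union, $rH$ is the disjoint union of $r$ copies of $H$, and $\vee$ is the join (add all edges between the two graphs). The signless Laplacian matrix of $G$ is $Q(G)=D(G)+A(G)$, where $D(G)$ is the diagonal matrix of vertex degrees and $A(G)$ the adjacency matrix. The $Q$-spectrum is the multiset of eigenvalues of $Q(G)$. Two graphs are $Q$-cospectral if they have the same $Q$-spectrum; $G$ is DQS if every graph $Q$-cospectral with $G$ is isomorphic to $G$. *)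

theory Defs
  imports
    "Graph_Theory.Pair_Digraph"
    "Graph_Theory.Digraph_Isomorphism"
    "Jordan_Normal_Form.Char_Poly"
    "HOL-Computational_Algebra.Fundamental_Theorem_Algebra"
begin

text \<open>
  A finite simple undirected graph is a \<^locale>\<open>pair_graph\<close>: a finite vertex set together with a
  finite, symmetric, irreflexive set of ordered pairs (each edge is present in both directions).
  Isomorphism is \<^const>\<open>digraph_iso\<close>, applied through the coercion \<^const>\<open>with_proj\<close>.
\<close>

section \<open>Graph constructions\<close>

definition complete_graph :: "nat \<Rightarrow> nat pair_pre_digraph" where
  "complete_graph n = \<lparr> pverts = {..<n}, parcs = {(i, j). i < n \<and> j < n \<and> i \<noteq> j} \<rparr>"

text \<open>Only meaningful for \<open>n \<ge> 3\<close> (for \<open>n = 1\<close> the formula gives a loop).\<close>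

definition cycle_graph :: "nat \<Rightarrow> nat pair_pre_digraph" where
  "cycle_graph n = \<lparr> pverts = {..<n},
     parcs = {(i, j). i < n \<and> j < n \<and> (j = (i + 1) mod n \<or> i = (j + 1) mod n)} \<rparr>"

definition disjoint_union ::
    "'a pair_pre_digraph \<Rightarrow> 'b pair_pre_digraph \<Rightarrow> ('a + 'b) pair_pre_digraph" where
  "disjoint_union G H = \<lparr> pverts = pverts G <+> pverts H,
     parcs = {(Inl u, Inl v) | u v. (u, v) \<in> parcs G} \<union> {(Inr u, Inr v) | u v. (u, v) \<in> parcs H} \<rparr>"

definition disjoint_Union ::
    "'i set \<Rightarrow> ('i \<Rightarrow> 'a pair_pre_digraph) \<Rightarrow> ('i \<times> 'a) pair_pre_digraph" where
  "disjoint_Union I G = \<lparr> pverts = (SIGMA i:I. pverts (G i)),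
     parcs = {((i, u), (i, v)) | i u v. i \<in> I \<and> (u, v) \<in> parcs (G i)} \<rparr>"

definition copies :: "nat \<Rightarrow> 'a pair_pre_digraph \<Rightarrow> (nat \<times> 'a) pair_pre_digraph" where
  "copies r H = disjoint_Union {..<r} (\<lambda>_. H)"

definition graph_join ::
    "'a pair_pre_digraph \<Rightarrow> 'b pair_pre_digraph \<Rightarrow> ('a + 'b) pair_pre_digraph" where
  "graph_join G H = \<lparr> pverts = pverts G <+> pverts H,
     parcs = parcs (disjoint_union G H)
       \<union> {(Inl u, Inr v) | u v. u \<in> pverts G \<and> v \<in> pverts H}
       \<union> {(Inr v, Inl u) | u v. u \<in> pverts G \<and> v \<in> pverts H} \<rparr>"

lemma pair_graphI:
  assumes "finite (pverts G)" "parcs G \<subseteq> pverts G \<times> pverts G" "irrefl (parcs G)" "sym (parcs G)"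
  shows "pair_graph G"
proof
  show "finite (parcs G)"
    using assms(1,2) by (meson finite_SigmaI finite_subset)
qed (use assms in \<open>auto simp: symmetric_def irrefl_def\<close>)

lemma pair_graph_iff:
  "pair_graph G \<longleftrightarrow>
     finite (pverts G) \<and> parcs G \<subseteq> pverts G \<times> pverts G \<and> irrefl (parcs G) \<and> sym (parcs G)"
proof
  assume "pair_graph G"
  then interpret pair_graph G .
  have "sym (parcs G)"
    using pair_sym_arcs by (simp add: symmetric_def)
  moreover have "irrefl (parcs G)"
    using pair_no_loops by (force simp: irrefl_def)
  moreover have "parcs G \<subseteq> pverts G \<times> pverts G"
    using in_arcsD1 in_arcsD2 by auto
  ultimately show "finite (pverts G) \<and> parcs G \<subseteq> pverts G \<times> pverts G \<and> irrefl (parcs G) \<and> sym (parcs G)"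
    using pair_finite_verts by blast
qed (auto intro: pair_graphI)

lemma pair_graph_complete_graph: "pair_graph (complete_graph n)"
  by (auto simp: pair_graph_iff complete_graph_def irrefl_def sym_def)

lemma pair_graph_cycle_graph:
  assumes "n \<ge> 3" shows "pair_graph (cycle_graph n)"
proof -
  have "(i + 1) mod n \<noteq> i" if "i < n" for i
    using that assms by (cases "i + 1 = n") auto
  then show ?thesis
    by (force simp: pair_graph_iff cycle_graph_def irrefl_def sym_def)
qed

lemma pair_graph_disjoint_union:
  "pair_graph G \<Longrightarrow> pair_graph H \<Longrightarrow> pair_graph (disjoint_union G H)"
  unfolding pair_graph_iff disjoint_union_def irrefl_def sym_def by fastforce

lemma pair_graph_disjoint_Union:
  "finite I \<Longrightarrow> (\<And>i. i \<in> I \<Longrightarrow> pair_graph (G i)) \<Longrightarrow> pair_graph (disjoint_Union I G)"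
  unfolding pair_graph_iff disjoint_Union_def irrefl_def sym_def by fastforce

lemma pair_graph_copies: "pair_graph H \<Longrightarrow> pair_graph (copies r H)"
  by (simp add: copies_def pair_graph_disjoint_Union)

lemma pair_graph_graph_join:
  "pair_graph G \<Longrightarrow> pair_graph H \<Longrightarrow> pair_graph (graph_join G H)"
  unfolding pair_graph_iff graph_join_def disjoint_union_def irrefl_def sym_def by fastforce

section \<open>The signless Laplacian and its spectrum\<close>

text \<open>
  Matrices are taken with respect to a list \<open>vs\<close> enumerating the vertices without repetition.
\<close>

definition adjacency_matrix :: "'a pair_pre_digraph \<Rightarrow> 'a list \<Rightarrow> real mat" where
  "adjacency_matrix G vs =
     mat (length vs) (length vs) (\<lambda>(i, j). if (vs ! i, vs ! j) \<in> parcs G then 1 else 0)"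

definition degree_matrix :: "'a pair_pre_digraph \<Rightarrow> 'a list \<Rightarrow> real mat" where
  "degree_matrix G vs =
     mat (length vs) (length vs) (\<lambda>(i, j). if i = j then real (out_degree G (vs ! i)) else 0)"

definition signless_laplacian :: "'a pair_pre_digraph \<Rightarrow> 'a list \<Rightarrow> real mat" where
  "signless_laplacian G vs = degree_matrix G vs + adjacency_matrix G vs"

text \<open>
  The multiset of all (complex) eigenvalues with algebraic multiplicity. The enumeration chosen
  by \<open>SOME\<close> is irrelevant, see \<open>Q_spectrum_eq\<close> below.
\<close>

definition Q_spectrum :: "'a pair_pre_digraph \<Rightarrow> complex multiset" where
  "Q_spectrum G =
     (let vs = (SOME vs. distinct vs \<and> set vs = pverts G)
      in proots (char_poly (map_mat complex_of_real (signless_laplacian G vs))))"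

definition Q_cospectral :: "'a pair_pre_digraph \<Rightarrow> 'b pair_pre_digraph \<Rightarrow> bool" where
  "Q_cospectral G H \<longleftrightarrow> Q_spectrum G = Q_spectrum H"

text \<open>
  A definition cannot quantify over types, so the vertex type \<open>'b\<close> of the competing graphs is a
  parameter; leaving it free in a theorem makes them range over graphs on arbitrary vertex types.
\<close>

definition DQS :: "'b itself \<Rightarrow> 'a pair_pre_digraph \<Rightarrow> bool" where
  "DQS _ G \<longleftrightarrow>
     (\<forall>H :: 'b pair_pre_digraph. pair_graph H \<longrightarrow> Q_cospectral H G \<longrightarrow> digraph_iso H G)"

lemma similar_mat_reorder:
  fixes f :: "'a \<Rightarrow> 'a \<Rightarrow> 'b :: comm_ring_1"
  assumes "distinct vs" "distinct ws" "set vs = set ws"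
  shows "similar_mat (mat (length vs) (length vs) (\<lambda>(i, j). f (vs ! i) (vs ! j)))
                     (mat (length ws) (length ws) (\<lambda>(i, j). f (ws ! i) (ws ! j)))"
proof -
  define n where "n = length vs"
  have lw: "length ws = n"
    using assms by (metis n_def distinct_card)
  define P where "P = (\<lambda>(vs :: 'a list) ws. mat n n (\<lambda>(i, j). if vs ! i = ws ! j then 1 else (0::'b)))"
  define M where "M = (\<lambda>vs. mat n n (\<lambda>(i, j). f (vs ! i) (vs ! j)))"
  have sum_nth: "(\<Sum>k<n. g (us ! k)) = sum g (set us)"
    if "distinct us" "length us = n" for us and g :: "'a \<Rightarrow> 'b"
    using sum.reindex_bij_betw[OF bij_betw_nth[OF that(1) refl refl], of g] that(2) by simp
  have PP: "P us zs * P zs us = 1\<^sub>m n"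
    if "distinct us" "distinct zs" "set us = set zs" "length us = n" "length zs = n" for us zs :: "'a list"
  proof (rule eq_matI)
    fix i j assume "i < dim_row (1\<^sub>m n)" "j < dim_col (1\<^sub>m n)"
    then have ij: "i < n" "j < n" by auto
    then have "(P us zs * P zs us) $$ (i, j) =
        (\<Sum>k<n. (if us ! i = zs ! k then 1 else 0) * (if zs ! k = us ! j then 1 else (0::'b)))"
      by (simp add: P_def scalar_prod_def atLeast0LessThan)
    also have "\<dots> = (\<Sum>z\<in>set zs. (if us ! i = z then 1 else 0) * (if z = us ! j then 1 else 0))"
      using sum_nth[of zs "\<lambda>z. (if us ! i = z then 1 else 0) * (if z = us ! j then 1 else 0)"] that
      by simp
    also have "\<dots> = (\<Sum>z\<in>set zs. if us ! i = z then (if z = us ! j then 1 else 0) else 0)"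
      by (intro sum.cong) auto
    also have "\<dots> = (if us ! i = us ! j then 1 else 0)"
      using ij that by (auto simp flip: that(3))
    also have "\<dots> = 1\<^sub>m n $$ (i, j)"
      using ij that by (simp add: nth_eq_iff_index_eq)
    finally show "(P us zs * P zs us) $$ (i, j) = 1\<^sub>m n $$ (i, j)" .
  qed (auto simp: P_def)
  have PM: "P vs ws * M ws = M vs * P vs ws"
  proof (rule eq_matI)
    fix i j assume "i < dim_row (M vs * P vs ws)" "j < dim_col (M vs * P vs ws)"
    then have ij: "i < n" "j < n" by (auto simp: M_def P_def)
    then have "(P vs ws * M ws) $$ (i, j) =
        (\<Sum>k<n. (if vs ! i = ws ! k then 1 else 0) * f (ws ! k) (ws ! j))"
      by (simp add: P_def M_def scalar_prod_def atLeast0LessThan)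
    also have "\<dots> = (\<Sum>w\<in>set ws. (if vs ! i = w then 1 else 0) * f w (ws ! j))"
      using sum_nth[of ws "\<lambda>w. (if vs ! i = w then 1 else 0) * f w (ws ! j)"] assms lw
      by simp
    also have "\<dots> = (\<Sum>w\<in>set ws. if vs ! i = w then f w (ws ! j) else 0)"
      by (intro sum.cong) auto
    also have "\<dots> = f (vs ! i) (ws ! j)"
      using ij assms by (auto simp: n_def simp flip: assms(3))
    also have "\<dots> = (\<Sum>v\<in>set vs. if v = ws ! j then f (vs ! i) v else 0)"
      using ij assms lw by (auto simp: n_def)
    also have "\<dots> = (\<Sum>v\<in>set vs. f (vs ! i) v * (if v = ws ! j then 1 else 0))"
      by (intro sum.cong) auto
    also have "\<dots> = (\<Sum>k<n. f (vs ! i) (vs ! k) * (if vs ! k = ws ! j then 1 else 0))"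
      using sum_nth[of vs "\<lambda>v. f (vs ! i) v * (if v = ws ! j then 1 else 0)"] assms n_def
      by simp
    also have "\<dots> = (M vs * P vs ws) $$ (i, j)"
      using ij by (simp add: P_def M_def scalar_prod_def atLeast0LessThan)
    finally show "(P vs ws * M ws) $$ (i, j) = (M vs * P vs ws) $$ (i, j)" .
  qed (auto simp: M_def P_def)
  have carr: "P us zs \<in> carrier_mat n n" "M us \<in> carrier_mat n n" for us zs
    by (auto simp: P_def M_def)
  have one: "P vs ws * P ws vs = 1\<^sub>m n" "P ws vs * P vs ws = 1\<^sub>m n"
    using PP assms lw n_def by auto
  have "M vs = M vs * (P vs ws * P ws vs)"
    by (simp add: one(1) right_mult_one_mat[OF carr(2)])
  also have "\<dots> = P vs ws * M ws * P ws vs"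
    unfolding PM using carr by (metis assoc_mult_mat)
  finally have "M vs = P vs ws * M ws * P ws vs" .
  then have "similar_mat_wit (M vs) (M ws) (P vs ws) (P ws vs)"
    by (rule similar_mat_witI[OF one]) (fact carr)+
  then have "similar_mat (M vs) (M ws)"
    unfolding similar_mat_def by blast
  then show ?thesis
    by (simp add: M_def lw flip: n_def)
qed

lemma Q_spectrum_eq:
  assumes "distinct ws" "set ws = pverts G"
  shows "Q_spectrum G = proots (char_poly (map_mat complex_of_real (signless_laplacian G ws)))"
proof -
  define vs where "vs = (SOME vs. distinct vs \<and> set vs = pverts G)"
  have vs: "distinct vs \<and> set vs = pverts G"
    unfolding vs_def by (rule someI) (use assms in blast)
  define f where "f = (\<lambda>u v. complex_of_real
    ((if u = v then real (out_degree G u) else 0) + (if (u, v) \<in> parcs G then 1 else 0)))"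
  have mat_eq: "map_mat complex_of_real (signless_laplacian G us) =
      mat (length us) (length us) (\<lambda>(i, j). f (us ! i) (us ! j))" if "distinct us" for us
    using that
    by (intro eq_matI)
      (auto simp: signless_laplacian_def degree_matrix_def adjacency_matrix_def f_def
         nth_eq_iff_index_eq)
  have "char_poly (map_mat complex_of_real (signless_laplacian G vs)) =
        char_poly (map_mat complex_of_real (signless_laplacian G ws))"
    using vs assms by (auto simp: mat_eq intro!: char_poly_similar similar_mat_reorder)
  then show ?thesis
    by (simp add: Q_spectrum_def Let_def flip: vs_def)
qed

end

theory Submission
  imports Defs "Jordan_Normal_Form.Schur_Decomposition"
begin

text \<open>Write \<open>N\<close> for the number of vertices minus one. The given graph is a cone: an apex joined to every vertex
  of a base whose components are odd cycles of length at least five, edges and points. Let \<open>H\<close> be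
  \<open>Q\<close>-cospectral to it. The proof turns the spectrum into two kinds of information: the traces
  of all powers of the signless Laplacian, which count weighted closed walks, and the multiplicity of the
  eigenvalue \<open>1\<close>.

  \<^bold>\<open>\<open>H\<close> is a cone.\<close> The traces of the first three powers give the sums of the degrees, of their
  squares, and of their cubes plus six times the number of triangles. If the largest degree of \<open>H\<close> were
  \<open>N - \<delta>\<close> with \<open>\<delta> \<ge> 1\<close>, the third sum would miss an amount of the order of \<open>\<delta> * N\<^sup>2\<close>, which the remaining
  degrees cannot supply because the second sum only leaves them an amount of the order of \<open>\<delta> * N\<close>
  (\<open>largest_degree_forced\<close>). So \<open>H\<close> has an apex, and for the degrees \<open>e\<close> in the two bases the three
  sums say that the sum of \<open>e * (e - 1) * (e - 2)\<close> plus six times the number of triangles in the base agrees.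
  It vanishes for the given graph, so the base of \<open>H\<close> has maximum degree two and no triangle, and
  both bases have equally many vertices of each degree (\<open>cospectral_is_cone\<close>).

  \<^bold>\<open>The base of \<open>H\<close> has no four-cycle.\<close> Subtracting the identity from the signless Laplacian of a cone leaves
  a product of a matrix with one column per base edge plus two, and a matrix with as many rows. By
  Sylvester's identity the multiplicity of the eigenvalue \<open>1\<close> is as small as this shape allows exactly
  when the product in the other order is invertible. For the given graph it is, because odd cycles make the
  incidence vectors of the base edges linearly independent and an isolated base vertex separates the two
  extra columns. Hence it is invertible for \<open>H\<close>, and its edges are independent too
  (\<open>cospectral_edge_independent\<close>); a four-cycle would be a dependency. This is where the
  parity of the cycle lengths enters.

  \<^bold>\<open>Adjacent base vertices of \<open>H\<close> have equal degree.\<close> Without triangles and four-cycles in the base, the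
  trace of the fourth power is determined by the degrees, except for the sum of
  \<open>(e u - e v)\<^sup>2\<close> over the adjacent pairs (\<open>kernel_trace_4_cone\<close>). It vanishes for the given graph,
  hence for \<open>H\<close>, so the base of \<open>H\<close> also consists of cycles, edges and points.

  \<^bold>\<open>The cycle lengths agree.\<close> Now the apex contributes equally to all traces of both graphs, so the
  traces of the powers of the two bases agree (\<open>base_traces_eq\<close>). The weight of closed walks of length \<open>c\<close>
  at a vertex is the same on all longer cycles, and exceeds this value by two on a cycle of length \<open>c\<close>, where
  one can also go once around in either direction. By induction on \<open>c\<close> both bases have
  equally many vertices in components of size \<open>c\<close> (\<open>component_size_counts_eq\<close>), and components of equal size
  are isomorphic.\<close>

section \<open>Traces and characteristic polynomials\<close>

definition mat_trace :: "'a :: comm_monoid_add mat \<Rightarrow> 'a" where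
  "mat_trace A = (\<Sum>i<dim_row A. A $$ (i, i))"

lemma mat_trace_mult_commute:
  fixes A B :: "'a :: comm_semiring_0 mat"
  assumes "A \<in> carrier_mat n m" "B \<in> carrier_mat m n"
  shows "mat_trace (A * B) = mat_trace (B * A)"
proof -
  have "mat_trace (A * B) = (\<Sum>i<n. \<Sum>j<m. A $$ (i, j) * B $$ (j, i))"
    using assms by (auto simp: mat_trace_def scalar_prod_def atLeast0LessThan intro!: sum.cong)
  also have "\<dots> = (\<Sum>j<m. \<Sum>i<n. B $$ (j, i) * A $$ (i, j))"
    by (subst sum.swap) (simp add: mult.commute)
  also have "\<dots> = mat_trace (B * A)"
    using assms by (auto simp: mat_trace_def scalar_prod_def atLeast0LessThan intro!: sum.cong)
  finally show ?thesis .
qed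

lemma mat_trace_similar:
  fixes A B :: "'a :: comm_ring_1 mat"
  assumes "similar_mat A B"
  shows "mat_trace A = mat_trace B"
proof -
  obtain n P R where carr: "A \<in> carrier_mat n n" "B \<in> carrier_mat n n"
      "P \<in> carrier_mat n n" "R \<in> carrier_mat n n"
    and one: "R * P = 1\<^sub>m n" and A: "A = P * B * R"
    using similar_matD[OF assms] by auto
  have "mat_trace A = mat_trace (R * (P * B))"
    unfolding A using carr by (intro mat_trace_mult_commute[of _ n n]) auto
  also have "R * (P * B) = R * P * B"
    using carr by (metis assoc_mult_mat)
  finally show ?thesis
    using carr one by simp
qed

lemma upper_triangular_mult:
  fixes A B :: "'a :: comm_ring_1 mat"
  assumes "A \<in> carrier_mat n n" "B \<in> carrier_mat n n" "upper_triangular A" "upper_triangular B"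
  shows "upper_triangular (A * B)"
    and "i < n \<Longrightarrow> (A * B) $$ (i, i) = A $$ (i, i) * B $$ (i, i)"
proof -
  have entry: "(A * B) $$ (i, j) = (\<Sum>k<n. A $$ (i, k) * B $$ (k, j))" if "i < n" "j < n" for i j
    using that assms by (simp add: scalar_prod_def atLeast0LessThan)
  show "upper_triangular (A * B)"
  proof
    fix i j assume ij: "j < i" "i < dim_row (A * B)"
    then have "A $$ (i, k) * B $$ (k, j) = 0" if "k < n" for k
      using that assms upper_triangularD[OF assms(3), of k i] upper_triangularD[OF assms(4), of j k]
      by (cases "k < i") auto
    then have "(\<Sum>k<n. A $$ (i, k) * B $$ (k, j)) = 0"
      by simp
    moreover have "i < n" "j < n"
      using ij assms by auto
    ultimately show "(A * B) $$ (i, j) = 0"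
      by (simp only: entry)
  qed
  assume i: "i < n"
  have "A $$ (i, k) * B $$ (k, i) = 0" if "k < n" "k \<noteq> i" for k
    using that i assms upper_triangularD[OF assms(3), of k i] upper_triangularD[OF assms(4), of i k]
    by (cases "k < i") auto
  then have "(\<Sum>k<n. A $$ (i, k) * B $$ (k, i)) = (\<Sum>k\<in>{i}. A $$ (i, k) * B $$ (k, i))"
    using i by (intro sum.mono_neutral_right) auto
  then show "(A * B) $$ (i, i) = A $$ (i, i) * B $$ (i, i)"
    using i by (simp only: entry) simp
qed

lemma upper_triangular_pow:
  fixes B :: "'a :: comm_ring_1 mat"
  assumes "B \<in> carrier_mat n n" "upper_triangular B"
  shows "upper_triangular (B ^\<^sub>m k) \<and> (\<forall>i<n. (B ^\<^sub>m k) $$ (i, i) = B $$ (i, i) ^ k)"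
proof (induction k)
  case 0
  then show ?case using assms by auto
next
  case (Suc k)
  have "B ^\<^sub>m k \<in> carrier_mat n n" using assms by simp
  with Suc show ?case
    using upper_triangular_mult[of "B ^\<^sub>m k" n B] assms by (simp add: mult.commute)
qed

text \<open>Over the complex numbers a Schur triangularisation has the eigenvalues on its diagonal, so
  the traces of all powers can be read off the characteristic polynomial.\<close>

lemma mat_trace_pow_eq:
  fixes A B :: "complex mat"
  assumes A: "A \<in> carrier_mat n n" and B: "B \<in> carrier_mat n n" and AB: "char_poly A = char_poly B"
  shows "mat_trace (A ^\<^sub>m k) = mat_trace (B ^\<^sub>m k)"
proof -
  obtain es where es: "char_poly A = (\<Prod>a\<leftarrow>es. [:- a, 1:])"
    using char_poly_factorized[OF A] by blast
  have "mat_trace (M ^\<^sub>m k) = (\<Sum>e\<leftarrow>es. e ^ k)"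
    if M: "M \<in> carrier_mat n n" and cM: "char_poly M = (\<Prod>a\<leftarrow>es. [:- a, 1:])" for M :: "complex mat"
  proof -
    obtain T P R where TPR: "schur_decomposition M es = (T, P, R)"
      by (metis prod_cases3)
    from schur_decomposition[OF M cM TPR]
    have sim: "similar_mat_wit M T P R" and ut: "upper_triangular T" and d: "diag_mat T = es"
      by auto
    have T: "T \<in> carrier_mat n n"
      using similar_mat_witD2[OF M sim] by auto
    have "similar_mat (M ^\<^sub>m k) (T ^\<^sub>m k)"
      using similar_mat_wit_pow[OF sim] unfolding similar_mat_def by blast
    then have "mat_trace (M ^\<^sub>m k) = mat_trace (T ^\<^sub>m k)"
      by (rule mat_trace_similar)
    also have "\<dots> = (\<Sum>i<n. T $$ (i, i) ^ k)"
      using upper_triangular_pow[OF T ut, of k] T by (simp add: mat_trace_def)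
    also have "\<dots> = (\<Sum>e\<leftarrow>diag_mat T. e ^ k)"
      using T by (simp add: diag_mat_def sum_list_sum_nth atLeast0LessThan)
    finally show ?thesis by (simp add: d)
  qed
  then show ?thesis using A B AB es by metis
qed

lemma complex_char_poly_eqI:
  fixes A B :: "complex mat"
  assumes A: "A \<in> carrier_mat n n" and B: "B \<in> carrier_mat m m"
    and eq: "proots (char_poly A) = proots (char_poly B)"
  shows "n = m" and "char_poly A = char_poly B"
proof -
  note dA = degree_monic_char_poly[OF A] and dB = degree_monic_char_poly[OF B]
  show "n = m"
    using dA dB eq by (metis size_proots_complex)
  show "char_poly A = char_poly B"
    using complex_poly_decompose_multiset[of "char_poly A"]
      complex_poly_decompose_multiset[of "char_poly B"] eq dA dB by simp
qed

text \<open>Both sides are determinants of the same block matrix with corners \<open>x\<close>, \<open>A\<close>, \<open>B\<close>, \<open>1\<close>,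
  after clearing the lower left block from the right and from the left.\<close>

lemma sylvester_det:
  fixes A B :: "'a :: idom mat"
  assumes A: "A \<in> carrier_mat n r" and B: "B \<in> carrier_mat r n"
  shows "x ^ r * det (x \<cdot>\<^sub>m 1\<^sub>m n - A * B) = x ^ n * det (x \<cdot>\<^sub>m 1\<^sub>m r - B * A)"
proof -
  define X where "X = four_block_mat (x \<cdot>\<^sub>m 1\<^sub>m n) A B (1\<^sub>m r)"
  define L where "L = four_block_mat (1\<^sub>m n) (0\<^sub>m n r) (- B) (x \<cdot>\<^sub>m 1\<^sub>m r)"
  define R where "R = four_block_mat (1\<^sub>m n) (0\<^sub>m n r) (- B) (1\<^sub>m r)"
  have carr: "X \<in> carrier_mat (n + r) (n + r)" "L \<in> carrier_mat (n + r) (n + r)"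
      "R \<in> carrier_mat (n + r) (n + r)"
    using A B by (auto simp: X_def L_def R_def)
  have AB: "x \<cdot>\<^sub>m 1\<^sub>m n - A * B \<in> carrier_mat n n" and BA: "x \<cdot>\<^sub>m 1\<^sub>m r - B * A \<in> carrier_mat r r"
    using A B by (auto intro!: minus_carrier_mat)
  have "X * R = four_block_mat (x \<cdot>\<^sub>m 1\<^sub>m n - A * B) A (0\<^sub>m r n) (1\<^sub>m r)"
    unfolding X_def R_def using A B
    by (subst mult_four_block_mat[of _ n n _ r _ r _ _ n _ r])
      (auto intro!: cong_four_block_mat simp: minus_add_uminus_mat)
  then have 1: "det X * det R = det (x \<cdot>\<^sub>m 1\<^sub>m n - A * B)"
    using det_mult[OF carr(1,3)] det_four_block_mat_lower_left_zero[OF AB A refl, of "1\<^sub>m r"]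
    by simp
  have "L * X = four_block_mat (x \<cdot>\<^sub>m 1\<^sub>m n) A (0\<^sub>m r n) (x \<cdot>\<^sub>m 1\<^sub>m r - B * A)"
    unfolding X_def L_def using A B
    by (subst mult_four_block_mat[of _ n n _ r _ r _ _ n _ r])
      (auto intro!: cong_four_block_mat)
  then have 2: "det L * det X = x ^ n * det (x \<cdot>\<^sub>m 1\<^sub>m r - B * A)"
    using det_mult[OF carr(2,1)] det_four_block_mat_lower_left_zero[OF _ A refl BA, of "x \<cdot>\<^sub>m 1\<^sub>m n"]
    by simp
  have "det R = 1" "det L = x ^ r"
    unfolding L_def R_def using B by (simp_all add: det_four_block_mat_upper_right_zero[of _ n _ r])
  with 1 2 show ?thesis by simp
qed

text \<open>From here on a matrix is a function of two vertices. This keeps sums over vertices free of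
  enumerations; \<open>kernel_mat\<close> passes to a matrix for a chosen list of vertices.\<close>

definition kernel_mat :: "'a list \<Rightarrow> ('a \<Rightarrow> 'a \<Rightarrow> 'b) \<Rightarrow> 'b mat" where
  "kernel_mat vs f = mat (length vs) (length vs) (\<lambda>(i, j). f (vs ! i) (vs ! j))"

lemma kernel_mat_dim [simp]:
  "dim_row (kernel_mat vs f) = length vs" "dim_col (kernel_mat vs f) = length vs"
  by (simp_all add: kernel_mat_def)

primrec kernel_pow :: "'a set \<Rightarrow> ('a \<Rightarrow> 'a \<Rightarrow> real) \<Rightarrow> nat \<Rightarrow> 'a \<Rightarrow> 'a \<Rightarrow> real" where
  "kernel_pow V f 0 = (\<lambda>u v. of_bool (u = v))"
| "kernel_pow V f (Suc j) = (\<lambda>u v. \<Sum>w\<in>V. f u w * kernel_pow V f j w v)"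

definition kernel_trace :: "'a set \<Rightarrow> ('a \<Rightarrow> 'a \<Rightarrow> real) \<Rightarrow> nat \<Rightarrow> real" where
  "kernel_trace V f j = (\<Sum>v\<in>V. kernel_pow V f j v v)"

lemma sum_nth_distinct:
  assumes "distinct us"
  shows "(\<Sum>k<length us. g (us ! k)) = sum g (set us)"
  using sum.reindex_bij_betw[OF bij_betw_nth[OF assms refl refl], of g] by simp

lemma pow_mat_Suc_left:
  fixes A :: "'a :: comm_ring_1 mat"
  assumes "A \<in> carrier_mat n n"
  shows "A ^\<^sub>m Suc k = A * A ^\<^sub>m k"
proof (induction k)
  case 0
  show ?case using assms by simp
next
  case (Suc k)
  have c: "A ^\<^sub>m k \<in> carrier_mat n n" using assms by simp
  have "A ^\<^sub>m Suc (Suc k) = A * A ^\<^sub>m k * A"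
    using Suc by simp
  also have "\<dots> = A * (A ^\<^sub>m k * A)"
    by (rule assoc_mult_mat[OF assms c assms])
  finally show ?case by simp
qed

lemma kernel_mat_pow:
  assumes "distinct vs"
  shows "kernel_mat vs f ^\<^sub>m k = kernel_mat vs (kernel_pow (set vs) f k)"
proof (induction k)
  case 0
  show ?case
    using assms by (intro eq_matI) (auto simp: kernel_mat_def nth_eq_iff_index_eq)
next
  case (Suc k)
  have "kernel_mat vs f ^\<^sub>m Suc k = kernel_mat vs f * kernel_mat vs f ^\<^sub>m k"
    by (rule pow_mat_Suc_left[of _ "length vs"]) (simp add: kernel_mat_def)
  also have "\<dots> = kernel_mat vs f * kernel_mat vs (kernel_pow (set vs) f k)"
    by (simp only: Suc)
  also have "\<dots> = kernel_mat vs (kernel_pow (set vs) f (Suc k))"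
  proof (rule eq_matI)
    fix i j assume "i < dim_row (kernel_mat vs (kernel_pow (set vs) f (Suc k)))"
      "j < dim_col (kernel_mat vs (kernel_pow (set vs) f (Suc k)))"
    then have ij: "i < length vs" "j < length vs" by (auto simp: kernel_mat_def)
    show "(kernel_mat vs f * kernel_mat vs (kernel_pow (set vs) f k)) $$ (i, j) =
        kernel_mat vs (kernel_pow (set vs) f (Suc k)) $$ (i, j)"
      using ij sum_nth_distinct[OF assms, of "\<lambda>w. f (vs ! i) w * kernel_pow (set vs) f k w (vs ! j)"]
      by (simp add: kernel_mat_def scalar_prod_def atLeast0LessThan)
  qed (auto simp: kernel_mat_def)
  finally show ?case .
qed

lemma mat_trace_kernel_mat_pow:
  assumes "distinct vs"
  shows "mat_trace (kernel_mat vs f ^\<^sub>m k) = kernel_trace (set vs) f k"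
  unfolding kernel_mat_pow[OF assms] kernel_trace_def mat_trace_def
  using sum_nth_distinct[OF assms, of "\<lambda>v. kernel_pow (set vs) f k v v"]
  by (simp add: kernel_mat_def)

section \<open>Simple graphs and the signless Laplacian\<close>

locale simple_graph =
  fixes V :: "'a set" and E :: "('a \<times> 'a) set"
  assumes finite_V: "finite V"
    and E_sub: "E \<subseteq> V \<times> V"
    and E_sym: "(u, v) \<in> E \<Longrightarrow> (v, u) \<in> E"
    and E_irrefl: "(u, u) \<notin> E"
begin

definition nb :: "'a \<Rightarrow> 'a set" where
  "nb u = {v. (u, v) \<in> E}"

definition deg :: "'a \<Rightarrow> nat" where
  "deg u = card (nb u)"

definition adj :: "'a \<Rightarrow> 'a \<Rightarrow> real" where
  "adj u v = of_bool ((u, v) \<in> E)"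

definition codeg :: "'a \<Rightarrow> 'a \<Rightarrow> nat" where
  "codeg u v = card (nb u \<inter> nb v)"

text \<open>The entries of the signless Laplacian.\<close>

definition qmat :: "'a \<Rightarrow> 'a \<Rightarrow> real" where
  "qmat u v = (if u = v then real (deg u) else 0) + adj u v"

lemma nb_sub: "nb u \<subseteq> V"
  using E_sub by (auto simp: nb_def)

lemma finite_nb [simp]: "finite (nb u)"
  using nb_sub finite_V by (rule finite_subset)

lemma nb_iff [simp]: "v \<in> nb u \<longleftrightarrow> (u, v) \<in> E"
  by (simp add: nb_def)

lemma E_commute: "(u, v) \<in> E \<longleftrightarrow> (v, u) \<in> E"
  using E_sym by blast

lemma adj_commute: "adj u v = adj v u"
  using E_commute by (simp add: adj_def)

lemma adj_self [simp]: "adj u u = 0"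
  by (simp add: adj_def E_irrefl)

lemma sum_adj: "(\<Sum>v\<in>V. adj u v * g v) = sum g (nb u)"
proof -
  have "(\<Sum>v\<in>V. adj u v * g v) = (\<Sum>v\<in>nb u. adj u v * g v)"
    using nb_sub finite_V by (intro sum.mono_neutral_right) (auto simp: adj_def)
  then show ?thesis by (simp add: adj_def)
qed

lemma sum_adj_1: "(\<Sum>v\<in>V. adj u v) = real (deg u)"
  using sum_adj[of u "\<lambda>_. 1"] by (simp add: deg_def)

lemma codeg_eq: "real (codeg u v) = (\<Sum>w\<in>V. adj u w * adj w v)"
proof -
  have "(\<Sum>w\<in>V. adj u w * adj w v) = (\<Sum>w\<in>nb u. adj w v)"
    by (rule sum_adj)
  also have "\<dots> = (\<Sum>w\<in>nb u. if w \<in> nb v then 1 else 0)"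
    using E_commute by (intro sum.cong) (auto simp: adj_def)
  also have "\<dots> = real (card (nb u \<inter> nb v))"
    by (simp add: sum.If_cases Int_def del: nb_iff)
  finally show ?thesis by (simp add: codeg_def)
qed

lemma codeg_self [simp]: "codeg u u = deg u"
  by (simp add: codeg_def deg_def)

lemma qmat_sum: 
  assumes "u \<in> V"
  shows "(\<Sum>w\<in>V. qmat u w * g w) = real (deg u) * g u + sum g (nb u)"
proof -
  have "(\<Sum>w\<in>V. qmat u w * g w) = (\<Sum>w\<in>V. (if w = u then real (deg u) * g u else 0) + adj u w * g w)"
    by (intro sum.cong) (auto simp: qmat_def algebra_simps)
  then show ?thesis
    using assms finite_V by (simp add: sum.distrib sum_adj)
qed

lemma qmat_commute: "qmat u v = qmat v u"
  by (auto simp: qmat_def adj_commute)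

end

lemma pair_graph_simple_graph: "pair_graph G \<Longrightarrow> simple_graph (pverts G) (parcs G)"
  unfolding pair_graph_iff simple_graph_def by (auto simp: sym_def irrefl_def)

lemma out_degree_deg:
  assumes "pair_graph G"
  shows "out_degree G v = simple_graph.deg (parcs G) v"
proof -
  interpret simple_graph "pverts G" "parcs G" by (rule pair_graph_simple_graph[OF assms])
  have "out_arcs G v = Pair v ` nb v"
    by (auto simp: out_arcs_def nb_def)
  then show ?thesis
    by (simp add: out_degree_def deg_def card_image inj_on_def)
qed

lemma signless_laplacian_kernel_mat:
  assumes "pair_graph G" "distinct vs"
  shows "signless_laplacian G vs = kernel_mat vs (simple_graph.qmat (parcs G))"
proof -
  interpret simple_graph "pverts G" "parcs G" by (rule pair_graph_simple_graph[OF assms(1)])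
  show ?thesis
    using assms
    by (intro eq_matI) (auto simp: signless_laplacian_def degree_matrix_def adjacency_matrix_def
        kernel_mat_def qmat_def adj_def out_degree_deg nth_eq_iff_index_eq)
qed

lemma kernel_mat_carrier [simp]: "kernel_mat vs f \<in> carrier_mat (length vs) (length vs)"
  by (simp add: kernel_mat_def)

text \<open>The two consequences of cospectrality that are used: equal characteristic polynomials and
  equal traces of all powers.\<close>

lemma Q_cospectral_char_poly:
  assumes G: "pair_graph G" "distinct vs" "set vs = pverts G"
    and H: "pair_graph H" "distinct ws" "set ws = pverts H"
    and cosp: "Q_cospectral G H"
  shows "length vs = length ws"
    and "char_poly (kernel_mat vs (simple_graph.qmat (parcs G))) =
         char_poly (kernel_mat ws (simple_graph.qmat (parcs H)))" (is "char_poly ?A = char_poly ?B")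
    and "kernel_trace (pverts G) (simple_graph.qmat (parcs G)) k =
         kernel_trace (pverts H) (simple_graph.qmat (parcs H)) k"
proof -
  let ?c = "map_mat complex_of_real"
  have c: "?c ?A \<in> carrier_mat (length vs) (length vs)" "?c ?B \<in> carrier_mat (length ws) (length ws)"
    by (simp_all add: kernel_mat_def)
  have pr: "proots (char_poly (?c ?A)) = proots (char_poly (?c ?B))"
    using cosp unfolding Q_cospectral_def Q_spectrum_eq[OF G(2,3)] Q_spectrum_eq[OF H(2,3)]
    by (simp add: signless_laplacian_kernel_mat G H)
  note eq = complex_char_poly_eqI[OF c pr]
  show len: "length vs = length ws" by (rule eq(1))
  have "map_poly complex_of_real (char_poly ?A) = map_poly complex_of_real (char_poly ?B)"
    using eq(2) by (simp add: of_real_hom.char_poly_hom[OF kernel_mat_carrier])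
  then show "char_poly ?A = char_poly ?B"
    by (simp add: poly_eq_iff coeff_map_poly)
  have tr: "mat_trace (?c M ^\<^sub>m k) = complex_of_real (mat_trace (M ^\<^sub>m k))"
    if "M \<in> carrier_mat n n" for M n
    using that by (simp add: mat_trace_def flip: of_real_hom.mat_hom_pow[OF that])
  have "complex_of_real (mat_trace (?A ^\<^sub>m k)) = complex_of_real (mat_trace (?B ^\<^sub>m k))"
    using mat_trace_pow_eq[OF c(1) _ eq(2), of k] c(2) len
    by (simp add: tr[OF kernel_mat_carrier])
  then show "kernel_trace (pverts G) (simple_graph.qmat (parcs G)) k =
         kernel_trace (pverts H) (simple_graph.qmat (parcs H)) k"
    using G H by (simp add: mat_trace_kernel_mat_pow)
qed

section \<open>The first three traces and the largest degree\<close>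

lemma cube_excess_bound:
  fixes e :: "'a \<Rightarrow> real"
  assumes "\<And>u. u \<in> W \<Longrightarrow> e u \<in> \<int>" "\<And>u. u \<in> W \<Longrightarrow> e u \<le> c + 2"
  shows "(\<Sum>u\<in>W. e u * (e u - 1) * (e u - 2)) \<le> c * (\<Sum>u\<in>W. e u * (e u - 1))"
  unfolding sum_distrib_left
proof (rule sum_mono)
  fix u assume u: "u \<in> W"
  have "e u * (e u - 1) \<ge> 0"
    using assms(1)[OF u] by (auto elim!: Ints_cases simp: zero_le_mult_iff)
  moreover have "e u - 2 \<le> c" using assms(2)[OF u] by simp
  ultimately show "e u * (e u - 1) * (e u - 2) \<le> c * (e u * (e u - 1))"
    using mult_right_mono[of "e u - 2" c "e u * (e u - 1)"] by (simp add: mult.commute)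
qed

text \<open>Here \<open>x\<close> is the largest degree of a graph on \<open>N + 1\<close> vertices, \<open>W\<close> is the set of the other vertices, and
  \<open>K\<close>, \<open>P\<close>, \<open>s\<close> are the numbers of base vertices of degree two, one and zero of the cone it is compared with; the
  right-hand sides of the three equations are the power sums of the degrees of that cone, the last one with
  its triangles. With \<open>\<delta> = N - x\<close> and \<open>e = d - 1\<close>, the sum \<open>E\<close> of \<open>e * (e - 1)\<close> equals
  \<open>N\<^sup>2 - x\<^sup>2 - 3 * \<delta> + 2 * K\<close>, which is of order \<open>\<delta> * N\<close>, whereas the sum \<open>F\<close> of \<open>e * (e - 1) * (e - 2)\<close> is
  at least about \<open>N\<^sup>3 - x\<^sup>3\<close>. But \<open>F\<close> is at most \<open>E\<close> times the largest value of \<open>e - 2\<close>. For \<open>\<delta> \<ge> 3\<close> the bound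
  \<open>e \<le> x - 1\<close> gives a contradiction; for smaller \<open>\<delta>\<close> the bound \<open>e * (e - 1) \<le> E\<close> is stronger, as it limits
  \<open>e\<close> to the order of the square root of \<open>N\<close>.\<close>

lemma largest_degree_forced:
  fixes d :: "'a \<Rightarrow> nat" and K P s T N x :: real
  assumes fin: "finite W" and card: "real (card W) = N" and N: "N \<ge> 32" and xN: "x \<le> N"
    and int: "x \<in> \<int>" and dx: "\<And>u. u \<in> W \<Longrightarrow> real (d u) \<le> x"
    and pos: "K \<ge> 0" "P \<ge> 0" "s \<ge> 0" and NK: "N = K + P + s"
    and S1: "x + (\<Sum>u\<in>W. real (d u)) = N + 3 * K + 2 * P + s"
    and S2: "x ^ 2 + (\<Sum>u\<in>W. real (d u) ^ 2) = N ^ 2 + 9 * K + 4 * P + s"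
    and S3: "x ^ 3 + (\<Sum>u\<in>W. real (d u) ^ 3) + T = N ^ 3 + 27 * K + 8 * P + s + 3 * (2 * K + P)"
    and T: "T \<le> (\<Sum>u\<in>W. real (d u)) - x + (\<Sum>u\<in>W. real (d u) * (real (d u) - 1))"
  shows "x = N"
proof (rule ccontr)
  assume "x \<noteq> N"
  define \<delta> where "\<delta> = N - x"
  have "\<delta> \<in> \<int>" using int card unfolding \<delta>_def by (metis Ints_diff Ints_of_nat)
  then have cases: "\<delta> = 1 \<or> \<delta> = 2 \<or> \<delta> \<ge> 3"
    using \<open>x \<noteq> N\<close> xN by (auto simp: \<delta>_def elim!: Ints_cases)
  have N\<delta>: "N = x + \<delta>" by (simp add: \<delta>_def)
  define e where "e u = real (d u) - 1" for u
  define S where "S = (\<lambda>k. \<Sum>u\<in>W. real (d u) ^ k)"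
  have S0: "S 0 = N" using card by (simp add: S_def)
  define E where "E = (\<Sum>u\<in>W. e u * (e u - 1))"
  define F where "F = (\<Sum>u\<in>W. e u * (e u - 1) * (e u - 2))"
  have "E = (\<Sum>u\<in>W. real (d u) ^ 2 - 3 * real (d u) ^ 1 + 2 * real (d u) ^ 0)"
    unfolding E_def e_def by (intro sum.cong) (auto simp: algebra_simps power2_eq_square)
  then have E: "E = S 2 - 3 * S 1 + 2 * S 0"
    by (simp only: S_def sum.distrib sum_subtractf sum_distrib_left)
  have "F = (\<Sum>u\<in>W. real (d u) ^ 3 - 6 * real (d u) ^ 2 + 11 * real (d u) ^ 1 - 6 * real (d u) ^ 0)"
    unfolding F_def e_def
    by (intro sum.cong) (auto simp: algebra_simps power2_eq_square power3_eq_cube)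
  then have F: "F = S 3 - 6 * S 2 + 11 * S 1 - 6 * S 0"
    by (simp only: S_def sum.distrib sum_subtractf sum_distrib_left)
  have T': "T \<le> S 2 - x"
    using T by (simp add: S_def algebra_simps power2_eq_square sum_subtractf)
  have S123: "S 1 = N + 3 * K + 2 * P + s - x" "S 2 = N ^ 2 + 9 * K + 4 * P + s - x ^ 2"
     "S 3 = N ^ 3 + 33 * K + 11 * P + s - x ^ 3 - T"
    using S1 S2 S3 by (simp_all add: S_def)
  have E': "E = N ^ 2 - x ^ 2 - 3 * \<delta> + 2 * K"
    unfolding E S123 S0 using NK by (simp add: \<delta>_def)
  have F': "F \<ge> N ^ 3 - x ^ 3 - 7 * (N ^ 2 - x ^ 2) + 10 * \<delta> - 2 * K"
    using T' NK unfolding F S123 S0 by (simp add: \<delta>_def)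
  have e_int: "e u \<in> \<int>" for u by (simp add: e_def)
  have e_le: "e u * (e u - 1) \<le> E" if "u \<in> W" for u
  proof -
    have "e v * (e v - 1) \<ge> 0" for v
      using e_int[of v] by (auto elim!: Ints_cases simp: zero_le_mult_iff)
    then show ?thesis
      unfolding E_def using that fin by (intro member_le_sum) auto
  qed
  have KN: "K \<le> N" using NK pos by simp
  have NN: "N * N \<ge> 32 * N" using N by (intro mult_right_mono) auto
  consider "\<delta> = 1" | "\<delta> = 2" | "\<delta> \<ge> 3" using cases by blast
  then show False
  proof cases
    case 1
    then have x: "x = N - 1" using N\<delta> by simp
    have E1: "E \<le> 4 * N - 4"
      using E' KN 1 unfolding x by (simp add: algebra_simps power2_eq_square)
    \<comment> \<open>A larger \<open>e\<close> would make \<open>e * (e - 1)\<close> exceed \<open>N\<^sup>2 / 4\<close>, and hence \<open>E\<close>.\<close>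
    have "e u \<le> N / 2 + 2" if "u \<in> W" for u
    proof (rule ccontr)
      assume "\<not> ?thesis"
      then have "e u * (e u - 1) \<ge> (N / 2 + 2) * (N / 2 + 1)"
        using N by (intro mult_mono) auto
      moreover have "(N / 2 + 2) * (N / 2 + 1) = N * N / 4 + 3 * N / 2 + 2"
        by (simp add: field_simps)
      ultimately show False using e_le[OF that] E1 NN N by linarith
    qed
    then have "F \<le> N / 2 * E"
      unfolding E_def F_def by (intro cube_excess_bound e_int)
    also have "\<dots> \<le> N / 2 * (4 * N - 4)" using E1 N by (intro mult_left_mono) auto
    finally have "F \<le> 2 * (N * N) - 2 * N" by (simp add: algebra_simps)
    moreover have "F \<ge> 3 * (N * N) - 19 * N + 18"
      using F' KN 1 unfolding x by (simp add: algebra_simps power2_eq_square power3_eq_cube)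
    ultimately show False using N NN by linarith
  next
    case 2
    then have x: "x = N - 2" using N\<delta> by simp
    have E1: "E \<le> 6 * N - 10"
      using E' KN 2 unfolding x by (simp add: algebra_simps power2_eq_square)
    \<comment> \<open>Any bound between the square root of \<open>6 * N\<close> and \<open>N\<close> minus a constant serves; \<open>N - 6\<close> is nearly the
      largest one that still contradicts the lower bound for \<open>F\<close>.\<close>
    have "e u \<le> (N - 6) + 2" if "u \<in> W" for u
    proof (rule ccontr)
      assume "\<not> ?thesis"
      then have "e u * (e u - 1) \<ge> (N - 4) * (N - 5)"
        using N by (intro mult_mono) auto
      moreover have "(N - 4) * (N - 5) = N * N - 9 * N + 20"
        by (simp add: algebra_simps)
      ultimately show False using e_le[OF that] E1 N NN by linarith
    qed
    then have "F \<le> (N - 6) * E"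
      unfolding E_def F_def by (intro cube_excess_bound e_int)
    also have "\<dots> \<le> (N - 6) * (6 * N - 10)" using E1 N by (intro mult_left_mono) auto
    finally have "F \<le> 6 * (N * N) - 46 * N + 60" by (simp add: algebra_simps)
    moreover have "F \<ge> 6 * (N * N) - 42 * N + 56"
      using F' KN 2 unfolding x by (simp add: algebra_simps power2_eq_square power3_eq_cube)
    ultimately show False using N by linarith
  next
    case 3
    have "e u \<le> (x - 3) + 2" if "u \<in> W" for u
      using dx[OF that] by (simp add: e_def)
    then have "F \<le> (x - 3) * E"
      unfolding E_def F_def by (intro cube_excess_bound e_int)
    with F' have "N ^ 3 - x ^ 3 - 7 * (N ^ 2 - x ^ 2) + 10 * \<delta> - 2 * K - (x - 3) * E \<le> 0"
      by linarith
    also have "N ^ 3 - x ^ 3 - 7 * (N ^ 2 - x ^ 2) + 10 * \<delta> - 2 * K - (x - 3) * E =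
        \<delta> * (N * N - 4 * N - x + 1) - 2 * (K * (x - 2))"
      unfolding E' \<delta>_def by (simp add: algebra_simps power2_eq_square power3_eq_cube)
    finally have *: "\<delta> * (N * N - 4 * N - x + 1) \<le> 2 * (K * (x - 2))" by simp
    have "K * (x - 2) \<le> N * N"
    proof (cases "x \<ge> 2")
      case True
      then show ?thesis using KN pos xN N by (intro mult_mono) auto
    next
      case False
      then have "K * (x - 2) \<le> 0" using pos by (simp add: mult_le_0_iff)
      also have "\<dots> \<le> N * N" by simp
      finally show ?thesis .
    qed
    moreover have "3 * (N * N - 5 * N) \<le> \<delta> * (N * N - 4 * N - x + 1)"
      using 3 NN xN N by (intro mult_mono) auto
    ultimately have "3 * (N * N - 5 * N) \<le> 2 * (N * N)"
      using * by (meson mult_left_mono order_trans zero_le_numeral)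
    then have "N * N \<le> 15 * N" by (simp add: algebra_simps)
    then show False using N NN by linarith
  qed
qed

context simple_graph
begin

lemma arc_sum_swap: "(\<Sum>u\<in>V. \<Sum>w\<in>nb u. g u w) = (\<Sum>u\<in>V. \<Sum>w\<in>nb u. g w u)"
proof -
  have "(\<Sum>u\<in>V. \<Sum>w\<in>nb u. g u w) = (\<Sum>u\<in>V. \<Sum>w\<in>V. if (u, w) \<in> E then g u w else 0)" for g :: "'a \<Rightarrow> 'a \<Rightarrow> 'b"
    using finite_V nb_sub by (intro sum.cong refl sum.mono_neutral_cong_left) auto
  note eq = this
  show ?thesis
    unfolding eq by (subst sum.swap) (simp add: E_commute)
qed

lemma kernel_pow_1: "v \<in> V \<Longrightarrow> kernel_pow V f (Suc 0) u v = f u v"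
  using finite_V by simp

lemma kernel_pow_2:
  assumes "u \<in> V" "v \<in> V"
  shows "kernel_pow V qmat 2 u v =
    (if u = v then real (deg u) ^ 2 else 0) + (real (deg u) + real (deg v)) * adj u v + real (codeg u v)"
proof -
  have "kernel_pow V qmat 2 u v = (\<Sum>w\<in>V. qmat u w * qmat w v)"
    using assms kernel_pow_1 by (simp add: numeral_2_eq_2 del: kernel_pow.simps(1))
  also have "\<dots> = real (deg u) * qmat u v + (\<Sum>w\<in>nb u. qmat w v)"
    by (rule qmat_sum[OF assms(1)])
  also have "(\<Sum>w\<in>nb u. qmat w v) = (\<Sum>w\<in>nb u. if w = v then real (deg v) else 0) + (\<Sum>w\<in>nb u. adj w v)"
    unfolding sum.distrib[symmetric] by (intro sum.cong) (auto simp: qmat_def)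
  also have "\<dots> = real (deg v) * adj u v + real (codeg u v)"
    using sum_adj[of u "\<lambda>w. adj w v"] by (simp add: codeg_eq adj_def)
  finally show ?thesis
    by (simp only:) (auto simp: qmat_def algebra_simps power2_eq_square)
qed

lemma kernel_trace_1: "kernel_trace V qmat 1 = (\<Sum>u\<in>V. real (deg u))"
  by (simp add: kernel_trace_def kernel_pow_1 qmat_def del: kernel_pow.simps)

lemma kernel_trace_2: "kernel_trace V qmat 2 = (\<Sum>u\<in>V. real (deg u) ^ 2) + (\<Sum>u\<in>V. real (deg u))"
  by (simp add: kernel_trace_def kernel_pow_2 sum.distrib)

text \<open>Twice the number of triangles at a vertex, that is, the number of arcs between its neighbours.\<close>

definition triangles_at :: "'a \<Rightarrow> nat" where
  "triangles_at u = (\<Sum>w\<in>nb u. codeg w u)"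

lemma kernel_trace_3:
  "kernel_trace V qmat 3 =
     (\<Sum>u\<in>V. real (deg u) ^ 3) + 3 * (\<Sum>u\<in>V. real (deg u) ^ 2) + real (\<Sum>u\<in>V. triangles_at u)"
proof -
  have s3: "(3::nat) = Suc 2" by simp
  have "kernel_trace V qmat 3 = (\<Sum>u\<in>V. \<Sum>w\<in>V. qmat u w * kernel_pow V qmat 2 w u)"
    unfolding kernel_trace_def s3 kernel_pow.simps ..
  also have "\<dots> = (\<Sum>u\<in>V. real (deg u) * (real (deg u) ^ 2 + real (deg u))
      + (\<Sum>w\<in>nb u. real (deg w) + real (deg u) + real (codeg w u)))"
  proof (intro sum.cong refl)
    fix u assume u: "u \<in> V"
    have "(\<Sum>w\<in>nb u. kernel_pow V qmat 2 w u) = (\<Sum>w\<in>nb u. real (deg w) + real (deg u) + real (codeg w u))"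
    proof (intro sum.cong refl)
      fix w assume w: "w \<in> nb u"
      then have "w \<in> V" "w \<noteq> u" "(w, u) \<in> E"
        using nb_sub[of u] E_irrefl E_sym by auto
      then show "kernel_pow V qmat 2 w u = real (deg w) + real (deg u) + real (codeg w u)"
        using u by (simp add: kernel_pow_2 adj_def)
    qed
    then show "(\<Sum>w\<in>V. qmat u w * kernel_pow V qmat 2 w u) = real (deg u) * (real (deg u) ^ 2 + real (deg u))
      + (\<Sum>w\<in>nb u. real (deg w) + real (deg u) + real (codeg w u))"
      using u by (simp only: qmat_sum) (simp add: kernel_pow_2 E_irrefl)
  qed
  also have "\<dots> = (\<Sum>u\<in>V. real (deg u) ^ 3) + (\<Sum>u\<in>V. real (deg u) ^ 2)
      + (\<Sum>u\<in>V. \<Sum>w\<in>nb u. real (deg w)) + (\<Sum>u\<in>V. \<Sum>w\<in>nb u. real (deg u))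
      + real (\<Sum>u\<in>V. triangles_at u)"
    by (simp add: sum.distrib triangles_at_def algebra_simps power2_eq_square power3_eq_cube)
  also have "(\<Sum>u\<in>V. \<Sum>w\<in>nb u. real (deg w)) = (\<Sum>u\<in>V. \<Sum>w\<in>nb u. real (deg u))"
    by (rule arc_sum_swap)
  also have "(\<Sum>u\<in>V. \<Sum>w\<in>nb u. real (deg u)) = (\<Sum>u\<in>V. real (deg u) ^ 2)"
    by (simp add: deg_def power2_eq_square)
  finally show ?thesis by simp
qed

lemma codeg_le: "w \<in> nb u \<Longrightarrow> codeg w u \<le> deg u - 1"
  unfolding codeg_def deg_def
  by (subst card_Diff_singleton[symmetric]) (auto intro!: card_mono simp: E_irrefl)

lemma triangles_at_le: "triangles_at u \<le> deg u * (deg u - 1)"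
  unfolding triangles_at_def
  using sum_bounded_above[of "nb u" "\<lambda>w. codeg w u" "deg u - 1"] codeg_le by (simp add: deg_def)

lemma deg_le:
  assumes "u \<in> V" shows "deg u \<le> card V - 1"
proof -
  have "nb u \<subseteq> V - {u}" using nb_sub E_irrefl by auto
  then have "deg u \<le> card (V - {u})"
    unfolding deg_def using finite_V by (intro card_mono) auto
  then show ?thesis using assms finite_V by simp
qed

text \<open>At a vertex of very large degree the trivial quadratic bound is useless, but the arcs between its
  neighbours are among the arcs that avoid it.\<close>

lemma triangles_at_le_rest:
  assumes "z \<in> V"
  shows "real (triangles_at z) \<le> (\<Sum>u\<in>V - {z}. real (deg u)) - real (deg z)"
proof -
  have "codeg w z + 1 \<le> deg w" if "w \<in> nb z" for w
  proof -
    have "nb w \<inter> nb z \<subseteq> nb w - {z}" "z \<in> nb w"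
      using that E_sym E_irrefl by auto
    then have "codeg w z < deg w"
      unfolding codeg_def deg_def by (intro psubset_card_mono) auto
    then show ?thesis by simp
  qed
  then have "(\<Sum>w\<in>nb z. codeg w z + 1) \<le> (\<Sum>w\<in>nb z. deg w)"
    by (rule sum_mono)
  also have "\<dots> \<le> (\<Sum>u\<in>V - {z}. deg u)"
    using nb_sub E_irrefl finite_V by (intro sum_mono2) auto
  finally have "triangles_at z + deg z \<le> (\<Sum>u\<in>V - {z}. deg u)"
    unfolding sum.distrib triangles_at_def by (simp add: deg_def)
  then have "real (triangles_at z + deg z) \<le> real (\<Sum>u\<in>V - {z}. deg u)"
    by (simp only: of_nat_le_iff)
  then show ?thesis by simp
qed

definition cone_over :: "'a \<Rightarrow> bool" where
  "cone_over z \<longleftrightarrow> z \<in> V \<and> (\<forall>u\<in>V - {z}. (z, u) \<in> E)"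

lemma cone_over_degI:
  assumes "z \<in> V" "deg z = card V - 1"
  shows "cone_over z"
proof -
  have "nb z \<subseteq> V - {z}" using nb_sub E_irrefl by auto
  moreover have "card (nb z) = card (V - {z})" using assms finite_V by (simp add: deg_def)
  ultimately have "nb z = V - {z}"
    using finite_V by (intro card_subset_eq) auto
  then show ?thesis using assms(1) unfolding cone_over_def by (auto simp: set_eq_iff)
qed

end

section \<open>Cones and the fourth trace\<close>

context simple_graph
begin

definition triangle_free :: bool where
  "triangle_free \<longleftrightarrow> (\<forall>u\<in>V. triangles_at u = 0)"

definition four_cycle_free :: bool where
  "four_cycle_free \<longleftrightarrow> (\<forall>u\<in>V. \<forall>v\<in>V. u \<noteq> v \<longrightarrow> codeg u v \<le> 1)"

definition componentwise_regular :: bool where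
  "componentwise_regular \<longleftrightarrow> (\<forall>(u, v)\<in>E. deg u = deg v)"

lemma triangle_freeD: 
  assumes triangle_free "(u, w) \<in> E" shows "codeg u w = 0"
proof -
  have "w \<in> V" using assms(2) E_sub by auto
  then have "triangles_at w = 0" using assms(1) by (simp add: triangle_free_def)
  then show ?thesis using assms(2) E_sym by (simp add: triangles_at_def)
qed

lemma kernel_pow_commute:
  assumes "\<And>u v. f u v = f v u" "u \<in> V" "v \<in> V"
  shows "kernel_pow V f 2 u v = kernel_pow V f 2 v u"
  using assms finite_V by (simp add: numeral_2_eq_2 mult.commute del: kernel_pow.simps(1))
    (simp add: mult.commute)

lemma kernel_trace_4: "kernel_trace V qmat 4 = (\<Sum>u\<in>V. \<Sum>v\<in>V. kernel_pow V qmat 2 u v ^ 2)"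
proof -
  have 4: "(4::nat) = Suc (Suc 2)" by simp
  have "kernel_trace V qmat 4 = (\<Sum>u\<in>V. \<Sum>w\<in>V. \<Sum>v\<in>V. qmat u w * qmat w v * kernel_pow V qmat 2 v u)"
    unfolding kernel_trace_def 4 kernel_pow.simps by (simp add: sum_distrib_left mult.assoc)
  also have "\<dots> = (\<Sum>u\<in>V. \<Sum>v\<in>V. (\<Sum>w\<in>V. qmat u w * qmat w v) * kernel_pow V qmat 2 v u)"
    by (simp add: sum_distrib_right) (rule sum.cong[OF refl], rule sum.swap)
  also have "\<dots> = (\<Sum>u\<in>V. \<Sum>v\<in>V. kernel_pow V qmat 2 u v ^ 2)"
  proof (intro sum.cong refl)
    fix u v assume uv: "u \<in> V" "v \<in> V"
    have "(\<Sum>w\<in>V. qmat u w * qmat w v) = kernel_pow V qmat 2 u v"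
      using uv kernel_pow_1 by (simp add: numeral_2_eq_2 del: kernel_pow.simps(1))
    moreover have "kernel_pow V qmat 2 v u = kernel_pow V qmat 2 u v"
      by (rule kernel_pow_commute[OF qmat_commute uv(2,1)])
    ultimately show "(\<Sum>w\<in>V. qmat u w * qmat w v) * kernel_pow V qmat 2 v u = kernel_pow V qmat 2 u v ^ 2"
      by (simp add: power2_eq_square)
  qed
  finally show ?thesis .
qed

lemma sum_codeg: "(\<Sum>u\<in>V. \<Sum>v\<in>V. real (codeg u v)) = (\<Sum>w\<in>V. real (deg w) ^ 2)"
proof -
  have "(\<Sum>u\<in>V. \<Sum>v\<in>V. real (codeg u v)) = (\<Sum>u\<in>V. \<Sum>w\<in>V. \<Sum>v\<in>V. adj u w * adj w v)"
    unfolding codeg_eq by (rule sum.cong[OF refl], rule sum.swap)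
  also have "\<dots> = (\<Sum>w\<in>V. \<Sum>u\<in>V. adj w u * real (deg w))"
    by (subst sum.swap) (simp add: sum_adj_1 adj_commute flip: sum_distrib_left)
  also have "\<dots> = (\<Sum>w\<in>V. real (deg w) ^ 2)"
    by (simp add: sum_adj_1 power2_eq_square flip: sum_distrib_right)
  finally show ?thesis .
qed

end

locale cone = simple_graph +
  fixes z :: 'a
  assumes cone_over: "cone_over z"
begin

definition W :: "'a set" where "W = V - {z}"

definition base_E :: "('a \<times> 'a) set" where "base_E = E \<inter> W \<times> W"

sublocale base: simple_graph W base_E
  using finite_V E_sym E_irrefl by unfold_locales (auto simp: W_def base_E_def)

lemma z_V [simp]: "z \<in> V" and z_W [simp]: "z \<notin> W" and W_V: "u \<in> W \<Longrightarrow> u \<in> V"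
  and V_eq: "V = insert z W"
  using cone_over by (auto simp: cone_over_def W_def)

lemma z_E: "u \<in> W \<Longrightarrow> (z, u) \<in> E" "u \<in> W \<Longrightarrow> (u, z) \<in> E"
proof -
  assume "u \<in> W"
  then show "(z, u) \<in> E" using cone_over by (simp add: cone_over_def W_def)
  then show "(u, z) \<in> E" by (rule E_sym)
qed

lemma finite_W [simp]: "finite W"
  by (rule base.finite_V)

lemma W_iff: "u \<in> W \<longleftrightarrow> u \<in> V \<and> u \<noteq> z"
  by (simp add: W_def)

lemma base_E_iff: "(u, v) \<in> base_E \<longleftrightarrow> (u, v) \<in> E \<and> u \<in> W \<and> v \<in> W"
  by (simp add: base_E_def)

lemma card_V: "card V = card W + 1"
  by (subst V_eq) simp

lemma sum_V: "sum f V = f z + sum f W"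
  by (subst V_eq) simp

lemma nb_z: "nb z = W"
proof
  show "nb z \<subseteq> W" using nb_sub[of z] E_irrefl[of z] by (auto simp: W_def)
  show "W \<subseteq> nb z" using z_E by auto
qed

lemma nb_W: "u \<in> W \<Longrightarrow> nb u = insert z (base.nb u)"
  using nb_sub[of u] z_E[of u] E_irrefl[of u] by (auto simp: base_E_iff W_iff)

lemma z_base_nb [simp]: "z \<notin> base.nb u"
  using base.nb_sub[of u] by auto

lemma deg_z: "deg z = card W"
  by (simp add: deg_def nb_z)

lemma deg_W: "u \<in> W \<Longrightarrow> deg u = base.deg u + 1"
  by (simp add: deg_def base.deg_def nb_W del: base.nb_iff)

lemma codeg_z_W: "u \<in> W \<Longrightarrow> codeg z u = base.deg u" "u \<in> W \<Longrightarrow> codeg u z = base.deg u"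
  using base.nb_sub[of u] by (simp_all add: codeg_def base.deg_def nb_z nb_W Int_absorb1 Int_absorb2 del: base.nb_iff)

lemma codeg_W: "u \<in> W \<Longrightarrow> v \<in> W \<Longrightarrow> codeg u v = base.codeg u v + 1"
  by (simp add: codeg_def base.codeg_def nb_W del: base.nb_iff)

lemma sum_triangles_at:
  "(\<Sum>u\<in>V. triangles_at u) = 3 * (\<Sum>u\<in>W. base.deg u) + (\<Sum>u\<in>W. base.triangles_at u)"
proof -
  have "triangles_at z = (\<Sum>u\<in>W. base.deg u)"
    by (simp add: triangles_at_def nb_z codeg_z_W)
  moreover have "triangles_at u = 2 * base.deg u + base.triangles_at u" if u: "u \<in> W" for u
  proof -
    have "triangles_at u = base.deg u + (\<Sum>w\<in>base.nb u. codeg w u)"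
      using u by (simp add: triangles_at_def nb_W codeg_z_W del: base.nb_iff)
    also have "(\<Sum>w\<in>base.nb u. codeg w u) = (\<Sum>w\<in>base.nb u. base.codeg w u + 1)"
      using u base.nb_sub[of u] by (intro sum.cong refl codeg_W) auto
    finally show ?thesis
      by (simp only: sum.distrib) (simp add: base.triangles_at_def base.deg_def del: base.nb_iff)
  qed
  ultimately show ?thesis
    by (simp add: sum_V sum.distrib flip: sum_distrib_left)
qed

lemma deg_sums:
  "(\<Sum>u\<in>V. real (deg u) ^ k) = real (card W) ^ k + (\<Sum>u\<in>W. (real (base.deg u) + 1) ^ k)"
  by (simp add: sum_V deg_z deg_W add.commute)

lemma adj_W: "u \<in> W \<Longrightarrow> v \<in> W \<Longrightarrow> adj u v = base.adj u v"
  by (simp add: adj_def base.adj_def base_E_iff)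

text \<open>The trace of the fourth power sees the base degrees one vertex at a time, through \<open>quartic_weight\<close>,
  and in adjacent pairs, through \<open>base_defect\<close>.\<close>

definition base_defect :: real where
  "base_defect = (\<Sum>u\<in>W. \<Sum>v\<in>base.nb u. (real (base.deg u) - real (base.deg v)) ^ 2)"

definition quartic_weight :: "real \<Rightarrow> real" where
  "quartic_weight e = 2 * (real (card W) + 1 + 2 * e) ^ 2 + ((e + 1) ^ 2 + (e + 1)) ^ 2
     + 8 * e + 12 * e ^ 2 + 4 * e ^ 3 + 3 * (e ^ 2 - e)"

text \<open>The trace of the fourth power is the sum of the squares of the entries of the second power. Off the diagonal
  and away from the apex such an entry is \<open>(2 + e u + e v) * adj u v + 1 + codeg u v\<close>: adjacent vertices
  have no common base neighbour, because there is no triangle, and other pairs have at most one, because there is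
  no four-cycle, so the squares of the co-degrees are the co-degrees themselves, whose sum the
  degrees determine.\<close>

lemma kernel_trace_4_cone:
  assumes tf: base.triangle_free and c4: base.four_cycle_free
  shows "kernel_trace V qmat 4 =
    (real (card W) ^ 2 + card W) ^ 2 + real (card W) * (real (card W) - 1)
      + (\<Sum>u\<in>W. quartic_weight (base.deg u)) - base_defect"
proof -
  define N where "N = real (card W)"
  define e where "e u = real (base.deg u)" for u
  have zz: "kernel_pow V qmat 2 z z = N ^ 2 + N"
    by (simp add: kernel_pow_2 deg_z N_def)
  have zu: "kernel_pow V qmat 2 z u = N + 1 + 2 * e u" "kernel_pow V qmat 2 u z = N + 1 + 2 * e u"
    if "u \<in> W" for u
    using that W_V[OF that] z_E[OF that] W_iff[of u]
    by (auto simp: kernel_pow_2 deg_z deg_W codeg_z_W N_def e_def adj_def)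
  \<comment> \<open>\<open>pair u v\<close> is \<open>(2 + e u + e v)\<^sup>2 + 2 * (2 + e u + e v)\<close>, written so that the difference of degrees appears.\<close>
  define pair where "pair = (\<lambda>u v. (8 + 6 * (e u + e v) + 2 * e u ^ 2 + 2 * e v ^ 2 - (e u - e v) ^ 2))"
  have uv: "kernel_pow V qmat 2 u v ^ 2 =
      (1 + 3 * real (base.codeg u v) + base.adj u v * pair u v)
      + (if u = v then ((e u + 1) ^ 2 + (e u + 1)) ^ 2 - 1 - 3 * e u else 0)"
    if uv: "u \<in> W" "v \<in> W" for u v
  proof (cases "u = v")
    case True
    then show ?thesis
      using uv W_V by (simp add: kernel_pow_2 deg_W codeg_W e_def)
  next
    case False
    have k: "kernel_pow V qmat 2 u v = (2 + e u + e v) * base.adj u v + 1 + real (base.codeg u v)"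
      using uv W_V False by (simp add: kernel_pow_2 deg_W codeg_W adj_W e_def)
    show ?thesis
    proof (cases "(u, v) \<in> base_E")
      case True
      have "base.codeg u v = 0" by (rule base.triangle_freeD[OF tf True])
      then show ?thesis
        using True False unfolding k
        by (simp add: base.adj_def pair_def algebra_simps power2_eq_square)
    next
      case nadj: False
      have "base.codeg u v \<le> 1"
        using c4 uv False by (simp add: base.four_cycle_free_def)
      then have "base.codeg u v = 0 \<or> base.codeg u v = 1" by linarith
      then show ?thesis
        using nadj False unfolding k by (auto simp: base.adj_def)
    qed
  qed
  have "kernel_trace V qmat 4 = (N ^ 2 + N) ^ 2 + 2 * (\<Sum>u\<in>W. (N + 1 + 2 * e u) ^ 2)
      + (\<Sum>u\<in>W. \<Sum>v\<in>W. kernel_pow V qmat 2 u v ^ 2)"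
    unfolding kernel_trace_4 by (simp add: sum_V zz zu sum.distrib)
  also have "(\<Sum>u\<in>W. \<Sum>v\<in>W. kernel_pow V qmat 2 u v ^ 2) =
     (\<Sum>u\<in>W. \<Sum>v\<in>W. (1 + 3 * real (base.codeg u v) + base.adj u v * pair u v)
      + (if u = v then ((e u + 1) ^ 2 + (e u + 1)) ^ 2 - 1 - 3 * e u else 0))"
    by (intro sum.cong refl uv)
  also have "\<dots> = N * N + 3 * (\<Sum>u\<in>W. e u ^ 2) + (\<Sum>u\<in>W. \<Sum>v\<in>base.nb u. pair u v)
      + (\<Sum>u\<in>W. ((e u + 1) ^ 2 + (e u + 1)) ^ 2) - N - 3 * (\<Sum>u\<in>W. e u)"
    using base.sum_codeg
    by (simp add: sum.distrib sum_subtractf base.sum_adj N_def e_def flip: sum_distrib_left)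
  also have "(\<Sum>u\<in>W. \<Sum>v\<in>base.nb u. pair u v) =
      8 * (\<Sum>u\<in>W. e u) + 12 * (\<Sum>u\<in>W. e u ^ 2) + 4 * (\<Sum>u\<in>W. e u ^ 3) - base_defect"
  proof -
    have swap: "(\<Sum>u\<in>W. \<Sum>v\<in>base.nb u. g (e v)) = (\<Sum>u\<in>W. e u * g (e u))" for g :: "real \<Rightarrow> real"
      using base.arc_sum_swap[of "\<lambda>u v. g (e v)"] by (simp add: e_def base.deg_def)
    have const: "(\<Sum>u\<in>W. \<Sum>v\<in>base.nb u. g (e u)) = (\<Sum>u\<in>W. e u * g (e u))" for g :: "real \<Rightarrow> real"
      by (simp add: e_def base.deg_def)
    have "(\<Sum>u\<in>W. \<Sum>v\<in>base.nb u. pair u v) =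
        (\<Sum>u\<in>W. \<Sum>v\<in>base.nb u. 8 + 6 * e u + 2 * e u ^ 2) +
        (\<Sum>u\<in>W. \<Sum>v\<in>base.nb u. 6 * e v + 2 * e v ^ 2) - base_defect"
      unfolding pair_def base_defect_def e_def by (simp add: sum.distrib sum_subtractf algebra_simps)
    also have "(\<Sum>u\<in>W. \<Sum>v\<in>base.nb u. 8 + 6 * e u + 2 * e u ^ 2) = (\<Sum>u\<in>W. e u * (8 + 6 * e u + 2 * e u ^ 2))"
      by (rule const)
    also have "(\<Sum>u\<in>W. \<Sum>v\<in>base.nb u. 6 * e v + 2 * e v ^ 2) = (\<Sum>u\<in>W. e u * (6 * e u + 2 * e u ^ 2))"
      by (rule swap)
    finally show ?thesis
      by (simp add: sum_distrib_left)
        (simp add: algebra_simps sum.distrib sum_distrib_left power2_eq_square power3_eq_cube)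
  qed
  finally show ?thesis
    by (simp add: quartic_weight_def sum.distrib sum_subtractf N_def e_def algebra_simps flip: sum_distrib_left)
qed

lemma base_defect_0_iff: "base_defect = 0 \<longleftrightarrow> base.componentwise_regular"
proof -
  have "base_defect = 0 \<longleftrightarrow> (\<forall>u\<in>W. \<forall>v\<in>base.nb u. (real (base.deg u) - real (base.deg v)) ^ 2 = 0)"
    unfolding base_defect_def by (simp add: sum_nonneg_eq_0_iff sum_nonneg)
  also have "\<dots> \<longleftrightarrow> base.componentwise_regular"
    using base.E_sub by (auto simp: base.componentwise_regular_def)
  finally show ?thesis .
qed

end

lemma sum_by_counts:
  fixes e :: "'a \<Rightarrow> nat" and g :: "nat \<Rightarrow> real"
  assumes "finite W" "\<And>u. u \<in> W \<Longrightarrow> e u \<le> 2"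
  shows "(\<Sum>u\<in>W. g (e u)) = (\<Sum>i\<le>2. real (card {u \<in> W. e u = i}) * g i)"
proof -
  have "(\<Sum>u\<in>W. g (e u)) = (\<Sum>i\<le>2. \<Sum>u | u \<in> W \<and> e u = i. g (e u))"
    using assms by (intro sum.group[symmetric]) auto
  then show ?thesis by simp
qed

lemma counts_eqI:
  fixes e :: "'a \<Rightarrow> nat" and e' :: "'b \<Rightarrow> nat"
  assumes "finite W" "\<And>u. u \<in> W \<Longrightarrow> e u \<le> 2" "finite W'" "\<And>u. u \<in> W' \<Longrightarrow> e' u \<le> 2"
    and "card W = card W'" "(\<Sum>u\<in>W. real (e u)) = (\<Sum>u\<in>W'. real (e' u))"
    "(\<Sum>u\<in>W. real (e u) ^ 2) = (\<Sum>u\<in>W'. real (e' u) ^ 2)"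
  shows "card {u \<in> W. e u = i} = card {u \<in> W'. e' u = i}"
proof (cases "i \<le> 2")
  case True
  note s = sum_by_counts[of W e, OF assms(1,2)] sum_by_counts[of W' e', OF assms(3,4)]
  have "real (card W) = real (card W')" using assms(5) by simp
  then have 0: "(\<Sum>i\<le>2. real (card {u \<in> W. e u = i})) = (\<Sum>i\<le>2. real (card {u \<in> W'. e' u = i}))"
    using s[of "\<lambda>_. 1"] by simp
  have 1: "(\<Sum>i\<le>2. real (card {u \<in> W. e u = i}) * real i) = (\<Sum>i\<le>2. real (card {u \<in> W'. e' u = i}) * real i)"
    using assms(6) s[of real] by simp
  have 2: "(\<Sum>i\<le>2. real (card {u \<in> W. e u = i}) * real i ^ 2) = (\<Sum>i\<le>2. real (card {u \<in> W'. e' u = i}) * real i ^ 2)"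
    using assms(7) s[of "\<lambda>i. real i ^ 2"] by simp
  have "i = 0 \<or> i = 1 \<or> i = 2" using True by linarith
  then show ?thesis using 0 1 2 by (auto simp: numeral_2_eq_2)
next
  case False
  then have "{u \<in> W. e u = i} = {}" "{u \<in> W'. e' u = i} = {}"
    using assms(2,4) by force+
  then show ?thesis by (simp only: card.empty)
qed

text \<open>Once \<open>largest_degree_forced\<close> has produced the apex of the other graph, the three trace identities reduce to
  identities between the bases. The falling factorial \<open>e * (e - 1) * (e - 2)\<close> is chosen because it is nonnegative
  and vanishes exactly for \<open>e \<le> 2\<close>: its sum, together with the triangle count of the base, is zero for the given cone,
  so every single term is zero for the other one.\<close>

lemma (in cone) cospectral_is_cone:
  fixes V' :: "'b set"
  assumes G: "\<And>u. u \<in> W \<Longrightarrow> base.deg u \<le> 2" base.triangle_free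
    and H: "simple_graph V' E'"
    and n: "card V' = card V" "card V \<ge> 33"
    and tr: "\<And>k. kernel_trace V' (simple_graph.qmat E') k = kernel_trace V qmat k"
  obtains z' where "cone V' E' z'"
    and "\<And>u. u \<in> cone.W V' z' \<Longrightarrow> simple_graph.deg (cone.base_E V' E' z') u \<le> 2"
    and "simple_graph.triangle_free (cone.W V' z') (cone.base_E V' E' z')"
    and "\<And>i. card {u \<in> cone.W V' z'. simple_graph.deg (cone.base_E V' E' z') u = i} = card {u \<in> W. base.deg u = i}"
proof -
  interpret H: simple_graph V' E' by (rule H)
  have "V' \<noteq> {}" using n by auto
  then obtain z' where z': "z' \<in> V'" "\<And>u. u \<in> V' \<Longrightarrow> H.deg u \<le> H.deg z'"
    using H.finite_V Max_in[of "H.deg ` V'"] Max_ge[of "H.deg ` V'"] by fastforce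
  have s1: "(\<Sum>u\<in>V'. real (H.deg u)) = (\<Sum>u\<in>V. real (deg u))"
    using tr[of 1] by (simp only: H.kernel_trace_1 kernel_trace_1)
  have s2: "(\<Sum>u\<in>V'. real (H.deg u) ^ 2) = (\<Sum>u\<in>V. real (deg u) ^ 2)"
    using tr[of 2] s1 by (simp only: H.kernel_trace_2 kernel_trace_2)
  have s3: "(\<Sum>u\<in>V'. real (H.deg u) ^ 3) + real (\<Sum>u\<in>V'. H.triangles_at u) =
     (\<Sum>u\<in>V. real (deg u) ^ 3) + real (\<Sum>u\<in>V. triangles_at u)"
    using tr[of 3] s2 by (simp only: H.kernel_trace_3 kernel_trace_3)
  have T: "(\<Sum>u\<in>V. triangles_at u) = 3 * (\<Sum>u\<in>W. base.deg u)"
    using G(2) by (simp add: sum_triangles_at base.triangle_free_def)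
  define N where "N = real (card W)"
  define K where "K = real (card {u \<in> W. base.deg u = 2})"
  define P where "P = real (card {u \<in> W. base.deg u = 1})"
  define s where "s = real (card {u \<in> W. base.deg u = 0})"
  have cnt: "(\<Sum>u\<in>W. g (base.deg u)) = s * g 0 + P * g 1 + K * g 2" for g :: "nat \<Rightarrow> real"
    using sum_by_counts[of W base.deg g] G(1) by (simp add: K_def P_def s_def numeral_2_eq_2)
  have NK: "N = K + P + s" using cnt[of "\<lambda>_. 1"] by (simp add: N_def)
  have b1: "(\<Sum>u\<in>W. real (base.deg u)) = 2 * K + P" using cnt[of real] by simp
  have d1: "(\<Sum>u\<in>V. real (deg u)) = N + 3 * K + 2 * P + s"
    using deg_sums[of 1] cnt[of "\<lambda>i. real i + 1"] by (simp add: N_def)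
  have d2: "(\<Sum>u\<in>V. real (deg u) ^ 2) = N ^ 2 + 9 * K + 4 * P + s"
    using deg_sums[of 2] cnt[of "\<lambda>i. (real i + 1) ^ 2"] by (simp add: N_def)
  have d3: "(\<Sum>u\<in>V. real (deg u) ^ 3) = N ^ 3 + 27 * K + 8 * P + s"
    using deg_sums[of 3] cnt[of "\<lambda>i. (real i + 1) ^ 3"] by (simp add: N_def)
  have Hsum: "sum f V' = f z' + sum f (V' - {z'})" for f :: "'b \<Rightarrow> real"
    using z'(1) H.finite_V by (rule sum.remove[rotated])
  have x: "real (H.deg z') = N"
  proof (rule largest_degree_forced[where W = "V' - {z'}" and d = H.deg and K = K and P = P and s = s
        and T = "real (\<Sum>u\<in>V'. H.triangles_at u)"])
    show "finite (V' - {z'})" using H.finite_V by simp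
    show "real (card (V' - {z'})) = N"
      using z'(1) n H.finite_V by (simp add: N_def card_V)
    show "N \<ge> 32" using n by (simp add: N_def card_V)
    show "real (H.deg z') \<le> N" using H.deg_le[OF z'(1)] n by (simp add: N_def card_V)
    show "real (H.deg z') + (\<Sum>u\<in>V' - {z'}. real (H.deg u)) = N + 3 * K + 2 * P + s"
      using s1 d1 Hsum by simp
    show "real (H.deg z') ^ 2 + (\<Sum>u\<in>V' - {z'}. real (H.deg u) ^ 2) = N ^ 2 + 9 * K + 4 * P + s"
      using s2 d2 Hsum by simp
    have "real (\<Sum>u\<in>V. triangles_at u) = 3 * (2 * K + P)"
      using b1 by (simp add: T flip: of_nat_sum)
    then show "real (H.deg z') ^ 3 + (\<Sum>u\<in>V' - {z'}. real (H.deg u) ^ 3) + real (\<Sum>u\<in>V'. H.triangles_at u)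
        = N ^ 3 + 27 * K + 8 * P + s + 3 * (2 * K + P)"
      using s3 d3 Hsum[of "\<lambda>u. real (H.deg u) ^ 3"] by simp
    have "real (\<Sum>u\<in>V' - {z'}. H.triangles_at u) \<le> (\<Sum>u\<in>V' - {z'}. real (H.deg u) * (real (H.deg u) - 1))"
      unfolding of_nat_sum
    proof (rule sum_mono)
      fix u
      have "real (H.triangles_at u) \<le> real (H.deg u * (H.deg u - 1))"
        using H.triangles_at_le[of u] by (simp only: of_nat_le_iff)
      also have "\<dots> = real (H.deg u) * (real (H.deg u) - 1)"
        by (cases "H.deg u") (auto simp: algebra_simps)
      finally show "real (H.triangles_at u) \<le> real (H.deg u) * (real (H.deg u) - 1)" .
    qed
    then show "real (\<Sum>u\<in>V'. H.triangles_at u) \<le> (\<Sum>u\<in>V' - {z'}. real (H.deg u)) - real (H.deg z')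
        + (\<Sum>u\<in>V' - {z'}. real (H.deg u) * (real (H.deg u) - 1))"
      using H.triangles_at_le_rest[OF z'(1)] Hsum[of "\<lambda>u. real (H.triangles_at u)"] by simp
  qed (use z'(2) NK in \<open>auto simp: K_def P_def s_def\<close>)
  have co: "H.cone_over z'"
    using x z'(1) n by (intro H.cone_over_degI) (auto simp: N_def card_V)
  interpret H: cone V' E' z' by unfold_locales (rule co)
  have cW: "card H.W = card W" using n by (simp add: H.card_V card_V)
  have e1: "(\<Sum>u\<in>H.W. real (H.base.deg u)) = (\<Sum>u\<in>W. real (base.deg u))"
    using s1 deg_sums[of 1] H.deg_sums[of 1] cW by (simp add: sum.distrib)
  have e2: "(\<Sum>u\<in>H.W. real (H.base.deg u) ^ 2) = (\<Sum>u\<in>W. real (base.deg u) ^ 2)"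
    using s2 e1 deg_sums[of 2] H.deg_sums[of 2] cW
    by (simp add: sum.distrib algebra_simps power2_eq_square flip: sum_distrib_left)
  have e3: "(\<Sum>u\<in>H.W. real (H.base.deg u) ^ 3) + real (\<Sum>u\<in>H.W. H.base.triangles_at u) = (\<Sum>u\<in>W. real (base.deg u) ^ 3)"
  proof -
    have cube: "(\<Sum>u\<in>X. (real (f u) + 1) ^ 3) = (\<Sum>u\<in>X. real (f u) ^ 3) + 3 * (\<Sum>u\<in>X. real (f u) ^ 2)
        + 3 * (\<Sum>u\<in>X. real (f u)) + real (card X)" for X :: "'c set" and f
      by (simp add: sum.distrib sum_distrib_left algebra_simps power2_eq_square power3_eq_cube)
    have "real (\<Sum>u\<in>H.W. H.base.deg u) = real (\<Sum>u\<in>W. base.deg u)" using e1 by simp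
    then show ?thesis
      using s3 e1 e2 deg_sums[of 3] H.deg_sums[of 3] cW
      by (simp add: T H.sum_triangles_at cube)
  qed
  have zero: "(\<Sum>u\<in>H.W. real (H.base.deg u) * (real (H.base.deg u) - 1) * (real (H.base.deg u) - 2))
      + real (\<Sum>u\<in>H.W. H.base.triangles_at u) = 0"
  proof -
    have fall: "(\<Sum>u\<in>X. real (f u) * (real (f u) - 1) * (real (f u) - 2)) =
        (\<Sum>u\<in>X. real (f u) ^ 3) - 3 * (\<Sum>u\<in>X. real (f u) ^ 2) + 2 * (\<Sum>u\<in>X. real (f u))" for X :: "'c set" and f
      by (simp add: sum.distrib sum_subtractf sum_distrib_left algebra_simps power2_eq_square power3_eq_cube)
    have "(\<Sum>u\<in>W. real (base.deg u) * (real (base.deg u) - 1) * (real (base.deg u) - 2)) = 0"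
      using cnt[of "\<lambda>i. real i * (real i - 1) * (real i - 2)"] by simp
    then show ?thesis using e1 e2 e3 by (simp add: fall)
  qed
  have nonneg: "real m * (real m - 1) * (real m - 2) \<ge> 0" for m
    by (cases "m \<ge> 2") (auto simp: not_le less_2_cases_iff)
  have "(\<Sum>u\<in>H.W. real (H.base.deg u) * (real (H.base.deg u) - 1) * (real (H.base.deg u) - 2)) \<ge> 0"
    using nonneg by (rule sum_nonneg)
  with zero have z1: "(\<Sum>u\<in>H.W. real (H.base.deg u) * (real (H.base.deg u) - 1) * (real (H.base.deg u) - 2)) = 0"
    and z2: "(\<Sum>u\<in>H.W. H.base.triangles_at u) = 0"
    by linarith+
  have le2: "H.base.deg u \<le> 2" if "u \<in> H.W" for u
    using z1 that nonneg by (subst (asm) sum_nonneg_eq_0_iff) auto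
  show thesis
  proof (rule that)
    show "cone V' E' z'" by unfold_locales
    show "H.base.deg u \<le> 2" if "u \<in> H.W" for u by (rule le2[OF that])
    show H.base.triangle_free using z2 by (simp add: H.base.triangle_free_def)
    show "card {u \<in> H.W. H.base.deg u = i} = card {u \<in> W. base.deg u = i}" for i
      using le2 G(1) cW e1 e2 by (intro counts_eqI) auto
  qed
qed

section \<open>Edge space and the eigenvalue one\<close>

context simple_graph
begin

definition edges :: "'a set set" where
  "edges = {{u, v} | u v. (u, v) \<in> E}"

text \<open>Linear independence of the incidence vectors of the edges: a weighting of the edges that sums to zero at
  every vertex is zero. A connected graph with this property is a tree or has a single cycle, of odd length.\<close>

definition edge_independent :: bool where
  "edge_independent \<longleftrightarrow>
     (\<forall>c :: 'a set \<Rightarrow> real. (\<forall>v\<in>V. (\<Sum>w\<in>nb v. c {v, w}) = 0) \<longrightarrow> (\<forall>(u, v)\<in>E. c {u, v} = 0))"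

lemma edges_sub: "\<epsilon> \<in> edges \<Longrightarrow> \<epsilon> \<subseteq> V"
  using E_sub by (auto simp: edges_def)

lemma finite_edges [simp]: "finite edges"
  using edges_sub finite_V by (intro finite_subset[of edges "Pow V"]) auto

lemma card_edge: "\<epsilon> \<in> edges \<Longrightarrow> card \<epsilon> = 2"
  using E_irrefl by (auto simp: edges_def card_insert_if)

lemma sum_edges_at:
  fixes c :: "'a set \<Rightarrow> real"
  shows "(\<Sum>\<epsilon>\<in>edges. of_bool (v \<in> \<epsilon>) * c \<epsilon>) = (\<Sum>w\<in>nb v. c {v, w})"
proof -
  have "(\<Sum>\<epsilon>\<in>edges. of_bool (v \<in> \<epsilon>) * c \<epsilon>) = (\<Sum>\<epsilon>\<in>(\<lambda>w. {v, w}) ` nb v. c \<epsilon>)"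
  proof (rule sum.mono_neutral_cong_right)
    show "(\<lambda>w. {v, w}) ` nb v \<subseteq> edges" unfolding edges_def nb_def by blast
    show "\<forall>\<epsilon>\<in>edges - (\<lambda>w. {v, w}) ` nb v. of_bool (v \<in> \<epsilon>) * c \<epsilon> = 0"
      using E_sym by (fastforce simp: edges_def doubleton_eq_iff)
  qed auto
  also have "\<dots> = (\<Sum>w\<in>nb v. c {v, w})"
    by (rule sum.reindex_cong[where l = "\<lambda>w. {v, w}"]) (auto simp: inj_on_def doubleton_eq_iff)
  finally show ?thesis .
qed

lemma handshake: "(\<Sum>v\<in>V. real (deg v)) = 2 * real (card edges)"
proof -
  have "(\<Sum>v\<in>V. real (deg v)) = (\<Sum>v\<in>V. \<Sum>\<epsilon>\<in>edges. of_bool (v \<in> \<epsilon>))"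
    using sum_edges_at[of _ "\<lambda>_. 1"] by (simp add: deg_def)
  also have "\<dots> = (\<Sum>\<epsilon>\<in>edges. \<Sum>v\<in>V. of_bool (v \<in> \<epsilon>))"
    by (rule sum.swap)
  also have "\<dots> = (\<Sum>\<epsilon>\<in>edges. 2)"
  proof (rule sum.cong[OF refl])
    fix \<epsilon> assume \<epsilon>: "\<epsilon> \<in> edges"
    then have "V \<inter> \<epsilon> = \<epsilon>" using edges_sub by auto
    then show "(\<Sum>v\<in>V. of_bool (v \<in> \<epsilon>)) = (2::real)"
      using card_edge[OF \<epsilon>] finite_V by (simp add: of_bool_def sum.If_cases)
  qed
  finally show ?thesis by simp
qed

lemma sum_single_edge:
  assumes "(p, q) \<in> E"
  shows "(\<Sum>w\<in>nb x. of_bool ({x, w} = {p, q})) = (of_bool (x = p) + of_bool (x = q) :: real)"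
proof -
  have pq: "p \<noteq> q" "(q, p) \<in> E" using assms E_irrefl E_sym by auto
  have "(\<Sum>w\<in>nb x. of_bool ({x, w} = {p, q})) =
      (\<Sum>w\<in>nb x. (if w = q then of_bool (x = p) else 0) + (if w = p then of_bool (x = q) else (0::real)))"
    using pq by (intro sum.cong) (auto simp: doubleton_eq_iff)
  also have "\<dots> = of_bool (x = p) + of_bool (x = q)"
    using assms pq by (auto simp: sum.distrib)
  finally show ?thesis .
qed

text \<open>Alternating signs around a four-cycle are a dependency.\<close>

lemma edge_independent_four_cycle_free:
  assumes edge_independent
  shows four_cycle_free
  unfolding four_cycle_free_def
proof (intro ballI impI, rule ccontr)
  fix u v assume uv: "u \<in> V" "v \<in> V" "u \<noteq> v" and "\<not> codeg u v \<le> 1"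
  then have "\<not> card (nb u \<inter> nb v) \<le> Suc 0" by (simp add: codeg_def)
  then have "\<not> (\<forall>a\<in>nb u \<inter> nb v. \<forall>b\<in>nb u \<inter> nb v. a = b)"
    by (subst (asm) card_le_Suc0_iff_eq) simp_all
  then obtain a b where ab: "a \<noteq> b" "(u, a) \<in> E" "(v, a) \<in> E" "(u, b) \<in> E" "(v, b) \<in> E"
    by auto
  have ne: "u \<noteq> a" "v \<noteq> a" "u \<noteq> b" "v \<noteq> b" using ab E_irrefl by auto
  define c where "c = (\<lambda>\<epsilon>. of_bool (\<epsilon> = {u, a}) - of_bool (\<epsilon> = {v, a}) +
    of_bool (\<epsilon> = {v, b}) - (of_bool (\<epsilon> = {u, b}) :: real))"
  have "(\<Sum>w\<in>nb x. c {x, w}) = 0" for x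
    unfolding c_def sum.distrib sum_subtractf using ab by (simp only: sum_single_edge)
  then have "c {u, a} = 0"
    using assms ab(2) unfolding edge_independent_def by blast
  moreover have "c {u, a} = 1"
    using uv(3) ab(1) ne by (auto simp: c_def doubleton_eq_iff)
  ultimately show False by simp
qed

end

context cone
begin

text \<open>The factorisation of the signless Laplacian of a cone minus the identity, as \<open>inc_product\<close> shows.
  The base contributes its unsigned incidence matrix times the transpose. The two inner indices after the
  edges carry the row, the column and the diagonal entry of the apex.\<close>

definition inc_left :: "'a set list \<Rightarrow> 'a \<Rightarrow> nat \<Rightarrow> real" where
  "inc_left es v j = (if j < length es then of_bool (v \<in> es ! j)
     else if j = length es then of_bool (v = z) else of_bool (v \<noteq> z))"

definition inc_right :: "'a set list \<Rightarrow> nat \<Rightarrow> 'a \<Rightarrow> real" where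
  "inc_right es j v = (if j < length es then of_bool (v \<in> es ! j)
     else if j = length es then (if v = z then real (card W) - 1 else 1) else of_bool (v = z))"

definition left_mat :: "'a list \<Rightarrow> 'a set list \<Rightarrow> real mat" where
  "left_mat vs es = mat (length vs) (length es + 2) (\<lambda>(i, j). inc_left es (vs ! i) j)"

definition right_mat :: "'a list \<Rightarrow> 'a set list \<Rightarrow> real mat" where
  "right_mat vs es = mat (length es + 2) (length vs) (\<lambda>(j, i). inc_right es j (vs ! i))"

context
  fixes vs :: "'a list" and es :: "'a set list"
  assumes vs: "distinct vs" "set vs = V" and es: "distinct es" "set es = base.edges"
begin

lemma mats_carrier: "left_mat vs es \<in> carrier_mat (length vs) (length es + 2)"
  "right_mat vs es \<in> carrier_mat (length es + 2) (length vs)"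
  by (simp_all add: left_mat_def right_mat_def)

lemma z_notin_edge [simp]: "j < length es \<Longrightarrow> z \<notin> es ! j"
  using base.edges_sub[of "es ! j"] es(2) nth_mem[of j es] by auto

lemma sum_es: "(\<Sum>j<length es. g (es ! j)) = sum g base.edges"
  using sum_nth_distinct[OF es(1), of g] es(2) by simp

lemma sum_split_2: "(\<Sum>j<length es + 2. g j) = (\<Sum>j<length es. g j) + g (length es) + g (Suc (length es))"
  for g :: "nat \<Rightarrow> real"
  by (simp add: eval_nat_numeral)

lemma inc_product:
  assumes "u \<in> V" "v \<in> V"
  shows "(\<Sum>j<length es + 2. inc_left es u j * inc_right es j v) = qmat u v - of_bool (u = v)"
proof -
  have "(\<Sum>j<length es. inc_left es u j * inc_right es j v) =
      (\<Sum>j<length es. (\<lambda>\<epsilon>. of_bool (u \<in> \<epsilon>) * of_bool (v \<in> \<epsilon>)) (es ! j))"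
    by (intro sum.cong) (auto simp: inc_left_def inc_right_def)
  also have "\<dots> = (\<Sum>w\<in>base.nb u. of_bool (v \<in> {u, w}))"
    using sum_es[of "\<lambda>\<epsilon>. of_bool (u \<in> \<epsilon>) * of_bool (v \<in> \<epsilon>) :: real"]
      base.sum_edges_at[of u "\<lambda>\<epsilon>. of_bool (v \<in> \<epsilon>)"] by (simp only:)
  also have "\<dots> = (if u = v then real (base.deg u) else base.adj u v)"
  proof (cases "u = v")
    case False
    then have "(\<Sum>w\<in>base.nb u. of_bool (v \<in> {u, w})) = (\<Sum>w\<in>base.nb u. if w = v then 1 else 0 :: real)"
      by (intro sum.cong) auto
    then show ?thesis using False by (simp add: base.adj_def)
  qed (simp add: base.deg_def)
  finally have *: "(\<Sum>j<length es. inc_left es u j * inc_right es j v) =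
     (if u = v then real (base.deg u) else base.adj u v)" .
  have z: "base.deg z = 0" "base.adj z w = 0" "base.adj w z = 0" for w
    by (auto simp: base.deg_def base.adj_def base.nb_def base_E_iff)
  show ?thesis
    unfolding sum_split_2 *
    using assms W_iff[of u] W_iff[of v] z_E[of u] z_E[of v] E_irrefl[of u]
    by (auto simp: inc_left_def inc_right_def qmat_def deg_z deg_W z adj_def base.adj_def base_E_iff)
qed

lemma left_right_mat:
  "left_mat vs es * right_mat vs es = kernel_mat vs qmat - 1\<^sub>m (length vs)"
proof (rule eq_matI)
  fix i j assume "i < dim_row (kernel_mat vs qmat - 1\<^sub>m (length vs))"
    "j < dim_col (kernel_mat vs qmat - 1\<^sub>m (length vs))"
  then have ij: "i < length vs" "j < length vs" by auto
  then have V: "vs ! i \<in> V" "vs ! j \<in> V" using vs(2) by auto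
  show "(left_mat vs es * right_mat vs es) $$ (i, j) = (kernel_mat vs qmat - 1\<^sub>m (length vs)) $$ (i, j)"
    using inc_product[OF V] ij vs(1)
    by (simp add: left_mat_def right_mat_def kernel_mat_def scalar_prod_def atLeast0LessThan nth_eq_iff_index_eq)
qed (auto simp: left_mat_def right_mat_def)

lemma char_poly_shift:
  "poly (char_poly (kernel_mat vs qmat)) (y + 1) =
     det (y \<cdot>\<^sub>m 1\<^sub>m (length vs) - left_mat vs es * right_mat vs es)"
proof -
  have c: "kernel_mat vs qmat \<in> carrier_mat (length vs) (length vs)" by simp
  show ?thesis
    unfolding char_poly_matrix[OF c] left_right_mat
    by (rule arg_cong[where f = det], rule eq_matI) (auto simp: char_matrix_def)
qed

lemma right_left_apply:
  assumes x: "x \<in> carrier_vec (length es + 2)" and j: "j < length es + 2"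
  shows "(right_mat vs es * left_mat vs es *\<^sub>v x) $ j =
    (\<Sum>v\<in>V. inc_right es j v * (\<Sum>i<length es + 2. inc_left es v i * x $ i))"
proof -
  have "(right_mat vs es * left_mat vs es *\<^sub>v x) $ j = (right_mat vs es *\<^sub>v (left_mat vs es *\<^sub>v x)) $ j"
    using assoc_mult_mat_vec[OF mats_carrier(2,1) x] by simp
  also have "\<dots> = (\<Sum>k<length vs. inc_right es j (vs ! k) * (\<Sum>i<length es + 2. inc_left es (vs ! k) i * x $ i))"
    using x j by (simp add: left_mat_def right_mat_def scalar_prod_def atLeast0LessThan)
  also have "\<dots> = (\<Sum>v\<in>V. inc_right es j v * (\<Sum>i<length es + 2. inc_left es v i * x $ i))"
    using sum_nth_distinct[OF vs(1), of "\<lambda>v. inc_right es j v * (\<Sum>i<length es + 2. inc_left es v i * x $ i)"] vs(2)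
    by simp
  finally show ?thesis .
qed

lemma right_left_carrier: "right_mat vs es * left_mat vs es \<in> carrier_mat (length es + 2) (length es + 2)"
  using mats_carrier by auto

text \<open>A kernel vector \<open>x\<close> of the product in the reverse order is mapped by the left factor to some \<open>w\<close> that is
  orthogonal to all columns of the left factor, since these columns are combinations of the rows of the right
  factor. As a combination of these columns, \<open>w\<close> is orthogonal to itself and so zero. Reading off \<open>w = 0\<close> at the
  apex and at an isolated base vertex kills the two extra coordinates of \<open>x\<close>, and independence of the edges
  kills the others.\<close>

lemma det_nonzero:
  assumes ind: base.edge_independent and iso: "u0 \<in> W" "base.deg u0 = 0"
  shows "det (right_mat vs es * left_mat vs es) \<noteq> 0"
proof
  assume "det (right_mat vs es * left_mat vs es) = 0"
  then obtain x where x: "x \<in> carrier_vec (length es + 2)" "x \<noteq> 0\<^sub>v (length es + 2)"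
    "right_mat vs es * left_mat vs es *\<^sub>v x = 0\<^sub>v (length es + 2)"
    using det_0_iff_vec_prod_zero[OF right_left_carrier] by blast
  let ?m = "length es"
  define w where "w v = (\<Sum>i<?m + 2. inc_left es v i * x $ i)" for v
  have right0: "(\<Sum>v\<in>V. inc_right es j v * w v) = 0" if "j < ?m + 2" for j
    using right_left_apply[OF x(1) that] x(3) that by (simp add: w_def)
  have left0: "(\<Sum>v\<in>V. inc_left es v j * w v) = 0" if j: "j < ?m + 2" for j
  proof -
    consider "j < ?m" | "j = ?m" | "j = Suc ?m" using j by linarith
    then show ?thesis
    proof cases
      case 1
      then show ?thesis using right0[OF j] by (simp add: inc_left_def inc_right_def)
    next
      case 2
      then show ?thesis using right0[of "Suc ?m"] by (simp add: inc_left_def inc_right_def)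
    next
      case 3
      have "(\<Sum>v\<in>V. inc_left es v j * w v) =
          (\<Sum>v\<in>V. inc_right es ?m v * w v - (real (card W) - 1) * (inc_right es (Suc ?m) v * w v))"
        using 3 by (intro sum.cong) (auto simp: inc_left_def inc_right_def)
      then show ?thesis
        using right0[of ?m] right0[of "Suc ?m"] by (simp add: sum_subtractf flip: sum_distrib_left)
    qed
  qed
  have "(\<Sum>v\<in>V. w v * w v) = (\<Sum>v\<in>V. \<Sum>i<?m + 2. x $ i * (inc_left es v i * w v))"
  proof (rule sum.cong[OF refl])
    fix v
    have "w v * w v = (\<Sum>i<?m + 2. inc_left es v i * x $ i) * w v"
      by (subst (1) w_def) (rule refl)
    also have "\<dots> = (\<Sum>i<?m + 2. x $ i * (inc_left es v i * w v))"
      unfolding sum_distrib_right by (rule sum.cong) (simp_all only: mult_ac)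
    finally show "w v * w v = (\<Sum>i<?m + 2. x $ i * (inc_left es v i * w v))" .
  qed
  also have "\<dots> = (\<Sum>i<?m + 2. x $ i * (\<Sum>v\<in>V. inc_left es v i * w v))"
    by (subst sum.swap) (simp only: sum_distrib_left)
  also have "\<dots> = 0" by (rule sum.neutral) (simp add: left0)
  finally have w0: "w v = 0" if "v \<in> V" for v
    using that finite_V by (simp add: sum_nonneg_eq_0_iff)
  have w: "w v = (\<Sum>i<?m. of_bool (v \<in> es ! i) * x $ i) + of_bool (v = z) * x $ ?m + of_bool (v \<noteq> z) * x $ Suc ?m" for v
    unfolding w_def sum_split_2 by (simp add: inc_left_def mult.commute)
  have "x $ ?m = 0"
    using w0[OF z_V] unfolding w[of z] by simp
  have no: "u0 \<notin> es ! i" if "i < ?m" for i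
  proof
    assume u0: "u0 \<in> es ! i"
    have "es ! i \<in> base.edges" using nth_mem[OF that] es(2) by blast
    then obtain u v where uv: "es ! i = {u, v}" "(u, v) \<in> base_E"
      unfolding base.edges_def by blast
    have "base.nb u0 = {}"
      using iso(2) base.finite_nb unfolding base.deg_def by (simp only: card_0_eq)
    then have "u0 \<noteq> u" "u0 \<noteq> v"
      using uv(2) base.E_sym[OF uv(2)] unfolding base.nb_def by blast+
    then show False using u0 unfolding uv(1) by blast
  qed
  have "x $ Suc ?m = 0"
  proof -
    have "u0 \<noteq> z" using iso(1) by auto
    moreover have "(\<Sum>i<?m. of_bool (u0 \<in> es ! i) * x $ i) = 0"
      by (rule sum.neutral) (simp add: no)
    ultimately show ?thesis
      using w0[OF W_V[OF iso(1)]] unfolding w[of u0] by simp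
  qed
  define c where "c \<epsilon> = x $ (THE i. i < ?m \<and> es ! i = \<epsilon>)" for \<epsilon>
  have c: "c (es ! i) = x $ i" if "i < ?m" for i
  proof -
    have "(THE j. j < ?m \<and> es ! j = es ! i) = i"
      using that es(1) by (intro the_equality) (auto simp: nth_eq_iff_index_eq)
    then show ?thesis by (simp add: c_def)
  qed
  have "(\<Sum>u\<in>base.nb v. c {v, u}) = 0" if "v \<in> W" for v
  proof -
    have "(\<Sum>u\<in>base.nb v. c {v, u}) = (\<Sum>i<?m. of_bool (v \<in> es ! i) * c (es ! i))"
      using sum_es[of "\<lambda>\<epsilon>. of_bool (v \<in> \<epsilon>) * c \<epsilon>"] base.sum_edges_at[of v c] by simp
    also have "\<dots> = w v"
      using \<open>x $ ?m = 0\<close> \<open>x $ Suc ?m = 0\<close> by (simp add: w c)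
    finally show ?thesis using w0[OF W_V[OF that]] by simp
  qed
  then have "\<forall>(u, v)\<in>base_E. c {u, v} = 0"
    using ind by (simp add: base.edge_independent_def)
  then have "c \<epsilon> = 0" if "\<epsilon> \<in> base.edges" for \<epsilon>
    using that by (auto simp: base.edges_def)
  then have "x $ i = 0" if "i < ?m" for i
    using that es(2) c[OF that] nth_mem[OF that] by simp
  moreover have "i < ?m \<or> i = ?m \<or> i = Suc ?m" if "i < ?m + 2" for i using that by linarith
  ultimately have "x = 0\<^sub>v (?m + 2)"
    using x(1) \<open>x $ ?m = 0\<close> \<open>x $ Suc ?m = 0\<close> by (intro eq_vecI) auto
  with x(2) show False by simp
qed

lemma edge_independent_if_det_nonzero:
  assumes "det (right_mat vs es * left_mat vs es) \<noteq> 0"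
  shows base.edge_independent
  unfolding base.edge_independent_def
proof (intro allI impI)
  fix c :: "'a set \<Rightarrow> real"
  assume c: "\<forall>v\<in>W. (\<Sum>w\<in>base.nb v. c {v, w}) = 0"
  let ?m = "length es"
  define x where "x = vec (?m + 2) (\<lambda>j. if j < ?m then c (es ! j) else 0)"
  have x: "x \<in> carrier_vec (?m + 2)" by (simp add: x_def)
  have "(\<Sum>i<?m + 2. inc_left es v i * x $ i) = 0" if "v \<in> V" for v
  proof -
    have "(\<Sum>i<?m + 2. inc_left es v i * x $ i) = (\<Sum>i<?m. (\<lambda>\<epsilon>. of_bool (v \<in> \<epsilon>) * c \<epsilon>) (es ! i))"
      unfolding sum_split_2 by (simp add: x_def inc_left_def)
    also have "\<dots> = (\<Sum>w\<in>base.nb v. c {v, w})"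
      using sum_es[of "\<lambda>\<epsilon>. of_bool (v \<in> \<epsilon>) * c \<epsilon>"] base.sum_edges_at[of v c] by (simp only:)
    also have "\<dots> = 0"
    proof (cases "v = z")
      case True
      then have "base.nb v = {}" using base.E_sub by auto
      then show ?thesis by simp
    next
      case False
      then show ?thesis using c that by (simp add: W_iff)
    qed
    finally show ?thesis .
  qed
  then have "right_mat vs es * left_mat vs es *\<^sub>v x = 0\<^sub>v (?m + 2)"
    using right_left_apply[OF x] by (intro eq_vecI) (auto simp: right_mat_def)
  then have "x = 0\<^sub>v (?m + 2)"
    using assms det_0_iff_vec_prod_zero[OF right_left_carrier] x by blast
  then have "x $ j = 0" if "j < ?m" for j using that by simp
  then have "c (es ! j) = 0" if "j < ?m" for j
    using that by (simp add: x_def)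
  then have "c \<epsilon> = 0" if "\<epsilon> \<in> base.edges" for \<epsilon>
    using that es(2) by (metis in_set_conv_nth)
  then show "\<forall>(u, v)\<in>base_E. c {u, v} = 0" by (auto simp: base.edges_def)
qed

end

text \<open>Equality of \<open>n\<close>, of the number \<open>r\<close> of inner indices and of the characteristic polynomials passes through
  Sylvester's identity to the reversed products, first away from zero and then, as both sides are polynomials,
  also at zero.\<close>

lemma cospectral_edge_independent:
  assumes H: "cone V' E' z'"
    and ind: base.edge_independent and iso: "u0 \<in> W" "base.deg u0 = 0"
    and vs: "distinct vs" "set vs = V" and ws: "distinct ws" "set ws = V'"
    and len: "length vs = length ws"
    and cp: "char_poly (kernel_mat vs qmat) = char_poly (kernel_mat ws (simple_graph.qmat E'))"
    and edges: "card (simple_graph.edges (cone.base_E V' E' z')) = card base.edges"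
  shows "simple_graph.edge_independent (cone.W V' z') (cone.base_E V' E' z')"
proof -
  interpret H: cone V' E' z' by (rule H)
  obtain es where es: "distinct es" "set es = base.edges"
    using finite_distinct_list base.finite_edges by blast
  obtain fs where fs: "distinct fs" "set fs = H.base.edges"
    using finite_distinct_list H.base.finite_edges by blast
  have m: "length fs = length es"
    using edges es fs distinct_card by metis
  define n where "n = length vs"
  define r where "r = length es + 2"
  define A where "A = right_mat vs es * left_mat vs es"
  define B where "B = H.right_mat ws fs * H.left_mat ws fs"
  have car: "A \<in> carrier_mat r r" "B \<in> carrier_mat r r"
    using right_left_carrier[OF vs es] H.right_left_carrier[OF ws fs] by (simp_all add: A_def B_def m r_def)
  have eq: "det (y \<cdot>\<^sub>m 1\<^sub>m r - A) = det (y \<cdot>\<^sub>m 1\<^sub>m r - B)" if "y \<noteq> 0" for y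
  proof -
    have "y ^ n * det (y \<cdot>\<^sub>m 1\<^sub>m r - A) = y ^ r * poly (char_poly (kernel_mat vs qmat)) (y + 1)"
      using sylvester_det[OF mats_carrier[OF vs es], of y] char_poly_shift[OF vs es, of y]
      by (simp add: A_def n_def r_def)
    also have "\<dots> = y ^ n * det (y \<cdot>\<^sub>m 1\<^sub>m r - B)"
      using sylvester_det[OF H.mats_carrier[OF ws fs], of y] H.char_poly_shift[OF ws fs, of y]
      by (simp add: B_def n_def r_def len cp m)
    finally show ?thesis using that by simp
  qed
  have cpA: "poly (char_poly M) y = det (y \<cdot>\<^sub>m 1\<^sub>m r - M)" if "M \<in> carrier_mat r r" for M :: "real mat" and y
    unfolding char_poly_matrix[OF that]
    using that by (intro arg_cong[where f = det] eq_matI) (auto simp: char_matrix_def)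
  have "poly (char_poly A - char_poly B) y = 0" if "y \<noteq> 0" for y
    using eq[OF that] car by (simp add: cpA)
  then have "- {0} \<subseteq> {y. poly (char_poly A - char_poly B) y = 0}" by auto
  moreover have "infinite (- {0 :: real})"
  proof
    assume "finite (- {0 :: real})"
    then have "finite (insert 0 (- {0 :: real}))" by simp
    moreover have "insert 0 (- {0 :: real}) = UNIV" by auto
    ultimately show False using infinite_UNIV_char_0[where 'a = real] by simp
  qed
  ultimately have "infinite {y. poly (char_poly A - char_poly B) y = 0}"
    using infinite_super by blast
  then have "char_poly A - char_poly B = 0"
    using poly_roots_finite by blast
  then have "det (0 \<cdot>\<^sub>m 1\<^sub>m r - A) = det (0 \<cdot>\<^sub>m 1\<^sub>m r - B)"
    using cpA[OF car(1), of 0] cpA[OF car(2), of 0] by simp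
  moreover have "0 \<cdot>\<^sub>m 1\<^sub>m r - M = - M" if "M \<in> carrier_mat r r" for M :: "real mat"
    using that by (intro eq_matI) auto
  ultimately have "det (- A) = det (- B)"
    using car by simp
  moreover have "det (- M) = 0 \<longleftrightarrow> det M = 0" if "M \<in> carrier_mat r r" for M :: "real mat"
    using det_0_negate[OF that] by simp
  moreover have "det A \<noteq> 0"
    unfolding A_def by (rule det_nonzero[OF vs es ind iso])
  ultimately have "det B \<noteq> 0" using car by metis
  then show ?thesis
    unfolding B_def by (rule H.edge_independent_if_det_nonzero[OF ws fs])
qed

end

section \<open>All traces of a cone\<close>

context simple_graph
begin

text \<open>The signless Laplacian plus the identity. For the base of a cone this is what remains of the signless Laplacian of the
  cone after deleting the apex, because the apex adds one to every degree.\<close>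

definition qmat1 :: "'a \<Rightarrow> 'a \<Rightarrow> real" where
  "qmat1 u v = qmat u v + of_bool (u = v)"

lemma qmat1_sum:
  assumes "u \<in> V"
  shows "(\<Sum>w\<in>V. qmat1 u w * g w) = (real (deg u) + 1) * g u + sum g (nb u)"
proof -
  have "(\<Sum>w\<in>V. qmat1 u w * g w) = (\<Sum>w\<in>V. qmat u w * g w) + (\<Sum>w\<in>V. if w = u then g u else 0)"
    unfolding sum.distrib[symmetric] by (intro sum.cong) (auto simp: qmat1_def algebra_simps)
  then show ?thesis
    using assms finite_V by (simp add: qmat_sum distrib_right)
qed

lemma kernel_pow_qmat1_Suc:
  "u \<in> V \<Longrightarrow> kernel_pow V qmat1 (Suc j) u v =
     (real (deg u) + 1) * kernel_pow V qmat1 j u v + (\<Sum>w\<in>nb u. kernel_pow V qmat1 j w v)"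
  using qmat1_sum[of u "\<lambda>w. kernel_pow V qmat1 j w v"] by simp

lemma componentwise_regularD: "componentwise_regular \<Longrightarrow> w \<in> nb u \<Longrightarrow> deg w = deg u"
  by (auto simp: componentwise_regular_def)

text \<open>Walks do not leave a component, so they preserve the degree.\<close>

lemma kernel_pow_qmat1_deg:
  assumes componentwise_regular "u \<in> V" "kernel_pow V qmat1 j u v \<noteq> 0"
  shows "deg u = deg v"
  using assms(2,3)
proof (induction j arbitrary: u)
  case (Suc j)
  show ?case
  proof (cases "kernel_pow V qmat1 j u v = 0")
    case True
    then have "(\<Sum>w\<in>nb u. kernel_pow V qmat1 j w v) \<noteq> 0"
      using Suc.prems kernel_pow_qmat1_Suc[of u j v] by simp
    then obtain w where w: "w \<in> nb u" "kernel_pow V qmat1 j w v \<noteq> 0"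
      by (rule sum.not_neutral_contains_not_neutral)
    then show ?thesis
      using Suc.IH[of w] componentwise_regularD[OF assms(1) w(1)] nb_sub[of u] by auto
  qed (use Suc in blast)
qed (auto split: if_splits)

lemma kernel_pow_qmat1_col_sum:
  assumes componentwise_regular "v \<in> V"
  shows "(\<Sum>u\<in>V. kernel_pow V qmat1 j u v) = (1 + 2 * real (deg v)) ^ j"
proof (induction j)
  case 0
  then show ?case using assms finite_V by simp
next
  case (Suc j)
  have "(\<Sum>u\<in>V. kernel_pow V qmat1 (Suc j) u v) =
      (\<Sum>u\<in>V. (real (deg u) + 1) * kernel_pow V qmat1 j u v) + (\<Sum>u\<in>V. \<Sum>w\<in>nb u. kernel_pow V qmat1 j w v)"
    unfolding sum.distrib[symmetric] by (intro sum.cong refl kernel_pow_qmat1_Suc)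
  also have "(\<Sum>u\<in>V. \<Sum>w\<in>nb u. kernel_pow V qmat1 j w v) = (\<Sum>u\<in>V. real (deg u) * kernel_pow V qmat1 j u v)"
    by (subst arc_sum_swap) (simp add: deg_def)
  also have "(\<Sum>u\<in>V. (real (deg u) + 1) * kernel_pow V qmat1 j u v) + \<dots> =
      (\<Sum>u\<in>V. (1 + 2 * real (deg u)) * kernel_pow V qmat1 j u v)"
    unfolding sum.distrib[symmetric] by (intro sum.cong) (auto simp: algebra_simps)
  also have "\<dots> = (\<Sum>u\<in>V. (1 + 2 * real (deg v)) * kernel_pow V qmat1 j u v)"
  proof (rule sum.cong[OF refl])
    fix u assume "u \<in> V"
    then show "(1 + 2 * real (deg u)) * kernel_pow V qmat1 j u v = (1 + 2 * real (deg v)) * kernel_pow V qmat1 j u v"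
      using kernel_pow_qmat1_deg[OF assms(1), of u j v] by (cases "kernel_pow V qmat1 j u v = 0") auto
  qed
  also have "\<dots> = (1 + 2 * real (deg v)) ^ Suc j"
    by (simp add: Suc flip: sum_distrib_left)
  finally show ?case .
qed

end

context cone
begin

text \<open>A power of the signless Laplacian of a cone, up to functions of the base degrees, which are constant along walks.
  The point is that \<open>f\<close>, \<open>g\<close>, \<open>p\<close> and \<open>h\<close> can be chosen equal for two cones with the same number of base
  vertices of each degree: their recursion in \<open>block_form_Suc\<close> refers to the base only through sums over its
  degrees.\<close>

definition block_form where
  "block_form j f g p h \<longleftrightarrow>
     kernel_pow V qmat j z z = f
   \<and> (\<forall>v\<in>W. kernel_pow V qmat j z v = g (base.deg v))
   \<and> (\<forall>u\<in>W. kernel_pow V qmat j u z = p (base.deg u))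
   \<and> (\<forall>u\<in>W. \<forall>v\<in>W. kernel_pow V qmat j u v =
         kernel_pow W base.qmat1 j u v + h (base.deg u) (base.deg v))"

lemma block_form_0: "block_form 0 1 (\<lambda>_. 0) (\<lambda>_. 0) (\<lambda>_ _. 0)"
  by (auto simp: block_form_def)

lemma block_form_Suc:
  assumes reg: base.componentwise_regular and s: "block_form j f g p h"
  shows "block_form (Suc j) (real (card W) * f + (\<Sum>w\<in>W. p (base.deg w)))
     (\<lambda>c. real (card W) * g c + (1 + 2 * real c) ^ j + (\<Sum>w\<in>W. h (base.deg w) c))
     (\<lambda>a. f + (1 + 2 * real a) * p a)
     (\<lambda>a c. g c + (1 + 2 * real a) * h a c)"
proof -
  let ?Q = "kernel_pow V qmat j" and ?B = "kernel_pow W base.qmat1 j"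
  have zrow: "kernel_pow V qmat (Suc j) z v = real (card W) * ?Q z v + (\<Sum>w\<in>W. ?Q w v)" for v
    using qmat_sum[OF z_V, of "\<lambda>w. ?Q w v"] by (simp add: deg_z nb_z del: nb_iff)
  have row: "kernel_pow V qmat (Suc j) u v =
      (real (base.deg u) + 1) * ?Q u v + ?Q z v + (\<Sum>w\<in>base.nb u. ?Q w v)" if "u \<in> W" for u v
    using qmat_sum[OF W_V[OF that], of "\<lambda>w. ?Q w v"] that
    by (simp add: deg_W nb_W del: nb_iff base.nb_iff)
  have nbW: "w \<in> W" "base.deg w = base.deg u" if "w \<in> base.nb u" for u w
    using base.nb_sub[of u] that base.componentwise_regularD[OF reg that] by (auto simp del: base.nb_iff)
  have s': "?Q z z = f" "\<And>v. v \<in> W \<Longrightarrow> ?Q z v = g (base.deg v)"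
    "\<And>u. u \<in> W \<Longrightarrow> ?Q u z = p (base.deg u)"
    "\<And>u v. u \<in> W \<Longrightarrow> v \<in> W \<Longrightarrow> ?Q u v = ?B u v + h (base.deg u) (base.deg v)"
    using s by (auto simp: block_form_def)
  have 1: "kernel_pow V qmat (Suc j) z z = real (card W) * f + (\<Sum>w\<in>W. p (base.deg w))"
    unfolding zrow by (simp add: s')
  have 2: "kernel_pow V qmat (Suc j) z v =
      real (card W) * g (base.deg v) + (1 + 2 * real (base.deg v)) ^ j + (\<Sum>w\<in>W. h (base.deg w) (base.deg v))"
    if "v \<in> W" for v
    unfolding zrow using that base.kernel_pow_qmat1_col_sum[OF reg that, of j]
    by (simp add: s' sum.distrib)
  have 3: "kernel_pow V qmat (Suc j) u z = f + (1 + 2 * real (base.deg u)) * p (base.deg u)"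
    if "u \<in> W" for u
  proof -
    have "(\<Sum>w\<in>base.nb u. ?Q w z) = (\<Sum>w\<in>base.nb u. p (base.deg u))"
      by (intro sum.cong refl) (simp only: s'(3)[OF nbW(1)] nbW(2))
    then show ?thesis
      unfolding row[OF that] using that by (simp add: s' distrib_right base.deg_def)
  qed
  have 4: "kernel_pow V qmat (Suc j) u v = kernel_pow W base.qmat1 (Suc j) u v
      + (g (base.deg v) + (1 + 2 * real (base.deg u)) * h (base.deg u) (base.deg v))"
    if "u \<in> W" "v \<in> W" for u v
  proof -
    have "(\<Sum>w\<in>base.nb u. ?Q w v) = (\<Sum>w\<in>base.nb u. ?B w v + h (base.deg u) (base.deg v))"
    proof (rule sum.cong[OF refl])
      fix w assume "w \<in> base.nb u"
      then show "?Q w v = ?B w v + h (base.deg u) (base.deg v)"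
        using nbW[of w u] s'(4)[of w v] that by simp
    qed
    then show ?thesis
      unfolding row[OF that(1)] base.kernel_pow_qmat1_Suc[OF that(1)] using that
      by (simp add: s' sum.distrib) (simp add: base.deg_def algebra_simps)
  qed
  show ?thesis
    unfolding block_form_def using 1 2 3 4 by blast
qed

lemma block_form_trace:
  assumes "block_form j f g p h"
  shows "kernel_trace V qmat j = f + (\<Sum>v\<in>W. h (base.deg v) (base.deg v)) + kernel_trace W base.qmat1 j"
proof -
  have "(\<Sum>v\<in>W. kernel_pow V qmat j v v) = (\<Sum>v\<in>W. kernel_pow W base.qmat1 j v v + h (base.deg v) (base.deg v))"
    using assms by (intro sum.cong) (auto simp: block_form_def)
  then show ?thesis
    using assms unfolding kernel_trace_def sum_V by (simp add: sum.distrib block_form_def)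
qed

lemma base_traces_eq:
  assumes H: "cone V' E' z'"
    and reg: base.componentwise_regular
      "simple_graph.componentwise_regular (cone.base_E V' E' z')"
    and cnt: "\<And>\<phi> :: nat \<Rightarrow> real. (\<Sum>u\<in>cone.W V' z'. \<phi> (simple_graph.deg (cone.base_E V' E' z') u)) = (\<Sum>u\<in>W. \<phi> (base.deg u))"
    and tr: "\<And>k. kernel_trace V' (simple_graph.qmat E') k = kernel_trace V qmat k"
  shows "kernel_trace (cone.W V' z') (simple_graph.qmat1 (cone.base_E V' E' z')) j = kernel_trace W base.qmat1 j"
proof -
  interpret H: cone V' E' z' by (rule H)
  have card: "card H.W = card W" using cnt[of "\<lambda>_. 1"] by simp
  have "\<exists>f g p h. block_form j f g p h \<and> H.block_form j f g p h"
  proof (induction j)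
    case 0
    show ?case by (rule exI, rule exI, rule exI, rule exI, rule conjI, rule block_form_0, rule H.block_form_0)
  next
    case (Suc j)
    then obtain f g p h where "block_form j f g p h" "H.block_form j f g p h" by blast
    note S = block_form_Suc[OF reg(1) this(1)] and HS = H.block_form_Suc[OF reg(2) this(2)]
    have "(\<lambda>c. real (card H.W) * g c + (1 + 2 * real c) ^ j + (\<Sum>w\<in>H.W. h (H.base.deg w) c)) =
        (\<lambda>c. real (card W) * g c + (1 + 2 * real c) ^ j + (\<Sum>w\<in>W. h (base.deg w) c))"
      using cnt[of "\<lambda>d. h d c" for c] card by (intro ext) simp
    note HS = HS[unfolded this, unfolded card cnt[of p]]
    show ?case by (rule exI, rule exI, rule exI, rule exI, rule conjI, rule S, rule HS)
  qed
  then obtain f g p h where *: "block_form j f g p h" "H.block_form j f g p h" by blast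
  show ?thesis
    using block_form_trace[OF *(1)] H.block_form_trace[OF *(2)] tr[of j] cnt[of "\<lambda>d. h d d"] by simp
qed

end

section \<open>Cycles and their coverings by the integers\<close>

text \<open>The weight of the closed walks that go around a cycle: \<open>cycle_walks c j k\<close> is the weight of the walks of length
  \<open>j\<close> on the integers, with steps \<open>-1\<close>, \<open>0\<close>, \<open>1\<close> of weights \<open>1\<close>, \<open>3\<close>, \<open>1\<close>, that lead from \<open>k\<close> to a multiple of \<open>c\<close>.
  For \<open>c = 0\<close> these are the walks to zero, since zero divides only zero; this is the value that all cycles longer
  than the walk have in common.\<close>

primrec cycle_walks :: "nat \<Rightarrow> nat \<Rightarrow> int \<Rightarrow> real" where
  "cycle_walks c 0 = (\<lambda>k. of_bool (int c dvd k))"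
| "cycle_walks c (Suc j) = (\<lambda>k. cycle_walks c j (k - 1) + 3 * cycle_walks c j k + cycle_walks c j (k + 1))"

lemma cycle_walks_short: "\<bar>k\<bar> + int j < int c \<Longrightarrow> cycle_walks c j k = cycle_walks 0 j k"
proof (induction j arbitrary: k)
  case 0
  then have "int c dvd k \<longleftrightarrow> k = 0" using dvd_imp_le_int[of k "int c"] by auto
  then show ?case by simp
qed simp

text \<open>The extra walk is the one that makes every step away from zero and ends at \<open>c\<close> or \<open>- c\<close>.\<close>

lemma cycle_walks_antipodal: "\<bar>k\<bar> + int j = int c \<Longrightarrow> k \<noteq> 0 \<Longrightarrow> cycle_walks c j k = cycle_walks 0 j k + 1"
proof (induction j arbitrary: k)
  case 0
  then have "int c dvd k" by (metis abs_dvd_iff abs_of_nat add.right_neutral dvd_abs_iff dvd_refl of_nat_0)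
  then show ?case using 0 by simp
next
  case (Suc j)
  then have s: "cycle_walks c j k = cycle_walks 0 j k" by (intro cycle_walks_short) simp
  show ?case
  proof (cases "k > 0")
    case True
    then have "cycle_walks c j (k - 1) = cycle_walks 0 j (k - 1)" "cycle_walks c j (k + 1) = cycle_walks 0 j (k + 1) + 1"
      using Suc.prems by (intro cycle_walks_short Suc.IH; simp)+
    then show ?thesis using s by simp
  next
    case False
    then have "cycle_walks c j (k + 1) = cycle_walks 0 j (k + 1)" "cycle_walks c j (k - 1) = cycle_walks 0 j (k - 1) + 1"
      using Suc.prems by (intro cycle_walks_short Suc.IH; simp)+
    then show ?thesis using s by simp
  qed
qed

lemma cycle_walks_full_turn:
  assumes "c > 0" shows "cycle_walks c c 0 = cycle_walks 0 c 0 + 2"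
proof -
  obtain j where j: "c = Suc j" using assms by (cases c) auto
  have "cycle_walks c j 0 = cycle_walks 0 j 0" by (rule cycle_walks_short) (simp add: j)
  moreover have "cycle_walks c j 1 = cycle_walks 0 j 1 + 1" "cycle_walks c j (-1) = cycle_walks 0 j (-1) + 1"
    by (rule cycle_walks_antipodal; simp add: j)+
  ultimately show ?thesis by (simp add: j)
qed

context simple_graph
begin

definition component :: "'a \<Rightarrow> 'a set" where
  "component v = E\<^sup>* `` {v}"

definition component_size :: "'a \<Rightarrow> nat" where
  "component_size v = card (component v)"

text \<open>A walk around a component whose vertices all have degree two, indexed by the integers in both directions. It is
  the universal covering of the component, so that walks in the component lift to walks on the integers.\<close>

definition covers :: "(int \<Rightarrow> 'a) \<Rightarrow> bool" where
  "covers \<gamma> \<longleftrightarrow> (\<forall>i. nb (\<gamma> i) = {\<gamma> (i - 1), \<gamma> (i + 1)} \<and> \<gamma> (i - 1) \<noteq> \<gamma> (i + 1))"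

lemma comp_self [simp]: "v \<in> component v"
  by (simp add: component_def)

lemma comp_sub: 
  assumes "v \<in> V" shows "component v \<subseteq> V"
proof
  fix w assume "w \<in> component v"
  then have "(v, w) \<in> E\<^sup>*" by (simp add: component_def)
  then show "w \<in> V" using assms by induction (use E_sub in auto)
qed

lemma finite_comp: "v \<in> V \<Longrightarrow> finite (component v)"
  using comp_sub finite_V finite_subset by blast

lemma compI_closed:
  assumes "v \<in> S" "\<And>u. u \<in> S \<Longrightarrow> nb u \<subseteq> S"
  shows "component v \<subseteq> S"
proof
  fix w assume "w \<in> component v"
  then have "(v, w) \<in> E\<^sup>*" by (simp add: component_def)
  then show "w \<in> S" using assms(1)
  proof induction
    case (step y x)
    then show ?case using assms(2)[of y] by auto
  qed
qed

lemma comp_closed: "u \<in> component v \<Longrightarrow> nb u \<subseteq> component v"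
  by (auto simp: component_def intro: rtrancl_into_rtrancl)

lemma comp_eq:
  assumes "u \<in> component v" shows "component u = component v"
proof -
  have "sym E" by (rule symI) (rule E_sym)
  then have "sym (E\<^sup>*)" by (rule sym_rtrancl)
  then have "(u, v) \<in> E\<^sup>*" "(v, u) \<in> E\<^sup>*" using assms by (auto simp: component_def dest: symD)
  then show ?thesis by (auto simp: component_def intro: rtrancl_trans)
qed

lemma covers_nb:
  assumes "covers \<gamma>"
  shows "nb (\<gamma> i) = {\<gamma> (i - 1), \<gamma> (i + 1)}" "\<gamma> (i - 1) \<noteq> \<gamma> (i + 1)" "\<gamma> i \<noteq> \<gamma> (i + 1)" "\<gamma> i \<in> V"
proof -
  show nb: "nb (\<gamma> i) = {\<gamma> (i - 1), \<gamma> (i + 1)}" and "\<gamma> (i - 1) \<noteq> \<gamma> (i + 1)"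
    using assms by (auto simp: covers_def)
  have "(\<gamma> i, \<gamma> (i + 1)) \<in> E" using nb nb_iff by blast
  then show "\<gamma> i \<noteq> \<gamma> (i + 1)" "\<gamma> i \<in> V" using E_irrefl E_sub by auto
qed

text \<open>If the covering returned to a vertex in the opposite direction, it would continue backwards, and the two branches
  would meet in the middle: at a vertex whose neighbours coincide or at a loop. That is excluded in
  \<open>covers_no_reflect\<close>.\<close>

lemma covers_reflect:
  assumes c: "covers \<gamma>" and ij: "\<gamma> i = \<gamma> j" "\<gamma> (i + 1) = \<gamma> (j - 1)"
  shows "\<gamma> (i + int m) = \<gamma> (j - int m) \<and> \<gamma> (i + int m + 1) = \<gamma> (j - int m - 1)"
proof (induction m)
  case (Suc m)
  let ?a = "i + int m + 1" and ?b = "j - int m - 1"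
  have "{\<gamma> (?a - 1), \<gamma> (?a + 1)} = {\<gamma> (?b - 1), \<gamma> (?b + 1)}"
    using Suc covers_nb(1)[OF c, of ?a] covers_nb(1)[OF c, of ?b] by simp
  moreover have "\<gamma> (?a - 1) = \<gamma> (?b + 1)" using Suc by simp
  moreover have "\<gamma> (?a - 1) \<noteq> \<gamma> (?a + 1)" by (rule covers_nb(2)[OF c])
  ultimately have "\<gamma> (?a + 1) = \<gamma> (?b - 1)" by (auto simp: doubleton_eq_iff)
  then show ?case using Suc by (simp add: algebra_simps)
qed (use ij in simp)

lemma covers_no_reflect:
  assumes c: "covers \<gamma>" and ij: "\<gamma> i = \<gamma> j" "\<gamma> (i + 1) = \<gamma> (j - 1)" and le: "i \<le> j"
  shows False
proof -
  define m where "m = nat ((j - i) div 2)"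
  have m: "int m = (j - i) div 2" using le by (simp add: m_def)
  note r = covers_reflect[OF c ij, of m]
  show False
  proof (cases "even (j - i)")
    case True
    then have "j - int m = i + int m" using m by (auto elim!: evenE)
    then have "\<gamma> (i + int m + 1) = \<gamma> (i + int m - 1)" using r by (simp only:)
    then show False using covers_nb(2)[OF c, of "i + int m"] by simp
  next
    case False
    then have "j - int m = i + int m + 1" using m by presburger
    then have "\<gamma> (i + int m) = \<gamma> (i + int m + 1)" using r by (simp only:)
    then show False using covers_nb(3)[OF c, of "i + int m"] by simp
  qed
qed

lemma covers_step:
  assumes c: "covers \<gamma>" and ij: "\<gamma> i = \<gamma> j"
  shows "\<gamma> (i + 1) = \<gamma> (j + 1) \<and> \<gamma> (i - 1) = \<gamma> (j - 1)"
proof -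
  have eq: "{\<gamma> (i - 1), \<gamma> (i + 1)} = {\<gamma> (j - 1), \<gamma> (j + 1)}"
    using covers_nb(1)[OF c, of i] covers_nb(1)[OF c, of j] ij by simp
  show ?thesis
  proof (rule ccontr)
    assume "\<not> ?thesis"
    then have "\<gamma> (i + 1) = \<gamma> (j - 1)" "\<gamma> (j + 1) = \<gamma> (i - 1)"
      using eq by (auto simp: doubleton_eq_iff)
    then show False
      using covers_no_reflect[OF c, of i j] covers_no_reflect[OF c, of j i] ij by (cases "i \<le> j") auto
  qed
qed

lemma covers_shift:
  assumes c: "covers \<gamma>" and ij: "\<gamma> i = \<gamma> j"
  shows "\<gamma> (i + m) = \<gamma> (j + m)"
proof (induction m rule: int_induct[where k = 0])
  case (step1 m)
  then show ?case using covers_step[OF c, of "i + m" "j + m"] by (simp add: algebra_simps)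
next
  case (step2 m)
  then show ?case using covers_step[OF c, of "i + m" "j + m"] by (simp add: algebra_simps)
qed (use ij in simp)

text \<open>Returning to a vertex shifts the whole covering, so the return times form a subgroup of the integers; it is not
  zero, because the graph is finite, and its least positive element generates it.\<close>

lemma covers_period:
  assumes c: "covers \<gamma>"
  obtains p :: nat where "p > 0" "\<And>i j. \<gamma> i = \<gamma> j \<longleftrightarrow> int p dvd i - j"
proof -
  have shift: "\<gamma> (i + m) = \<gamma> (j + m)" if "\<gamma> i = \<gamma> j" for i j m by (rule covers_shift[OF c that])
  have "\<not> inj (\<lambda>n::nat. \<gamma> (int n))"
  proof
    assume "inj (\<lambda>n::nat. \<gamma> (int n))"
    moreover have "finite (range (\<lambda>n::nat. \<gamma> (int n)))"
      using covers_nb(4)[OF c] finite_V by (auto intro: finite_subset[of _ V])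
    ultimately show False using finite_imageD infinite_UNIV_nat by blast
  qed
  then obtain a b :: nat where "a \<noteq> b" "\<gamma> (int a) = \<gamma> (int b)"
    unfolding inj_def by blast
  then obtain a b :: nat where ab: "a < b" "\<gamma> (int a) = \<gamma> (int b)"
    by (cases "a < b") (auto simp: not_less order.order_iff_strict)
  have "\<gamma> (int b + - int a) = \<gamma> (int a + - int a)" using ab by (intro shift) simp
  then have ex: "\<exists>p::nat. p > 0 \<and> \<gamma> (int p) = \<gamma> 0"
    using ab by (intro exI[of _ "b - a"]) (simp add: of_nat_diff)
  define p where "p = (LEAST p::nat. p > 0 \<and> \<gamma> (int p) = \<gamma> 0)"
  have p: "p > 0" "\<gamma> (int p) = \<gamma> 0" using LeastI_ex[OF ex] by (auto simp: p_def)
  have least: "p \<le> n" if "n > 0" "\<gamma> (int n) = \<gamma> 0" for n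
    unfolding p_def using that by (intro Least_le) simp
  have mult: "\<gamma> (i + int p * int n) = \<gamma> i" for i n
  proof (induction n)
    case (Suc n)
    have "\<gamma> (int p + (i + int p * int n)) = \<gamma> (0 + (i + int p * int n))" by (rule shift[OF p(2)])
    then show ?case using Suc by (simp add: algebra_simps)
  qed simp
  have mult': "\<gamma> (i + int p * q) = \<gamma> i" for i q
  proof (cases "q \<ge> 0")
    case True
    then show ?thesis using mult[of i "nat q"] by simp
  next
    case False
    then show ?thesis using mult[of "i + int p * q" "nat (- q)"] by (simp add: algebra_simps)
  qed
  have zero: "\<gamma> k = \<gamma> 0 \<longleftrightarrow> int p dvd k" for k
  proof
    assume k: "\<gamma> k = \<gamma> 0"
    have "\<gamma> (k mod int p) = \<gamma> 0"
      using mult'[of k "- (k div int p)"] k by (simp add: minus_mult_div_eq_mod algebra_simps)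
    moreover have r: "0 \<le> k mod int p" "k mod int p < int p" using p(1) by auto
    ultimately have "p \<le> nat (k mod int p)" if "k mod int p > 0"
      using that by (intro least) auto
    with r have "\<not> k mod int p > 0" by linarith
    then show "int p dvd k" using \<open>0 \<le> k mod int p\<close> by (simp add: dvd_eq_mod_eq_0)
  next
    assume "int p dvd k"
    then show "\<gamma> k = \<gamma> 0" using mult'[of 0] by (auto elim!: dvdE)
  qed
  have "\<gamma> i = \<gamma> j \<longleftrightarrow> int p dvd i - j" for i j
  proof -
    have "\<gamma> i = \<gamma> j \<longleftrightarrow> \<gamma> (i - j) = \<gamma> 0"
      using shift[of i j "- j"] shift[of "i - j" 0 j] by auto
    then show ?thesis by (simp add: zero)
  qed
  with p(1) show thesis by (rule that)
qed

lemma covers_comp: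
  assumes c: "covers \<gamma>"
  shows "component (\<gamma> 0) = range \<gamma>"
proof
  show "component (\<gamma> 0) \<subseteq> range \<gamma>"
    by (rule compI_closed) (auto simp: covers_nb(1)[OF c] simp del: nb_iff)
  have "\<gamma> i \<in> component (\<gamma> 0)" for i
  proof (induction i rule: int_induct[where k = 0])
    case (step1 i)
    have "\<gamma> (i + 1) \<in> nb (\<gamma> i)" by (simp add: covers_nb(1)[OF c] del: nb_iff)
    then show ?case using comp_closed[OF step1(2)] by blast
  next
    case (step2 i)
    have "\<gamma> (i - 1) \<in> nb (\<gamma> i)" by (simp add: covers_nb(1)[OF c] del: nb_iff)
    then show ?case using comp_closed[OF step2(2)] by blast
  qed simp
  then show "range \<gamma> \<subseteq> component (\<gamma> 0)" by auto
qed

lemma covers_component_size: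
  assumes c: "covers \<gamma>"
  shows "\<gamma> i = \<gamma> j \<longleftrightarrow> int (component_size (\<gamma> 0)) dvd i - j" and "component_size (\<gamma> 0) \<ge> 3"
proof -
  obtain p :: nat where p: "p > 0" "\<And>i j. \<gamma> i = \<gamma> j \<longleftrightarrow> int p dvd i - j"
    by (rule covers_period[OF c]) blast
  have "range \<gamma> = \<gamma> ` {0..<int p}"
  proof
    have "\<gamma> i \<in> \<gamma> ` {0..<int p}" for i
      by (rule image_eqI[of _ _ "i mod int p"]) (use p(1) in \<open>auto simp: p(2) minus_mod_eq_mult_div\<close>)
    then show "range \<gamma> \<subseteq> \<gamma> ` {0..<int p}" by auto
  qed auto
  moreover have "inj_on \<gamma> {0..<int p}"
  proof (rule inj_onI)
    fix i j assume ij: "i \<in> {0..<int p}" "j \<in> {0..<int p}" "\<gamma> i = \<gamma> j"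
    then have "int p dvd i - j" "\<bar>i - j\<bar> < int p" by (auto simp: p(2))
    then show "i = j" using dvd_imp_le_int[of "i - j" "int p"] by auto
  qed
  ultimately have "component_size (\<gamma> 0) = p"
    by (simp add: component_size_def covers_comp[OF c] card_image)
  then show "\<gamma> i = \<gamma> j \<longleftrightarrow> int (component_size (\<gamma> 0)) dvd i - j" by (simp add: p(2))
  have "card {\<gamma> (- 1), \<gamma> 0, \<gamma> 1} = 3"
    using covers_nb(2,3)[OF c, of 0] covers_nb(3)[OF c, of "-1"] by auto
  moreover have "card {\<gamma> (- 1), \<gamma> 0, \<gamma> 1} \<le> card (component (\<gamma> 0))"
    unfolding covers_comp[OF c]
    by (rule card_mono) (use covers_nb(4)[OF c] finite_V in \<open>auto intro: finite_subset[of _ V]\<close>)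
  ultimately show "component_size (\<gamma> 0) \<ge> 3" by (simp add: component_size_def)
qed

lemma covers_kernel_pow:
  assumes c: "covers \<gamma>"
  shows "kernel_pow V qmat1 j (\<gamma> k) (\<gamma> 0) = cycle_walks (component_size (\<gamma> 0)) j k"
proof (induction j arbitrary: k)
  case 0
  then show ?case using covers_component_size(1)[OF c, of k 0] by simp
next
  case (Suc j)
  have "deg (\<gamma> k) = 2"
    using covers_nb(1,2)[OF c, of k] by (simp add: deg_def)
  then show ?case
    using covers_nb(2)[OF c, of k]
    unfolding kernel_pow_qmat1_Suc[OF covers_nb(4)[OF c]] covers_nb(1)[OF c] by (simp add: Suc)
qed

text \<open>Never turning back determines the walk after its first step.\<close>

lemma half_cover:
  assumes reg: componentwise_regular and d: "deg v = 2" and w: "(v, w) \<in> E"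
  obtains f :: "nat \<Rightarrow> 'a" where "f 0 = v" "f 1 = w"
    "\<And>n. nb (f (Suc n)) = {f n, f (Suc (Suc n))} \<and> f n \<noteq> f (Suc (Suc n))"
proof -
  define P where "P n p \<longleftrightarrow> p \<in> E \<and> deg (snd p) = 2 \<and> (n = 0 \<longrightarrow> p = (v, w))" for n :: nat and p
  define R where "R n p p' \<longleftrightarrow> fst p' = snd p \<and> nb (snd p) = {fst p, snd p'} \<and> fst p \<noteq> snd p'"
    for n :: nat and p p' :: "'a \<times> 'a"
  have "\<exists>F. \<forall>n. P n (F n) \<and> R n (F n) (F (Suc n))"
  proof (rule dependent_nat_choice)
    show "\<exists>p. P 0 p"
      using d w componentwise_regularD[OF reg, of w v] by (intro exI[of _ "(v, w)"]) (simp add: P_def)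
    fix p n assume "P n p"
    then obtain x u where p: "p = (x, u)" "(x, u) \<in> E" "deg u = 2" by (cases p) (auto simp: P_def)
    have x: "x \<in> nb u" using E_sym[OF p(2)] by simp
    moreover have "card (nb u) = 2" using p(3) by (simp add: deg_def)
    ultimately obtain a b where "nb u = {a, b}" "a \<noteq> b" "x = a \<or> x = b"
      by (auto simp: card_2_iff simp del: nb_iff)
    then obtain y where y: "nb u = {x, y}" "x \<noteq> y"
      by (metis insert_commute)
    then have yu: "y \<in> nb u" by blast
    have "P (Suc n) (u, y)"
      using yu p(3) componentwise_regularD[OF reg yu] by (simp add: P_def)
    moreover have "R n p (u, y)" using y by (simp add: R_def p)
    ultimately show "\<exists>p'. P (Suc n) p' \<and> R n p p'" by blast
  qed
  then obtain F where F: "\<And>n. P n (F n)" "\<And>n. R n (F n) (F (Suc n))" by blast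
  show thesis
  proof (rule that[of "\<lambda>n. fst (F n)"])
    show "fst (F 0) = v" using F(1)[of 0] by (simp add: P_def)
    show "fst (F 1) = w" using F(1)[of 0] F(2)[of 0] by (simp add: P_def R_def)
    show "nb (fst (F (Suc n))) = {fst (F n), fst (F (Suc (Suc n)))} \<and> fst (F n) \<noteq> fst (F (Suc (Suc n)))" for n
      using F(2)[of n] F(2)[of "Suc n"] by (simp add: R_def)
  qed
qed

lemma covers_exists:
  assumes reg: componentwise_regular and d: "deg v = 2"
  obtains \<gamma> where "covers \<gamma>" "\<gamma> 0 = v"
proof -
  have "card (nb v) = 2" using d by (simp add: deg_def)
  then obtain w w' where w: "nb v = {w, w'}" "w \<noteq> w'" by (auto simp: card_2_iff)
  then have "w \<in> nb v" "w' \<in> nb v" by auto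
  then have E: "(v, w) \<in> E" "(v, w') \<in> E" by auto
  obtain f where f: "f 0 = v" "f 1 = w"
    "\<And>n. nb (f (Suc n)) = {f n, f (Suc (Suc n))} \<and> f n \<noteq> f (Suc (Suc n))"
    by (rule half_cover[OF reg d E(1)]) blast
  obtain g where g: "g 0 = v" "g 1 = w'"
    "\<And>n. nb (g (Suc n)) = {g n, g (Suc (Suc n))} \<and> g n \<noteq> g (Suc (Suc n))"
    by (rule half_cover[OF reg d E(2)]) blast
  define \<gamma> where "\<gamma> i = (if i \<ge> 0 then f (nat i) else g (nat (- i)))" for i
  have pos: "\<gamma> (int n) = f n" for n by (simp add: \<gamma>_def)
  have neg: "\<gamma> (- int n) = g n" for n using f g by (simp add: \<gamma>_def)
  have "nb (\<gamma> i) = {\<gamma> (i - 1), \<gamma> (i + 1)} \<and> \<gamma> (i - 1) \<noteq> \<gamma> (i + 1)" for i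
  proof -
    consider "i = 0" | n where "i = int (Suc n)" | n where "i = - int (Suc n)"
    proof -
      consider "i = 0" | "i > 0" | "i < 0" by linarith
      then show thesis
      proof cases
        case 2
        then have "i = int (Suc (nat (i - 1)))" by simp
        then show thesis by (rule that(2))
      next
        case 3
        then have "i = - int (Suc (nat (- i - 1)))" by simp
        then show thesis by (rule that(3))
      qed (rule that(1))
    qed
    then show ?thesis
    proof cases
      case 1
      have "\<gamma> 0 = v" "\<gamma> 1 = w" "\<gamma> (- 1) = w'" using f g pos[of 0] pos[of 1] neg[of 1] by auto
      then show ?thesis using w 1 by auto
    next
      case 2
      then have "i - 1 = int n" "i + 1 = int (Suc (Suc n))" by auto
      then show ?thesis using f(3)[of n] unfolding 2 by (simp only: pos) simp
    next
      case 3
      then have "i + 1 = - int n" "i - 1 = - int (Suc (Suc n))" by auto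
      then show ?thesis using g(3)[of n] unfolding 3 by (simp only: neg) auto
    qed
  qed
  then show thesis using that[of \<gamma>] pos[of 0] f(1) by (simp add: covers_def)
qed

end

section \<open>Component sizes\<close>

text \<open>The diagonal entry of a power at a vertex in a component of size \<open>c\<close>. On a single edge the matrix has the
  eigenvalues \<open>3\<close> and \<open>1\<close>, with the sum and the difference of the two vertices as eigenvectors.\<close>

definition closed_walk_weight :: "nat \<Rightarrow> nat \<Rightarrow> real" where
  "closed_walk_weight c j = (if c = 1 then 1 else if c = 2 then (3 ^ j + 1) / 2 else cycle_walks c j 0)"

context simple_graph
begin

text \<open>Components are regular of degree at most two, hence points, edges or cycles.\<close>

definition points_edges_cycles :: bool where
  "points_edges_cycles \<longleftrightarrow> componentwise_regular \<and> (\<forall>v\<in>V. deg v \<le> 2)"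

lemma deg0_comp:
  assumes "deg v = 0"
  shows "nb v = {}" "component v = {v}"
proof -
  show nb: "nb v = {}" using assms by (simp add: deg_def)
  show "component v = {v}"
    using compI_closed[of v "{v}"] nb by auto
qed

lemma deg1_comp:
  assumes componentwise_regular "deg v = 1"
  obtains w where "nb v = {w}" "nb w = {v}" "w \<noteq> v" "component v = {v, w}"
proof -
  obtain w where w: "nb v = {w}"
    using assms(2) unfolding deg_def by (rule card_1_singletonE)
  then have wv: "w \<in> nb v" by blast
  then have "deg w = 1" using componentwise_regularD[OF assms(1) wv] assms(2) by simp
  moreover have "v \<in> nb w" using wv E_commute by simp
  ultimately have w': "nb w = {v}"
    unfolding deg_def by (metis card_1_singletonE singletonD)
  have "w \<noteq> v" using wv E_irrefl by auto
  have "component v \<subseteq> {v, w}" by (rule compI_closed) (use w w' in \<open>auto simp del: nb_iff\<close>)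
  moreover have "w \<in> component v" using comp_closed[OF comp_self, of v] wv by blast
  ultimately have "component v = {v, w}" by auto
  with w w' \<open>w \<noteq> v\<close> show thesis by (rule that)
qed

lemma component_size_deg:
  assumes points_edges_cycles "v \<in> V"
  shows "component_size v = 1 \<longleftrightarrow> deg v = 0" "component_size v = 2 \<longleftrightarrow> deg v = 1" "component_size v \<ge> 1"
proof -
  have reg: componentwise_regular and "deg v \<le> 2" using assms by (auto simp: points_edges_cycles_def)
  then consider "deg v = 0" | "deg v = 1" | "deg v = 2" by linarith
  then have "(deg v = 0 \<and> component_size v = 1) \<or> (deg v = 1 \<and> component_size v = 2) \<or> (deg v = 2 \<and> component_size v \<ge> 3)"
  proof cases
    case 1
    then show ?thesis using deg0_comp by (simp add: component_size_def)
  next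
    case 2
    obtain w where "nb v = {w}" "nb w = {v}" "w \<noteq> v" "component v = {v, w}"
      by (rule deg1_comp[OF reg 2])
    then show ?thesis using 2 by (simp add: component_size_def)
  next
    case 3
    then obtain \<gamma> where "covers \<gamma>" "\<gamma> 0 = v" by (rule covers_exists[OF reg])
    then show ?thesis using 3 covers_component_size(2)[of \<gamma>] by auto
  qed
  then show "component_size v = 1 \<longleftrightarrow> deg v = 0" "component_size v = 2 \<longleftrightarrow> deg v = 1" "component_size v \<ge> 1" by auto
qed

lemma kernel_pow_diag:
  assumes s: points_edges_cycles and v: "v \<in> V"
  shows "kernel_pow V qmat1 j v v = closed_walk_weight (component_size v) j"
proof -
  have reg: componentwise_regular and "deg v \<le> 2" using assms by (auto simp: points_edges_cycles_def)
  then consider "deg v = 0" | "deg v = 1" | "deg v = 2" by linarith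
  then show ?thesis
  proof cases
    case 1
    have "kernel_pow V qmat1 j v v = 1"
    proof (induction j)
      case (Suc j)
      then show ?case
        unfolding kernel_pow_qmat1_Suc[OF v] deg0_comp(1)[OF 1] 1 by simp
    qed simp
    then show ?thesis using component_size_deg(1)[OF s v] 1 by (simp add: closed_walk_weight_def)
  next
    case 2
    obtain w where w: "nb v = {w}" "nb w = {v}" "w \<noteq> v" "component v = {v, w}"
      by (rule deg1_comp[OF reg 2])
    have wV: "w \<in> V" "deg w = 1" using w nb_sub[of v] by (auto simp: deg_def)
    have "kernel_pow V qmat1 j v v = (3 ^ j + 1) / 2 \<and> kernel_pow V qmat1 j w v = (3 ^ j - 1) / 2"
    proof (induction j)
      case 0
      then show ?case using w(3) by simp
    next
      case (Suc j)
      then show ?case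
        unfolding kernel_pow_qmat1_Suc[OF v] kernel_pow_qmat1_Suc[OF wV(1)] w 2 wV(2)
        by (simp add: field_simps)
    qed
    then show ?thesis using component_size_deg(2)[OF s v] 2 by (simp add: closed_walk_weight_def)
  next
    case 3
    then obtain \<gamma> where c: "covers \<gamma>" "\<gamma> 0 = v" by (rule covers_exists[OF reg])
    then show ?thesis
      using covers_kernel_pow[OF c(1), of j 0] covers_component_size(2)[OF c(1)]
      by (simp add: closed_walk_weight_def)
  qed
qed

lemma kernel_trace_qmat1:
  "points_edges_cycles \<Longrightarrow> kernel_trace V qmat1 j = (\<Sum>v\<in>V. closed_walk_weight (component_size v) j)"
  unfolding kernel_trace_def by (intro sum.cong refl kernel_pow_diag)

end

lemma sum_by_size:
  fixes f :: "'a \<Rightarrow> nat" and g :: "nat \<Rightarrow> real"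
  assumes "finite V" "\<And>s. s > c \<Longrightarrow> g s = 0"
  shows "(\<Sum>v\<in>V. g (f v)) = (\<Sum>s\<le>c. real (card {v \<in> V. f v = s}) * g s)"
proof -
  have "(\<Sum>v\<in>V. g (f v)) = (\<Sum>v\<in>{v \<in> V. f v \<le> c}. g (f v))"
    using assms by (intro sum.mono_neutral_right) (auto simp: not_le)
  also have "\<dots> = (\<Sum>s\<le>c. \<Sum>v | v \<in> {v \<in> V. f v \<le> c} \<and> f v = s. g (f v))"
    using assms(1) by (intro sum.group[symmetric]) auto
  also have "\<dots> = (\<Sum>s\<le>c. real (card {v \<in> V. f v = s}) * g s)"
  proof (rule sum.cong[OF refl])
    fix s assume "s \<in> {..c}"
    then have "{v. v \<in> {v \<in> V. f v \<le> c} \<and> f v = s} = {v \<in> V. f v = s}" by auto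
    then show "(\<Sum>v | v \<in> {v \<in> V. f v \<le> c} \<and> f v = s. g (f v)) = real (card {v \<in> V. f v = s}) * g s"
      by simp
  qed
  finally show ?thesis .
qed

text \<open>Points and edges are counted by the degrees. For \<open>c \<ge> 3\<close> the weights of closed walks of length \<open>c\<close>, diminished by
  the common value \<open>A\<close> of long cycles, vanish on components larger than \<open>c\<close> and equal two on components of size
  \<open>c\<close>; smaller components are known by induction.\<close>

lemma component_size_counts_eq:
  assumes G: "simple_graph V E" "simple_graph.points_edges_cycles V E"
    and H: "simple_graph V' E'" "simple_graph.points_edges_cycles V' E'"
    and cnt: "\<And>i. card {v \<in> V'. simple_graph.deg E' v = i} = card {v \<in> V. simple_graph.deg E v = i}"
    and card: "card V' = card V"
    and tr: "\<And>j. kernel_trace V' (simple_graph.qmat1 E') j = kernel_trace V (simple_graph.qmat1 E) j"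
  shows "card {v \<in> V'. simple_graph.component_size E' v = c} = card {v \<in> V. simple_graph.component_size E v = c}"
proof -
  interpret G: simple_graph V E by (rule G)
  interpret H: simple_graph V' E' by (rule H)
  show ?thesis
  proof (induction c rule: less_induct)
    case (less c)
    consider "c = 0" | "c = 1" | "c = 2" | "c \<ge> 3" by linarith
    then show ?case
    proof cases
      case 1
      have "H.component_size v \<noteq> c" if "v \<in> V'" for v using H.component_size_deg(3)[OF H(2) that] 1 by linarith
      moreover have "G.component_size v \<noteq> c" if "v \<in> V" for v using G.component_size_deg(3)[OF G(2) that] 1 by linarith
      ultimately have "{v \<in> V'. H.component_size v = c} = {}" "{v \<in> V. G.component_size v = c} = {}" by blast+
      then show ?thesis by (simp only: card.empty)
    next
      case 2
      have "{v \<in> V'. H.component_size v = c} = {v \<in> V'. H.deg v = 0}" "{v \<in> V. G.component_size v = c} = {v \<in> V. G.deg v = 0}"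
        using H.component_size_deg(1)[OF H(2)] G.component_size_deg(1)[OF G(2)] 2 by auto
      then show ?thesis using cnt by simp
    next
      case 3
      have "{v \<in> V'. H.component_size v = c} = {v \<in> V'. H.deg v = 1}" "{v \<in> V. G.component_size v = c} = {v \<in> V. G.deg v = 1}"
        using H.component_size_deg(2)[OF H(2)] G.component_size_deg(2)[OF G(2)] 3 by auto
      then show ?thesis using cnt by simp
    next
      case 4
      define A where "A = cycle_walks 0 c 0"
      define g where "g s = closed_walk_weight s c - A" for s
      have g0: "g s = 0" if "s > c" for s
        using that 4 cycle_walks_short[of 0 c s] by (simp add: g_def closed_walk_weight_def A_def)
      have gc: "g c = 2"
        using 4 cycle_walks_full_turn[of c] by (simp add: g_def closed_walk_weight_def A_def)
      have "(\<Sum>v\<in>V'. g (H.component_size v)) = (\<Sum>v\<in>V. g (G.component_size v))"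
        using tr[of c] card
        by (simp add: g_def sum_subtractf H.kernel_trace_qmat1[OF H(2)] G.kernel_trace_qmat1[OF G(2)])
      then have "(\<Sum>s\<le>c. real (card {v \<in> V'. H.component_size v = s}) * g s) = (\<Sum>s\<le>c. real (card {v \<in> V. G.component_size v = s}) * g s)"
        using sum_by_size[of V' c g H.component_size, OF H.finite_V g0] sum_by_size[of V c g G.component_size, OF G.finite_V g0] by simp
      moreover have "{..c} = insert c {..<c}" by auto
      ultimately have "real (card {v \<in> V'. H.component_size v = c}) * 2 + (\<Sum>s<c. real (card {v \<in> V'. H.component_size v = s}) * g s) =
          real (card {v \<in> V. G.component_size v = c}) * 2 + (\<Sum>s<c. real (card {v \<in> V. G.component_size v = s}) * g s)"
        by (simp add: gc)
      moreover have "(\<Sum>s<c. real (card {v \<in> V'. H.component_size v = s}) * g s) = (\<Sum>s<c. real (card {v \<in> V. G.component_size v = s}) * g s)"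
        using less by (intro sum.cong) auto
      ultimately show ?thesis by simp
    qed
  qed
qed

section \<open>Gluing components\<close>

definition arc_iso_on :: "'a set \<Rightarrow> ('a \<times> 'a) set \<Rightarrow> 'b set \<Rightarrow> ('b \<times> 'b) set \<Rightarrow> ('a \<Rightarrow> 'b) \<Rightarrow> bool" where
  "arc_iso_on A E B F f \<longleftrightarrow> bij_betw f A B \<and> (\<forall>x\<in>A. \<forall>y\<in>A. (x, y) \<in> E \<longleftrightarrow> (f x, f y) \<in> F)"

text \<open>For cycles the isomorphism identifies the two coverings, which have the same period.\<close>

lemma comp_iso:
  assumes G: "simple_graph V E" "simple_graph.points_edges_cycles V E" "v \<in> V"
    and H: "simple_graph V' E'" "simple_graph.points_edges_cycles V' E'" "v' \<in> V'"
    and size: "simple_graph.component_size E v = simple_graph.component_size E' v'"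
  shows "\<exists>f. arc_iso_on (simple_graph.component E v) E (simple_graph.component E' v') E' f"
proof -
  interpret G: simple_graph V E by (rule G)
  interpret H: simple_graph V' E' by (rule H)
  have regG: G.componentwise_regular and regH: H.componentwise_regular
    using G H by (simp_all add: G.points_edges_cycles_def H.points_edges_cycles_def)
  have le: "G.deg v \<le> 2" "H.deg v' \<le> 2"
    using G H by (simp_all add: G.points_edges_cycles_def H.points_edges_cycles_def)
  note cs = G.component_size_deg[OF G(2,3)] H.component_size_deg[OF H(2,3)]
  have deg: "G.deg v = H.deg v'"
  proof -
    have "G.deg v = 0 \<longleftrightarrow> H.deg v' = 0" "G.deg v = 1 \<longleftrightarrow> H.deg v' = 1"
      using cs size by auto
    then show ?thesis using le by linarith
  qed
  consider "G.deg v = 0" | "G.deg v = 1" | "G.deg v = 2" using le by linarith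
  then show ?thesis
  proof cases
    case 1
    have "arc_iso_on {v} E {v'} E' (\<lambda>_. v')"
      by (simp add: arc_iso_on_def bij_betw_def G.E_irrefl H.E_irrefl)
    then show ?thesis using G.deg0_comp[OF 1] H.deg0_comp[of v'] 1 deg by auto
  next
    case 2
    obtain w where w: "G.nb v = {w}" "G.nb w = {v}" "w \<noteq> v" "G.component v = {v, w}"
      by (rule G.deg1_comp[OF regG 2])
    have "H.deg v' = 1" using 2 deg by simp
    then obtain w' where w': "H.nb v' = {w'}" "H.nb w' = {v'}" "w' \<noteq> v'" "H.component v' = {v', w'}"
      by (rule H.deg1_comp[OF regH])
    have "(v, w) \<in> E" "(w, v) \<in> E" using w G.nb_iff by blast+
    moreover have "(v', w') \<in> E'" "(w', v') \<in> E'" using w' H.nb_iff by blast+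
    ultimately have "arc_iso_on {v, w} E {v', w'} E' (\<lambda>x. if x = v then v' else w')"
      using w(3) w'(3) by (auto simp: arc_iso_on_def bij_betw_def inj_on_def G.E_irrefl H.E_irrefl)
    then show ?thesis using w w' by auto
  next
    case 3
    then obtain \<gamma> where c: "G.covers \<gamma>" "\<gamma> 0 = v" by (rule G.covers_exists[OF regG])
    have "H.deg v' = 2" using 3 deg by simp
    then obtain \<gamma>' where c': "H.covers \<gamma>'" "\<gamma>' 0 = v'" by (rule H.covers_exists[OF regH])
    have eq: "\<gamma> i = \<gamma> j \<longleftrightarrow> \<gamma>' i = \<gamma>' j" for i j
      using G.covers_component_size(1)[OF c(1), of i j] H.covers_component_size(1)[OF c'(1), of i j] c(2) c'(2) size by simp
    define f where "f x = \<gamma>' (SOME i. \<gamma> i = x)" for x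
    have f: "f (\<gamma> i) = \<gamma>' i" for i
    proof -
      have "\<gamma> (SOME j. \<gamma> j = \<gamma> i) = \<gamma> i" by (rule someI) (rule refl)
      then show ?thesis by (simp add: f_def eq)
    qed
    have "bij_betw f (range \<gamma>) (range \<gamma>')"
      unfolding bij_betw_def inj_on_def by (auto simp: f eq image_iff)
    moreover have "(\<gamma> i, \<gamma> j) \<in> E \<longleftrightarrow> (\<gamma>' i, \<gamma>' j) \<in> E'" for i j
    proof -
      have "(\<gamma> i, \<gamma> j) \<in> E \<longleftrightarrow> \<gamma> j \<in> G.nb (\<gamma> i)" by simp
      also have "\<dots> \<longleftrightarrow> \<gamma>' j \<in> H.nb (\<gamma>' i)"
        by (simp add: G.covers_nb(1)[OF c(1)] H.covers_nb(1)[OF c'(1)] eq del: G.nb_iff H.nb_iff)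
      finally show ?thesis by simp
    qed
    ultimately have "arc_iso_on (range \<gamma>) E (range \<gamma>') E' f"
      by (auto simp: arc_iso_on_def f)
    then show ?thesis
      using G.covers_comp[OF c(1)] H.covers_comp[OF c'(1)] c(2) c'(2) by auto
  qed
qed

lemma (in simple_graph) remove_comp:
  assumes "v \<in> V" and S: points_edges_cycles
  defines "V1 \<equiv> V - component v" and "E1 \<equiv> E \<inter> (V - component v) \<times> (V - component v)"
  shows "simple_graph V1 E1" and "simple_graph.points_edges_cycles V1 E1"
    and "\<And>u. u \<in> V1 \<Longrightarrow> simple_graph.component_size E1 u = component_size u"
    and "\<And>u w. u \<in> V1 \<Longrightarrow> (u, w) \<in> E \<longleftrightarrow> (u, w) \<in> E1"
    and "card {u \<in> V1. simple_graph.component_size E1 u = c} + (if c = component_size v then c else 0) = card {u \<in> V. component_size u = c}"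
proof -
  have V1_iff: "x \<in> V1 \<longleftrightarrow> x \<in> V \<and> x \<notin> component v" for x by (simp add: V1_def)
  have E1_iff: "(x, y) \<in> E1 \<longleftrightarrow> (x, y) \<in> E \<and> x \<in> V1 \<and> y \<in> V1" for x y
    using E_sub by (auto simp: E1_def V1_def)
  have out: "w \<in> V1" if "u \<in> V1" "(u, w) \<in> E" for u w
  proof -
    have "w \<notin> component v"
    proof
      assume "w \<in> component v"
      then have "u \<in> component v" using comp_closed[of w v] E_sym[OF that(2)] by auto
      then show False using that(1) by (simp add: V1_def)
    qed
    then show ?thesis using that(2) E_sub by (auto simp: V1_def)
  qed
  show E1: "(u, w) \<in> E \<longleftrightarrow> (u, w) \<in> E1" if "u \<in> V1" for u w
    using that out[OF that, of w] unfolding E1_iff by blast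
  show sg: "simple_graph V1 E1"
  proof
    show "finite V1" using finite_V by (simp add: V1_def)
    show "E1 \<subseteq> V1 \<times> V1" by (auto simp: E1_iff)
    show "(w, u) \<in> E1" if "(u, w) \<in> E1" for u w
      using that E_sym[of u w] by (simp add: E1_iff)
    show "(u, u) \<notin> E1" for u using E_irrefl by (simp add: E1_iff)
  qed
  interpret S: simple_graph V1 E1 by (rule sg)
  have nb: "S.nb u = nb u" if "u \<in> V1" for u
    using E1[OF that] unfolding S.nb_def nb_def by blast
  have component: "S.component u = component u" if "u \<in> V1" for u
  proof
    show "S.component u \<subseteq> component u"
    proof (rule S.compI_closed)
      fix x assume "x \<in> component u"
      then show "S.nb x \<subseteq> component u" using comp_closed[of x u] unfolding S.nb_def nb_def E1_iff by blast
    qed simp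
    have "component u \<subseteq> S.component u \<inter> V1"
    proof (rule compI_closed)
      fix x assume "x \<in> S.component u \<inter> V1"
      then show "nb x \<subseteq> S.component u \<inter> V1"
        using S.comp_closed[of x u] nb[of x] S.nb_sub[of x] by (simp del: S.nb_iff nb_iff)
    qed (use that in simp)
    then show "component u \<subseteq> S.component u" by blast
  qed
  show cs: "S.component_size u = component_size u" if "u \<in> V1" for u
    using component[OF that] by (simp add: component_size_def S.component_size_def)
  have deg: "S.deg u = deg u" if "u \<in> V1" for u
    using nb[OF that] by (simp add: deg_def S.deg_def)
  show S.points_edges_cycles
    unfolding S.points_edges_cycles_def S.componentwise_regular_def
  proof (intro conjI ballI)
    fix p assume "p \<in> E1"
    then obtain u w where p: "p = (u, w)" "(u, w) \<in> E" "u \<in> V1" "w \<in> V1"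
      by (cases p) (simp add: E1_iff)
    have "deg u = deg w"
      using S p(2) by (auto simp: points_edges_cycles_def componentwise_regular_def)
    then show "case p of (u, w) \<Rightarrow> S.deg u = S.deg w"
      by (simp add: p(1) deg p(3,4))
  next
    fix u assume u: "u \<in> V1"
    then show "S.deg u \<le> 2" using S by (simp add: deg points_edges_cycles_def V1_iff)
  qed
  have same: "component_size u = component_size v" if "u \<in> component v" for u
    using comp_eq[OF that] by (simp add: component_size_def)
  define A where "A = {u \<in> V1. S.component_size u = c}"
  define B where "B = (if c = component_size v then component v else {})"
  have "{u \<in> V. component_size u = c} = A \<union> B"
  proof (rule Set.set_eqI)
    fix u
    show "u \<in> {u \<in> V. component_size u = c} \<longleftrightarrow> u \<in> A \<union> B"
      using comp_sub[OF assms(1)] cs[of u] same[of u] by (cases "u \<in> component v") (auto simp: A_def B_def V1_iff)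
  qed
  moreover have "card (A \<union> B) = card A + card B"
    using S.finite_V finite_comp[OF assms(1)] finite_subset[of A V1]
    by (intro card_Un_disjoint) (auto simp: A_def B_def V1_def)
  moreover have "card B = (if c = component_size v then c else 0)"
    by (simp add: B_def component_size_def)
  ultimately show "card {u \<in> V1. S.component_size u = c} + (if c = component_size v then c else 0) = card {u \<in> V. component_size u = c}"
    by (simp only: A_def)
qed

text \<open>Induction on the number of vertices: components of equal size are matched and removed.\<close>

lemma iso_from_component_size_counts:
  assumes "simple_graph V E" "simple_graph.points_edges_cycles V E"
    and "simple_graph V' E'" "simple_graph.points_edges_cycles V' E'"
    and "\<And>c. card {v \<in> V'. simple_graph.component_size E' v = c} = card {v \<in> V. simple_graph.component_size E v = c}"
  shows "\<exists>f. arc_iso_on V E V' E' f"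
  using assms
proof (induction "card V" arbitrary: V E V' E' rule: less_induct)
  case less
  interpret G: simple_graph V E by (rule less.prems)
  interpret H: simple_graph V' E' by (rule less.prems)
  show ?case
  proof (cases "V = {}")
    case True
    have "V' = {}"
    proof (rule ccontr)
      assume "V' \<noteq> {}"
      then obtain v' where v': "v' \<in> V'" by auto
      have "{v \<in> V'. H.component_size v = H.component_size v'} = {}"
        using less.prems(5)[of "H.component_size v'"] True H.finite_V by (simp add: card_eq_0_iff)
      then show False using v' by blast
    qed
    then show ?thesis using True by (auto simp: arc_iso_on_def bij_betw_def)
  next
    case False
    then obtain v where v: "v \<in> V" by auto
    have "card {x \<in> V'. H.component_size x = G.component_size v} \<noteq> 0"
      unfolding less.prems(5) using v G.finite_V by (auto simp: card_eq_0_iff)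
    then have "{x \<in> V'. H.component_size x = G.component_size v} \<noteq> {}" by (metis card.empty)
    then obtain v' where v': "v' \<in> V'" "H.component_size v' = G.component_size v" by blast
    define V1 where "V1 = V - G.component v"
    define E1 where "E1 = E \<inter> V1 \<times> V1"
    define V2 where "V2 = V' - H.component v'"
    define E2 where "E2 = E' \<inter> V2 \<times> V2"
    note R = G.remove_comp[OF v less.prems(2), folded V1_def, folded E1_def]
    note R' = H.remove_comp[OF v'(1) less.prems(4), folded V2_def, folded E2_def]
    have less_card: "card V1 < card V"
      using v G.finite_V G.comp_self[of v] unfolding V1_def by (intro psubset_card_mono) blast+
    have counts: "card {x \<in> V2. simple_graph.component_size E2 x = c} = card {x \<in> V1. simple_graph.component_size E1 x = c}" for c
      using R(5)[of c] R'(5)[of c] less.prems(5)[of c] v'(2) by simp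
    obtain f1 where f1: "arc_iso_on V1 E1 V2 E2 f1"
      using less.hyps[OF less_card R(1,2) R'(1,2) counts] by (rule exE)
    obtain f0 where f0: "arc_iso_on (G.component v) E (H.component v') E' f0"
      using comp_iso[OF less.prems(1,2) v less.prems(3,4) v'(1)] v'(2) by auto
    define f where "f x = (if x \<in> G.component v then f0 x else f1 x)" for x
    have V: "V = G.component v \<union> V1" "G.component v \<inter> V1 = {}" "V' = H.component v' \<union> V2" "H.component v' \<inter> V2 = {}"
      using G.comp_sub[OF v] H.comp_sub[OF v'(1)] by (auto simp: V1_def V2_def)
    have "bij_betw f (G.component v) (H.component v')"
      using f0 by (auto simp: arc_iso_on_def f_def cong: bij_betw_cong)
    moreover have "bij_betw f V1 V2"
    proof -
      have "bij_betw f V1 V2 = bij_betw f1 V1 V2"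
        by (rule bij_betw_cong) (auto simp: f_def V1_def)
      then show ?thesis using f1 by (simp add: arc_iso_on_def)
    qed
    ultimately have bij: "bij_betw f V V'"
      unfolding V(1,3) using V(4) by (rule bij_betw_combine)
    have "(x, y) \<in> E \<longleftrightarrow> (f x, f y) \<in> E'" if xy: "x \<in> V" "y \<in> V" for x y
    proof -
      have fc: "f u \<in> H.component v'" if "u \<in> G.component v" for u
        using that f0 by (auto simp: arc_iso_on_def f_def bij_betw_def)
      have fV: "f u = f1 u" "f u \<in> V2" if "u \<in> V1" for u
        using that f1 V by (auto simp: arc_iso_on_def f_def bij_betw_def)
      consider "x \<in> G.component v" "y \<in> G.component v" | "x \<in> G.component v" "y \<in> V1" | "x \<in> V1" "y \<in> G.component v" | "x \<in> V1" "y \<in> V1"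
        using xy V by auto
      then show ?thesis
      proof cases
        case 1
        then show ?thesis using f0 by (auto simp: arc_iso_on_def f_def)
      next
        case 2
        have "(x, y) \<notin> E" using G.comp_closed[OF 2(1)] 2(2) V by auto
        moreover have "(f x, f y) \<notin> E'" using H.comp_closed[OF fc[OF 2(1)]] fV(2)[OF 2(2)] V by auto
        ultimately show ?thesis by simp
      next
        case 3
        have "(x, y) \<notin> E" using R(4)[OF 3(1), of y] 3(2) V by (auto simp: E1_def)
        moreover have "(f x, f y) \<notin> E'" using R'(4)[OF fV(2)[OF 3(1)], of "f y"] fc[OF 3(2)] V by (auto simp: E2_def)
        ultimately show ?thesis by simp
      next
        case 4
        then show ?thesis
          using R(4)[OF 4(1), of y] R'(4)[OF fV(2)[OF 4(1)], of "f y"] f1 fV(1)[OF 4(1)] fV(1)[OF 4(2)]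
          by (auto simp: arc_iso_on_def)
      qed
    qed
    with bij show ?thesis by (auto simp: arc_iso_on_def)
  qed
qed

section \<open>Cospectral cones are isomorphic\<close>

text \<open>The base facts of the given cone enter as follows: together with the degree bound, absence of triangles makes the
  other graph a cone, independence of the edges excludes four-cycles in both bases, and regularity of the components is
  transferred by the fourth trace.\<close>

lemma (in cone) cospectral_iso:
  assumes H: "simple_graph V' E'"
    and n: "card V \<ge> 33"
    and good: base.points_edges_cycles base.triangle_free base.edge_independent "u0 \<in> W" "base.deg u0 = 0"
    and vs: "distinct vs" "set vs = V" and ws: "distinct ws" "set ws = V'"
    and len: "length vs = length ws"
    and cp: "char_poly (kernel_mat vs qmat) = char_poly (kernel_mat ws (simple_graph.qmat E'))"
    and tr: "\<And>k. kernel_trace V' (simple_graph.qmat E') k = kernel_trace V qmat k"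
  shows "\<exists>f. arc_iso_on V' E' V E f"
proof -
  have le2: "base.deg u \<le> 2" if "u \<in> W" for u
    using good(1) that by (simp add: base.points_edges_cycles_def)
  have regG: base.componentwise_regular
    using good(1) by (simp add: base.points_edges_cycles_def)
  have cV: "card V' = card V"
    using vs ws len by (metis distinct_card)
  obtain z' where z': "cone V' E' z'"
    and le2': "\<And>u. u \<in> cone.W V' z' \<Longrightarrow> simple_graph.deg (cone.base_E V' E' z') u \<le> 2"
    and tf': "simple_graph.triangle_free (cone.W V' z') (cone.base_E V' E' z')"
    and cnt: "\<And>i. card {u \<in> cone.W V' z'. simple_graph.deg (cone.base_E V' E' z') u = i}
                = card {u \<in> W. base.deg u = i}"
    by (rule cospectral_is_cone[OF le2 good(2) H cV n tr], assumption, rule that)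
  interpret H: cone V' E' z' by (rule z')
  have sums: "(\<Sum>u\<in>H.W. \<phi> (H.base.deg u)) = (\<Sum>u\<in>W. \<phi> (base.deg u))" for \<phi> :: "nat \<Rightarrow> real"
    using sum_by_counts[of H.W H.base.deg \<phi>, OF H.finite_W le2']
      sum_by_counts[of W base.deg \<phi>, OF finite_W le2] cnt by simp
  have cW: "card H.W = card W" using sums[of "\<lambda>_. 1"] by simp
  have "card H.base.edges = card base.edges"
    using sums[of real] H.base.handshake base.handshake by simp
  then have ind: H.base.edge_independent
    by (rule cospectral_edge_independent[OF z' good(3,4,5) vs ws len cp])
  have "H.base_defect = base_defect"
  proof -
    have "H.quartic_weight e = quartic_weight e" for e
      by (simp add: quartic_weight_def H.quartic_weight_def cW)
    then show ?thesis
      using tr[of 4] sums[of "\<lambda>i. quartic_weight (real i)"]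
        H.kernel_trace_4_cone[OF tf' H.base.edge_independent_four_cycle_free[OF ind]]
        kernel_trace_4_cone[OF good(2) base.edge_independent_four_cycle_free[OF good(3)]] cW
      by simp
  qed
  then have regH: H.base.componentwise_regular
    using regG H.base_defect_0_iff base_defect_0_iff by simp
  then have goodH: H.base.points_edges_cycles
    using le2' by (simp add: H.base.points_edges_cycles_def)
  have "kernel_trace H.W H.base.qmat1 j = kernel_trace W base.qmat1 j" for j
    by (rule base_traces_eq[OF z' regG regH sums tr])
  then have "card {v \<in> H.W. H.base.component_size v = c} = card {v \<in> W. base.component_size v = c}" for c
    by (rule component_size_counts_eq[OF base.simple_graph_axioms good(1) H.base.simple_graph_axioms goodH cnt cW])
  then obtain f where f: "arc_iso_on H.W H.base_E W base_E f"
    using iso_from_component_size_counts[OF H.base.simple_graph_axioms goodH base.simple_graph_axioms good(1)]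
    by metis
  define g where "g x = (if x = z' then z else f x)" for x
  have fW: "f x \<in> W" if "x \<in> H.W" for x
    using f that by (auto simp: arc_iso_on_def bij_betw_def)
  have gW: "g x = f x" if "x \<in> H.W" for x
    using that by (auto simp: g_def)
  have "bij_betw g H.W W"
    using f gW by (auto simp: arc_iso_on_def cong: bij_betw_cong)
  then have "bij_betw g (insert z' H.W) (insert (g z') W)"
    by (intro notIn_Un_bij_betw[where A = H.W and A' = W, simplified]) (auto simp: g_def)
  then have bij: "bij_betw g V' V"
    by (simp add: g_def flip: V_eq H.V_eq)
  moreover have "(x, y) \<in> E' \<longleftrightarrow> (g x, g y) \<in> E" if xy: "x \<in> V'" "y \<in> V'" for x y
  proof -
    consider "x = z'" "y = z'" | "x = z'" "y \<in> H.W" | "x \<in> H.W" "y = z'" | "x \<in> H.W" "y \<in> H.W"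
      using xy H.W_iff by blast
    then show ?thesis
    proof cases
      case 1
      then show ?thesis using E_irrefl H.E_irrefl by simp
    next
      case 2
      then show ?thesis using H.z_E(1)[OF 2(2)] z_E(1)[OF fW[OF 2(2)]] gW by (simp add: g_def)
    next
      case 3
      then show ?thesis using H.z_E(2)[OF 3(1)] z_E(2)[OF fW[OF 3(1)]] gW by (simp add: g_def)
    next
      case 4
      have "(x, y) \<in> E' \<longleftrightarrow> (x, y) \<in> H.base_E" using 4 by (simp add: H.base_E_iff)
      also have "\<dots> \<longleftrightarrow> (f x, f y) \<in> base_E" using f 4 by (simp add: arc_iso_on_def)
      also have "\<dots> \<longleftrightarrow> (g x, g y) \<in> E" using 4 fW gW by (simp add: base_E_iff)
      finally show ?thesis .
    qed
  qed
  ultimately show ?thesis by (auto simp: arc_iso_on_def)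
qed

section \<open>Isomorphisms of pair graphs\<close>

lemma digraph_iso_iff:
  assumes G: "pair_graph G" and H: "pair_graph H"
  shows "digraph_iso G H \<longleftrightarrow> (\<exists>f. arc_iso_on (pverts G) (parcs G) (pverts H) (parcs H) f)"
proof
  assume "digraph_iso G H"
  then obtain hom where hom: "pre_digraph.digraph_isomorphism (with_proj G) hom"
    and eq: "with_proj H = app_iso hom (with_proj G)"
    unfolding digraph_iso_def by blast
  have V: "pverts H = iso_verts hom ` pverts G" and A: "parcs H = iso_arcs hom ` parcs G"
    and t: "iso_tail hom = fst" and h: "iso_head hom = snd"
    using arg_cong[OF eq, of verts] arg_cong[OF eq, of arcs] arg_cong[OF eq, of tail] arg_cong[OF eq, of head]
    by simp_all
  have inj: "inj_on (iso_verts hom) (pverts G)"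
    and arc: "iso_arcs hom a = (iso_verts hom (fst a), iso_verts hom (snd a))" if "a \<in> parcs G" for a
    using hom that unfolding pre_digraph.digraph_isomorphism_def t h by (auto intro: prod_eqI)
  have inj: "inj_on (iso_verts hom) (pverts G)"
    using hom unfolding pre_digraph.digraph_isomorphism_def by simp
  have sub: "parcs G \<subseteq> pverts G \<times> pverts G" using G by (simp add: pair_graph_iff)
  have "(x, y) \<in> parcs G \<longleftrightarrow> (iso_verts hom x, iso_verts hom y) \<in> parcs H"
    if xy: "x \<in> pverts G" "y \<in> pverts G" for x y
  proof
    assume "(x, y) \<in> parcs G"
    then show "(iso_verts hom x, iso_verts hom y) \<in> parcs H"
      unfolding A using arc[of "(x, y)"] by (intro image_eqI[of _ _ "(x, y)"]) auto
  next
    assume "(iso_verts hom x, iso_verts hom y) \<in> parcs H"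
    then obtain a b where ab: "(a, b) \<in> parcs G" "iso_arcs hom (a, b) = (iso_verts hom x, iso_verts hom y)"
      unfolding A by force
    then have "iso_verts hom a = iso_verts hom x" "iso_verts hom b = iso_verts hom y"
      using arc[OF ab(1)] by auto
    moreover have "a \<in> pverts G" "b \<in> pverts G" using ab(1) sub by auto
    ultimately have "a = x" "b = y" using inj xy by (auto dest: inj_onD)
    then show "(x, y) \<in> parcs G" using ab(1) by simp
  qed
  then have "arc_iso_on (pverts G) (parcs G) (pverts H) (parcs H) (iso_verts hom)"
    using inj V by (simp add: arc_iso_on_def bij_betw_def)
  then show "\<exists>f. arc_iso_on (pverts G) (parcs G) (pverts H) (parcs H) f" by blast
next
  assume "\<exists>f. arc_iso_on (pverts G) (parcs G) (pverts H) (parcs H) f"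
  then obtain f where bij: "bij_betw f (pverts G) (pverts H)"
    and arc: "\<And>x y. x \<in> pverts G \<Longrightarrow> y \<in> pverts G \<Longrightarrow> (x, y) \<in> parcs G \<longleftrightarrow> (f x, f y) \<in> parcs H"
    unfolding arc_iso_on_def by blast
  interpret G: pair_graph G by (rule G)
  have subG: "parcs G \<subseteq> pverts G \<times> pverts G" and subH: "parcs H \<subseteq> pverts H \<times> pverts H"
    using G H by (simp_all add: pair_graph_iff)
  have inj: "inj_on f (pverts G)" and V: "f ` pverts G = pverts H"
    using bij by (auto simp: bij_betw_def)
  define hom where "hom = \<lparr>iso_verts = f, iso_arcs = map_prod f f, iso_head = snd, iso_tail = fst\<rparr>"
  have A: "map_prod f f ` parcs G = parcs H"
  proof
    show "map_prod f f ` parcs G \<subseteq> parcs H" using arc subG by auto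
    show "parcs H \<subseteq> map_prod f f ` parcs G"
    proof
      fix p assume p: "p \<in> parcs H"
      then obtain x y where xy: "p = (f x, f y)" "x \<in> pverts G" "y \<in> pverts G"
        using subH V by (cases p) blast
      then have "(x, y) \<in> parcs G" using arc p by simp
      then show "p \<in> map_prod f f ` parcs G" using xy(1) by force
    qed
  qed
  have "inj_on (map_prod f f) (parcs G)"
    using map_prod_inj_on[OF inj inj] subG by (rule inj_on_subset)
  then have "pre_digraph.digraph_isomorphism (with_proj G) hom"
    using inj G.wf_digraph_axioms by (simp add: pre_digraph.digraph_isomorphism_def hom_def)
  moreover have "with_proj H = app_iso hom (with_proj G)"
    by (simp add: app_iso_def hom_def with_proj_def V A)
  ultimately show "digraph_iso G H" unfolding digraph_iso_def by blast
qed

lemma arc_iso_on_trans: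
  assumes "arc_iso_on A E B F f" "arc_iso_on B F C D g"
  shows "arc_iso_on A E C D (g \<circ> f)"
  using assms bij_betw_trans[of f A B g C] unfolding arc_iso_on_def by (auto simp: bij_betw_def)

lemma arc_iso_on_inv:
  assumes "arc_iso_on A E B F f"
  shows "arc_iso_on B F A E (inv_into A f)"
proof -
  have bij: "bij_betw f A B" using assms by (simp add: arc_iso_on_def)
  then have "inv_into A f y \<in> A" "f (inv_into A f y) = y" if "y \<in> B" for y
    using that by (auto simp: bij_betw_def inv_into_into f_inv_into_f)
  then show ?thesis
    using assms bij_betw_inv_into[OF bij] by (simp add: arc_iso_on_def)
qed

lemma Q_spectrum_iso:
  assumes G: "pair_graph G" and H: "pair_graph H"
    and f: "arc_iso_on (pverts G) (parcs G) (pverts H) (parcs H) f"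
  shows "Q_spectrum G = Q_spectrum H"
proof -
  interpret G: simple_graph "pverts G" "parcs G" by (rule pair_graph_simple_graph[OF G])
  interpret H: simple_graph "pverts H" "parcs H" by (rule pair_graph_simple_graph[OF H])
  obtain vs where vs: "distinct vs" "set vs = pverts G"
    using finite_distinct_list[OF G.finite_V] by blast
  have bij: "bij_betw f (pverts G) (pverts H)"
    and arc: "\<And>x y. x \<in> pverts G \<Longrightarrow> y \<in> pverts G \<Longrightarrow> (x, y) \<in> parcs G \<longleftrightarrow> (f x, f y) \<in> parcs H"
    using f unfolding arc_iso_on_def by blast+
  have inj: "inj_on f (pverts G)" and img: "f ` pverts G = pverts H"
    using bij by (auto simp: bij_betw_def)
  have ws: "distinct (map f vs)" "set (map f vs) = pverts H"
    using vs inj img by (simp_all add: distinct_map)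
  have nb: "H.nb (f u) = f ` G.nb u" if u: "u \<in> pverts G" for u
  proof
    show "H.nb (f u) \<subseteq> f ` G.nb u"
    proof
      fix y assume y: "y \<in> H.nb (f u)"
      then obtain x where "y = f x" "x \<in> pverts G" using H.nb_sub[of "f u"] img by blast
      then show "y \<in> f ` G.nb u" using arc[OF u] y by simp
    qed
    show "f ` G.nb u \<subseteq> H.nb (f u)" using arc[OF u] G.nb_sub[of u] by auto
  qed
  have deg: "H.deg (f u) = G.deg u" if u: "u \<in> pverts G" for u
    unfolding H.deg_def G.deg_def nb[OF u]
    by (rule card_image) (rule inj_on_subset[OF inj G.nb_sub])
  have qmat: "H.qmat (f u) (f v) = G.qmat u v" if "u \<in> pverts G" "v \<in> pverts G" for u v
    using that arc[OF that] inj deg by (simp add: H.qmat_def G.qmat_def H.adj_def G.adj_def inj_on_eq_iff)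
  have "vs ! i \<in> pverts G" if "i < length vs" for i
    using vs(2) that nth_mem by blast
  then have "kernel_mat (map f vs) H.qmat = kernel_mat vs G.qmat"
    by (intro eq_matI) (auto simp: kernel_mat_def qmat)
  then show ?thesis
    unfolding Q_spectrum_eq[OF vs] Q_spectrum_eq[OF ws]
    by (simp add: signless_laplacian_kernel_mat G H vs ws)
qed

section \<open>The cone over odd cycles, edges and points\<close>

lemma cycle_graph_nb:
  assumes "j < n" "n \<ge> 3"
  shows "(j, j') \<in> parcs (cycle_graph n) \<longleftrightarrow>
    j' = (if j + 1 = n then 0 else j + 1) \<or> j' = (if j = 0 then n - 1 else j - 1)"
proof -
  have s: "(i + 1) mod n = (if i + 1 = n then 0 else i + 1)" if "i < n" for i
    using that by auto
  show ?thesis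
    using assms s[of j] s[of j'] by (cases "j' < n") (auto simp: cycle_graph_def split: if_splits)
qed

definition cone_graph_base ::
    "nat \<Rightarrow> nat \<Rightarrow> nat \<Rightarrow> (nat \<Rightarrow> nat) \<Rightarrow> (nat \<times> nat + nat \<times> nat + nat \<times> nat) pair_pre_digraph" where
  "cone_graph_base t q s k = disjoint_union (disjoint_Union {1..t} (\<lambda>i. cycle_graph (k i)))
     (disjoint_union (copies q (complete_graph 2)) (copies s (complete_graph 1)))"

definition cone_graph ::
    "nat \<Rightarrow> nat \<Rightarrow> nat \<Rightarrow> (nat \<Rightarrow> nat) \<Rightarrow>
      (nat + nat \<times> nat + nat \<times> nat + nat \<times> nat) pair_pre_digraph" where
  "cone_graph t q s k = graph_join (complete_graph 1) (cone_graph_base t q s k)"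

locale odd_cone =
  fixes t q s :: nat and k :: "nat \<Rightarrow> nat"
  assumes k: "\<And>i. i \<in> {1..t} \<Longrightarrow> k i \<ge> 4" "\<And>i. i \<in> {1..t} \<Longrightarrow> odd (k i)"
begin

abbreviation "X \<equiv> cone_graph t q s k"
abbreviation "Y \<equiv> cone_graph_base t q s k"

lemma k5: "i \<in> {1..t} \<Longrightarrow> k i \<ge> 5"
  using k[of i] by presburger

lemma pair_graph_X: "pair_graph X"
  unfolding cone_graph_def cone_graph_base_def
  by (intro pair_graph_graph_join pair_graph_disjoint_union pair_graph_disjoint_Union pair_graph_copies
      pair_graph_complete_graph pair_graph_cycle_graph finite_atLeastAtMost)
    (use k5 in fastforce)

sublocale X: simple_graph "pverts X" "parcs X"
  by (rule pair_graph_simple_graph[OF pair_graph_X])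

lemma verts_X: "pverts X = insert (Inl 0) (Inr ` pverts Y)"
  by (auto simp: cone_graph_def graph_join_def complete_graph_def)

lemma arcs_X:
  "(Inr a, Inr b) \<in> parcs X \<longleftrightarrow> (a, b) \<in> parcs Y"
  "(Inl 0, Inr b) \<in> parcs X \<longleftrightarrow> b \<in> pverts Y"
  by (auto simp: cone_graph_def graph_join_def complete_graph_def disjoint_union_def)

lemma verts_Y: "pverts Y = (\<lambda>(i, j). Inl (i, j)) ` (SIGMA i:{1..t}. {..<k i}) \<union>
    (\<lambda>(i, b). Inr (Inl (i, b))) ` ({..<q} \<times> {..<2}) \<union> (\<lambda>i. Inr (Inr (i, 0))) ` {..<s}"
  by (force simp: cone_graph_base_def disjoint_union_def disjoint_Union_def copies_def cycle_graph_def complete_graph_def)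

lemma arcs_Y:
  "(Inl (i, j), y) \<in> parcs Y \<longleftrightarrow> (\<exists>j'. y = Inl (i, j') \<and> i \<in> {1..t} \<and> (j, j') \<in> parcs (cycle_graph (k i)))"
  "(Inr (Inl (i, b)), y) \<in> parcs Y \<longleftrightarrow> (\<exists>b'. y = Inr (Inl (i, b')) \<and> i < q \<and> b < 2 \<and> b' < 2 \<and> b \<noteq> b')"
  "(Inr (Inr (i, b)), y) \<notin> parcs Y"
  by (auto simp: cone_graph_base_def disjoint_union_def disjoint_Union_def copies_def complete_graph_def)

sublocale X: cone "pverts X" "parcs X" "Inl 0"
proof
  show "X.cone_over (Inl 0)"
    unfolding X.cone_over_def by (auto simp: verts_X arcs_X)
qed

lemma W_X: "X.W = Inr ` pverts Y"
  unfolding X.W_def unfolding verts_X by auto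

lemma base_X: "(Inr a, y) \<in> X.base_E \<longleftrightarrow> (\<exists>b. y = Inr b \<and> (a, b) \<in> parcs Y)"
proof
  assume *: "(Inr a, y) \<in> X.base_E"
  then have "y \<in> X.W" by (simp add: X.base_E_iff)
  then obtain b where "y = Inr b" unfolding W_X by blast
  then show "\<exists>b. y = Inr b \<and> (a, b) \<in> parcs Y" using * by (simp add: X.base_E_iff arcs_X)
next
  assume "\<exists>b. y = Inr b \<and> (a, b) \<in> parcs Y"
  then obtain b where b: "y = Inr b" "(a, b) \<in> parcs Y" by blast
  then have *: "(Inr a, Inr b) \<in> parcs X" by (simp add: arcs_X)
  then have "Inr a \<in> pverts X" "Inr b \<in> pverts X" using X.E_sub by auto
  then show "(Inr a, y) \<in> X.base_E" using * b by (simp add: X.base_E_iff X.W_iff)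
qed

definition "succ i j = (if j + 1 = k i then 0 else j + 1 :: nat)"
definition "pred i j = (if j = 0 then k i - 1 else j - 1 :: nat)"

text \<open>The base vertices on cycles, on edges, and the isolated ones.\<close>

abbreviation "cv i j \<equiv> Inr (Inl (i, j))"
abbreviation "ev i b \<equiv> Inr (Inr (Inl (i, b)))"
abbreviation "pv i \<equiv> Inr (Inr (Inr (i, 0)))"

lemma nb_cv:
  assumes "i \<in> {1..t}" "j < k i"
  shows "X.base.nb (cv i j) = {cv i (succ i j), cv i (pred i j)}"
  using assms cycle_graph_nb[OF assms(2)] k5[OF assms(1)]
  by (auto simp: X.base.nb_def base_X arcs_Y succ_def pred_def)

lemma nb_ev:
  assumes "i < q" "b < 2"
  shows "X.base.nb (ev i b) = {ev i (1 - b)}"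
  using assms less_2_cases[OF assms(2)] by (auto simp: X.base.nb_def base_X arcs_Y)

lemma nb_pv: "X.base.nb (pv i) = {}"
  by (auto simp: X.base.nb_def base_X arcs_Y)

lemma W_cases:
  assumes "v \<in> X.W"
  obtains i j where "v = cv i j" "i \<in> {1..t}" "j < k i"
  | i b where "v = ev i b" "i < q" "b < 2"
  | i where "v = pv i" "i < s"
  using assms unfolding W_X verts_Y by auto

lemma succ_pred:
  assumes "i \<in> {1..t}" "j < k i"
  shows "succ i j < k i" "pred i j < k i" "succ i j \<noteq> pred i j" "succ i (pred i j) = j"
    "pred i (succ i j) = j" "succ i (succ i j) \<noteq> pred i j" "pred i (pred i j) \<noteq> succ i j"
    "succ i (succ i j) \<noteq> succ i j" "pred i (pred i j) \<noteq> pred i j" "j \<noteq> succ i j" "j \<noteq> pred i j"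
  using assms(2) k5[OF assms(1)] by (auto simp: succ_def pred_def)

lemma deg_X:
  "i \<in> {1..t} \<Longrightarrow> j < k i \<Longrightarrow> X.base.deg (cv i j) = 2"
  "i < q \<Longrightarrow> b < 2 \<Longrightarrow> X.base.deg (ev i b) = 1"
  "X.base.deg (pv i) = 0"
  using succ_pred(3) by (simp_all add: X.base.deg_def nb_cv nb_ev nb_pv)

lemma points_edges_cycles_X: "X.base.points_edges_cycles"
  unfolding X.base.points_edges_cycles_def X.base.componentwise_regular_def
proof (intro conjI ballI)
  fix p assume "p \<in> X.base_E"
  then obtain u v where p: "p = (u, v)" "(u, v) \<in> X.base_E" "u \<in> X.W" "v \<in> X.base.nb u"
    by (cases p) (auto simp: X.base_E_iff)
  have "X.base.deg u = X.base.deg v"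
    using p(3)
  proof (cases rule: W_cases)
    case (1 i j)
    then show ?thesis using p(4) succ_pred(1,2)[OF 1(2,3)] by (auto simp: nb_cv deg_X simp del: X.base.nb_iff)
  next
    case (2 i b)
    then show ?thesis using p(4) by (auto simp: nb_ev deg_X simp del: X.base.nb_iff)
  next
    case (3 i)
    then show ?thesis using p(4) by (auto simp: nb_pv simp del: X.base.nb_iff)
  qed
  then show "case p of (u, v) \<Rightarrow> X.base.deg u = X.base.deg v" by (simp add: p)
next
  fix v assume "v \<in> X.W"
  then show "X.base.deg v \<le> 2" by (cases rule: W_cases) (simp_all add: deg_X)
qed

lemma triangle_free_X: "X.base.triangle_free"
  unfolding X.base.triangle_free_def
proof
  fix v assume "v \<in> X.W"
  then show "X.base.triangles_at v = 0"
  proof (cases rule: W_cases)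
    case (1 i j)
    show ?thesis
      unfolding X.base.triangles_at_def X.base.codeg_def 1(1) nb_cv[OF 1(2,3)]
      using succ_pred[OF 1(2,3)] by (auto simp: nb_cv[OF 1(2)])
  next
    case (2 i b)
    then show ?thesis
      unfolding X.base.triangles_at_def X.base.codeg_def 2(1) nb_ev[OF 2(2,3)]
      by (cases "b = 0") (auto simp: nb_ev)
  next
    case (3 i)
    then show ?thesis by (simp add: X.base.triangles_at_def nb_pv del: X.base.nb_iff)
  qed
qed

text \<open>At a vertex of a cycle the weights of its two edges are opposite, so the weights alternate around the cycle; as its
  length is odd, each weight is its own negative.\<close>

lemma edge_independent_X: "X.base.edge_independent"
  unfolding X.base.edge_independent_def
proof (intro allI impI)
  fix c :: "(nat + nat \<times> nat + nat \<times> nat + nat \<times> nat) set \<Rightarrow> real"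
  assume c: "\<forall>v\<in>X.W. (\<Sum>w\<in>X.base.nb v. c {v, w}) = 0"
  have alternate: "c {cv i j, cv i (succ i j)} = 0" if i: "i \<in> {1..t}" and j: "j < k i" for i j
  proof -
    define y where "y j = c {cv i j, cv i (succ i j)}" for j
    have step: "y j = - y (pred i j)" if j: "j < k i" for j
    proof -
      have "cv i j \<in> X.W" using i j unfolding W_X verts_Y by force
      then have "(\<Sum>w\<in>X.base.nb (cv i j). c {cv i j, w}) = 0" using c by blast
      then have "c {cv i j, cv i (succ i j)} + c {cv i j, cv i (pred i j)} = 0"
        unfolding nb_cv[OF i j] using succ_pred(3)[OF i j] by simp
      moreover have "c {cv i j, cv i (pred i j)} = y (pred i j)"
        using succ_pred(4)[OF i j] by (simp add: y_def insert_commute)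
      ultimately show ?thesis by (simp add: y_def)
    qed
    have y: "y j = (- 1) ^ j * y 0" if "j < k i" for j
      using that
    proof (induction j)
      case (Suc j)
      then show ?case using step[of "Suc j"] by (simp add: pred_def)
    qed simp
    have "y 0 = - y (k i - 1)" using step[of 0] j by (simp add: pred_def)
    also have "y (k i - 1) = (- 1) ^ (k i - 1) * y 0" using y[of "k i - 1"] j by simp
    also have "even (k i - 1)" using k(2)[OF i] by simp
    then have "(- 1 :: real) ^ (k i - 1) = 1" by simp
    finally have "y 0 = 0" by simp
    then show ?thesis using y[OF j] by (simp add: y_def)
  qed
  show "\<forall>(u, v)\<in>X.base_E. c {u, v} = 0"
  proof (intro ballI)
    fix p assume "p \<in> X.base_E"
    then obtain u v where p: "p = (u, v)" "u \<in> X.W" "v \<in> X.base.nb u"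
      by (cases p) (auto simp: X.base_E_iff)
    have "c {u, v} = 0"
      using p(2)
    proof (cases rule: W_cases)
      case (1 i j)
      then consider "v = cv i (succ i j)" | "v = cv i (pred i j)"
        using p(3) unfolding 1(1) nb_cv[OF 1(2,3)] by blast
      then show ?thesis
      proof cases
        case 1
        then show ?thesis using alternate[of i j] \<open>u = cv i j\<close> \<open>i \<in> {1..t}\<close> \<open>j < k i\<close> by simp
      next
        case 2
        then show ?thesis
          using alternate[OF 1(2) succ_pred(2)[OF 1(2,3)]] succ_pred(4)[OF 1(2,3)] 1(1) by (simp add: insert_commute)
      qed
    next
      case (2 i b)
      have "(\<Sum>w\<in>X.base.nb u. c {u, w}) = 0" using c p(2) by blast
      then show ?thesis using p(3) unfolding 2(1) nb_ev[OF 2(2,3)] by simp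
    next
      case (3 i)
      then show ?thesis using p(3) unfolding 3(1) nb_pv by simp
    qed
    then show "case p of (u, v) \<Rightarrow> c {u, v} = 0" by (simp add: p)
  qed
qed

end

theorem theorem1p2:
  fixes t q s :: nat
    and k :: "nat \<Rightarrow> nat"
    and G :: "'a pair_pre_digraph"
  assumes "t \<ge> 2" and "q \<ge> 1" and "s \<ge> 1"
    and "\<And>i. i \<in> {1..t} \<Longrightarrow> k i \<ge> 4"
    and "pair_graph G"
    and "digraph_iso G
           (graph_join (complete_graph 1)
             (disjoint_union
               (disjoint_Union {1..t} (\<lambda>i. cycle_graph (k i)))
               (disjoint_union (copies q (complete_graph 2)) (copies s (complete_graph 1)))))"
    and "card (pverts G) \<ge> 33"
    and "\<And>i. i \<in> {1..t} \<Longrightarrow> odd (k i)"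
  shows "DQS TYPE('b) G"
  unfolding DQS_def
proof (intro allI impI)
  fix H :: "'b pair_pre_digraph"
  assume H: "pair_graph H" and cosp: "Q_cospectral H G"
  interpret odd_cone t q s k by unfold_locales (fact assms)+
  obtain f where f: "arc_iso_on (pverts G) (parcs G) (pverts X) (parcs X) f"
    using assms(6) unfolding cone_graph_def[symmetric] cone_graph_base_def[symmetric]
      digraph_iso_iff[OF assms(5) pair_graph_X] by blast
  have cosp': "Q_cospectral H X"
    using cosp Q_spectrum_iso[OF assms(5) pair_graph_X f] by (simp add: Q_cospectral_def)
  interpret H: simple_graph "pverts H" "parcs H" by (rule pair_graph_simple_graph[OF H])
  obtain ws where ws: "distinct ws" "set ws = pverts H"
    using finite_distinct_list[OF H.finite_V] by blast
  obtain vs where vs: "distinct vs" "set vs = pverts X"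
    using finite_distinct_list[OF X.finite_V] by blast
  note Q = Q_cospectral_char_poly[OF H ws pair_graph_X vs cosp']
  have "card (pverts X) = card (pverts G)"
    using f by (auto simp: arc_iso_on_def dest: bij_betw_same_card)
  then have n: "card (pverts X) \<ge> 33" using assms(7) by simp
  have "pv 0 \<in> X.W" using assms(3) unfolding W_X verts_Y by force
  then obtain g where g: "arc_iso_on (pverts H) (parcs H) (pverts X) (parcs X) g"
    using X.cospectral_iso[OF H.simple_graph_axioms n points_edges_cycles_X triangle_free_X edge_independent_X
        _ deg_X(3) vs ws Q(1)[symmetric] Q(2)[symmetric] Q(3)] by blast
  have "arc_iso_on (pverts H) (parcs H) (pverts G) (parcs G) (inv_into (pverts G) f \<circ> g)"
    by (rule arc_iso_on_trans[OF g arc_iso_on_inv[OF f]])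
  then show "digraph_iso H G"
    unfolding digraph_iso_iff[OF H assms(5)] by blast
qed

end
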